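(* Let $W$ be a finite Coxeter group and let $c$ be a Coxeter element of $W$. There exists a lattice congruence $\Theta_c$ of the weak order on $W$ such that the bottom elements (i.e. the unique minimal elements) of the congruence classes of $\Theta_c$ are exactly the $c$-sortable elements of $W$. In particular, the weak order on $c$-sortable elements (the subposet of the weak order on $W$ induced by the set of $c$-sortable elements) is a lattice quotient of the weak order on $W$: it is isomorphic to the quotient lattice of $W$ modulo $\Theta_c$.
   Context: A Coxeter group $W$ comes with a fixed finite set $S$ of simple generators and presentation $(st)^{m(s,t)}=1$ for $s,t\in S$, where $m(s,s)=1$ and $m(s,t)\ge 2$ for $s\ne t$. $l(w)$ is the length of $w$ with respect to $S$; a word in $S$ of length $l(w)$ representing $w$ is reduced. $T=\{wsw^{-1}:w\in W,s\in S\}$ is the set of reflections and $I(w)=\{t\in T:l(tw)<l(w)\}$ is the inversion set. The weak order is the right weak order: $v\le w$ iff $I(v)\subseteq I(w)$; equivalently its cover relations are $w\lessdot ws$ for $s\in S$ with $l(w)<l(ws)$. For $W$ finite it is a lattice. A Coxeter element $c$ of $W$ is an element represented by a word $a_1a_2\cdots a_n$ with $S=\{a_1,\ldots,a_n\}$ and $n=|S|$. Fix such a word for $c$ and form the half-infinite word $c^\infty=a_1\cdots a_n|a_1\cdots a_n|a_1\cdots a_n|\cdots$, where the dividers "$|$" are ignored when subwords are interpreted as elements of $W$. The $c$-sorting word for $w\in W$ is the lexicographically first (as a sequence of positions in $c^\infty$) subword of $c^\infty$ that is a reduced word for $w$. It defines a sequence of subsets of $S$: the sets of letters of the $c$-sorting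 word occurring between adjacent dividers. The element $w$ is $c$-sortable if this sequence is weakly decreasing under inclusion; this does not depend on the choice of reduced word for $c$. A congruence on a lattice $L$ is an equivalence relation $\equiv$ such that $a_1\equiv b_1$ and $a_2\equiv b_2$ imply $a_1\wedge a_2\equiv b_1\wedge b_2$ and $a_1\vee a_2\equiv b_1\vee b_2$. The quotient is the lattice of classes with induced meet and join. For a congruence on a finite lattice each congruence class has a unique minimal element, called its bottom element. *)

theory Defs
  imports "HOL-Algebra.Generated_Groups" "HOL-Algebra.Lattice" "HOL-Library.Extended_Nat"
begin

section \<open>Group presentations\<close>

text \<open>A letter \<open>(s, True)\<close> stands for \<open>s\<close> and \<open>(s, False)\<close> for its formal inverse.
  The relation \<open>equivclp (pres_step S R)\<close> is equality in the group \<open>\<langle>S | R\<rangle>\<close>.\<close>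

inductive pres_step :: "'a set \<Rightarrow> ('a \<times> bool) list set \<Rightarrow> ('a \<times> bool) list \<Rightarrow> ('a \<times> bool) list \<Rightarrow> bool"
  for S R where
    cancel: "s \<in> S \<Longrightarrow> pres_step S R (u @ [(s, b), (s, \<not> b)] @ v) (u @ v)"
  | relator: "r \<in> R \<Longrightarrow> pres_step S R (u @ r @ v) (u @ v)"

definition word_prod :: "('a, 'b) monoid_scheme \<Rightarrow> 'a list \<Rightarrow> 'a" where
  "word_prod W ws = foldr (\<otimes>\<^bsub>W\<^esub>) ws \<one>\<^bsub>W\<^esub>"

definition signed_prod :: "('a, 'b) monoid_scheme \<Rightarrow> ('a \<times> bool) list \<Rightarrow> 'a" where
  "signed_prod W u = word_prod W (map (\<lambda>(s, b). if b then s else inv\<^bsub>W\<^esub> s) u)"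

definition has_presentation ::
    "('a, 'b) monoid_scheme \<Rightarrow> 'a set \<Rightarrow> ('a \<times> bool) list set \<Rightarrow> bool" where
  "has_presentation W S R \<longleftrightarrow>
     generate W S = carrier W \<and>
     (\<forall>u \<in> lists (S \<times> UNIV). \<forall>v \<in> lists (S \<times> UNIV).
        signed_prod W u = signed_prod W v \<longleftrightarrow> equivclp (pres_step S R) u v)"


section \<open>Coxeter systems\<close>

text \<open>There is no relator for a pair with \<open>m s t = \<infinity>\<close>.\<close>

definition coxeter_relators :: "'a set \<Rightarrow> ('a \<Rightarrow> 'a \<Rightarrow> enat) \<Rightarrow> ('a \<times> bool) list set" where
  "coxeter_relators S m =
     {concat (replicate n [(s, True), (t, True)]) | s t n. s \<in> S \<and> t \<in> S \<and> m s t = enat n}"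

locale coxeter_system = group W for W (structure) +
  fixes S :: "'a set" and m :: "'a \<Rightarrow> 'a \<Rightarrow> enat"
  assumes finite_generators: "finite S"
    and generators_closed: "S \<subseteq> carrier W"
    and m_diag: "s \<in> S \<Longrightarrow> m s s = 1"
    and m_off_diag: "\<lbrakk>s \<in> S; t \<in> S; s \<noteq> t\<rbrakk> \<Longrightarrow> 2 \<le> m s t"
    and m_sym: "\<lbrakk>s \<in> S; t \<in> S\<rbrakk> \<Longrightarrow> m s t = m t s"
    and presentation: "has_presentation W S (coxeter_relators S m)"

definition cox_length :: "('a, 'b) monoid_scheme \<Rightarrow> 'a set \<Rightarrow> 'a \<Rightarrow> nat" where
  "cox_length W S w = (LEAST n. \<exists>ws \<in> lists S. length ws = n \<and> word_prod W ws = w)"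

definition reduced_word :: "('a, 'b) monoid_scheme \<Rightarrow> 'a set \<Rightarrow> 'a list \<Rightarrow> 'a \<Rightarrow> bool" where
  "reduced_word W S ws w \<longleftrightarrow>
     ws \<in> lists S \<and> word_prod W ws = w \<and> length ws = cox_length W S w"

definition reflections :: "('a, 'b) monoid_scheme \<Rightarrow> 'a set \<Rightarrow> 'a set" where
  "reflections W S = {w \<otimes>\<^bsub>W\<^esub> s \<otimes>\<^bsub>W\<^esub> inv\<^bsub>W\<^esub> w | w s. w \<in> carrier W \<and> s \<in> S}"

definition inversions :: "('a, 'b) monoid_scheme \<Rightarrow> 'a set \<Rightarrow> 'a \<Rightarrow> 'a set" where
  "inversions W S w =
     {t \<in> reflections W S. cox_length W S (t \<otimes>\<^bsub>W\<^esub> w) < cox_length W S w}"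

definition weak_order :: "('a, 'b) monoid_scheme \<Rightarrow> 'a set \<Rightarrow> 'a gorder" where
  "weak_order W S =
     \<lparr>carrier = carrier W, eq = (=), le = (\<lambda>v w. inversions W S v \<subseteq> inversions W S w)\<rparr>"


section \<open>Coxeter elements and sortable elements\<close>

definition coxeter_word :: "('a, 'b) monoid_scheme \<Rightarrow> 'a set \<Rightarrow> 'a \<Rightarrow> 'a list \<Rightarrow> bool" where
  "coxeter_word W S c as \<longleftrightarrow> set as = S \<and> length as = card S \<and> word_prod W as = c"

definition coxeter_element :: "('a, 'b) monoid_scheme \<Rightarrow> 'a set \<Rightarrow> 'a \<Rightarrow> bool" where
  "coxeter_element W S c \<longleftrightarrow> (\<exists>as. coxeter_word W S c as)"

text \<open>Positions in the half-infinite word are counted from 0, so the dividers separate the blocks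
  of positions with equal \<open>i div length as\<close>. If \<open>as\<close> is empty, then so is \<open>S\<close>, and
  the only reduced word is the empty one; the letters \<open>c_inf [] i\<close> are then never used.\<close>

definition c_inf :: "'a list \<Rightarrow> nat \<Rightarrow> 'a" where
  "c_inf as i = as ! (i mod length as)"

definition reduced_positions ::
    "('a, 'b) monoid_scheme \<Rightarrow> 'a set \<Rightarrow> 'a list \<Rightarrow> 'a \<Rightarrow> nat list set" where
  "reduced_positions W S as w =
     {ps. sorted_wrt (<) ps \<and> reduced_word W S (map (c_inf as) ps) w}"

text \<open>The sorting word itself is \<open>map (c_inf as) ps\<close> for the unique such \<open>ps\<close>.\<close>

definition is_sorting_positions ::
    "('a, 'b) monoid_scheme \<Rightarrow> 'a set \<Rightarrow> 'a list \<Rightarrow> 'a \<Rightarrow> nat list \<Rightarrow> bool" where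
  "is_sorting_positions W S as w ps \<longleftrightarrow>
     ps \<in> reduced_positions W S as w \<and>
     (\<forall>qs \<in> reduced_positions W S as w. qs \<noteq> ps \<longrightarrow> (ps, qs) \<in> lexord {(i, j). i < j})"

definition sorting_block :: "'a list \<Rightarrow> nat list \<Rightarrow> nat \<Rightarrow> 'a set" where
  "sorting_block as ps k = c_inf as ` {i \<in> set ps. i div length as = k}"

text \<open>Whether the blocks decrease does not depend on the word \<open>as\<close> chosen for \<open>c\<close>.\<close>

definition c_sortable :: "('a, 'b) monoid_scheme \<Rightarrow> 'a set \<Rightarrow> 'a \<Rightarrow> 'a \<Rightarrow> bool" where
  "c_sortable W S c w \<longleftrightarrow>
     w \<in> carrier W \<and>
     (\<exists>as ps. coxeter_word W S c as \<and> is_sorting_positions W S as w ps \<and>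
              antimono (sorting_block as ps))"


section \<open>Lattice congruences and quotients\<close>

locale lattice_congruence = lattice L for L (structure) +
  fixes \<Theta> :: "('a \<times> 'a) set"
  assumes equivalence: "equiv (carrier L) \<Theta>"
    and meet_compatible:
      "\<lbrakk>(a1, b1) \<in> \<Theta>; (a2, b2) \<in> \<Theta>\<rbrakk> \<Longrightarrow> (a1 \<sqinter> a2, b1 \<sqinter> b2) \<in> \<Theta>"
    and join_compatible:
      "\<lbrakk>(a1, b1) \<in> \<Theta>; (a2, b2) \<in> \<Theta>\<rbrakk> \<Longrightarrow> (a1 \<squnion> a2, b1 \<squnion> b2) \<in> \<Theta>"

definition minimal_in :: "('a, 'b) gorder_scheme \<Rightarrow> 'a set \<Rightarrow> 'a \<Rightarrow> bool" where
  "minimal_in L X x \<longleftrightarrow> x \<in> X \<and> (\<forall>y \<in> X. y \<sqsubseteq>\<^bsub>L\<^esub> x \<longrightarrow> y = x)"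

definition bottom_elements :: "('a, 'b) gorder_scheme \<Rightarrow> ('a \<times> 'a) set \<Rightarrow> 'a set" where
  "bottom_elements L \<Theta> = {x. \<exists>X \<in> carrier L // \<Theta>. \<forall>y. minimal_in L X y \<longleftrightarrow> y = x}"

definition quotient_meet ::
    "('a, 'b) gorder_scheme \<Rightarrow> ('a \<times> 'a) set \<Rightarrow> 'a set \<Rightarrow> 'a set \<Rightarrow> 'a set" where
  "quotient_meet L \<Theta> X Y = (\<Union>x \<in> X. \<Union>y \<in> Y. \<Theta> `` {x \<sqinter>\<^bsub>L\<^esub> y})"

definition quotient_join ::
    "('a, 'b) gorder_scheme \<Rightarrow> ('a \<times> 'a) set \<Rightarrow> 'a set \<Rightarrow> 'a set \<Rightarrow> 'a set" where
  "quotient_join L \<Theta> X Y = (\<Union>x \<in> X. \<Union>y \<in> Y. \<Theta> `` {x \<squnion>\<^bsub>L\<^esub> y})"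

text \<open>The order of the quotient is the one belonging to the induced meet; the lemmas below show
  that this makes the classes a lattice whose meet and join are the induced ones.\<close>

definition quotient_lattice :: "('a, 'b) gorder_scheme \<Rightarrow> ('a \<times> 'a) set \<Rightarrow> 'a set gorder" where
  "quotient_lattice L \<Theta> =
     \<lparr>carrier = carrier L // \<Theta>, eq = (=), le = (\<lambda>X Y. quotient_meet L \<Theta> X Y = X)\<rparr>"

context lattice_congruence
begin

lemma quotient_meet_class:
  assumes x: "x \<in> carrier L" and y: "y \<in> carrier L"
  shows "quotient_meet L \<Theta> (\<Theta> `` {x}) (\<Theta> `` {y}) = \<Theta> `` {x \<sqinter> y}"
proof -
  have "congruent2 \<Theta> \<Theta> (\<lambda>x y. \<Theta> `` {x \<sqinter> y})"
    by (intro congruent2I' equiv_class_eq[OF equivalence] meet_compatible)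
  from UN_equiv_class2[OF equivalence equivalence this x y]
  show ?thesis by (simp add: quotient_meet_def)
qed

lemma quotient_join_class:
  assumes x: "x \<in> carrier L" and y: "y \<in> carrier L"
  shows "quotient_join L \<Theta> (\<Theta> `` {x}) (\<Theta> `` {y}) = \<Theta> `` {x \<squnion> y}"
proof -
  have "congruent2 \<Theta> \<Theta> (\<lambda>x y. \<Theta> `` {x \<squnion> y})"
    by (intro congruent2I' equiv_class_eq[OF equivalence] join_compatible)
  from UN_equiv_class2[OF equivalence equivalence this x y]
  show ?thesis by (simp add: quotient_join_def)
qed

lemma class_eq_iff:
  assumes "x \<in> carrier L" "y \<in> carrier L"
  shows "\<Theta> `` {x} = \<Theta> `` {y} \<longleftrightarrow> (x, y) \<in> \<Theta>"
  using assms equivalence by (simp add: eq_equiv_class_iff)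

lemma theta_refl: "x \<in> carrier L \<Longrightarrow> (x, x) \<in> \<Theta>"
  using equivalence by (auto simp: equiv_def refl_on_def)

lemma theta_sym: "(x, y) \<in> \<Theta> \<Longrightarrow> (y, x) \<in> \<Theta>"
  using equivalence by (auto simp: equiv_def dest: symD)

lemma theta_trans: "(x, y) \<in> \<Theta> \<Longrightarrow> (y, z) \<in> \<Theta> \<Longrightarrow> (x, z) \<in> \<Theta>"
  using equivalence by (auto simp: equiv_def dest: transD)

lemma absorb_join: "x \<in> carrier L \<Longrightarrow> y \<in> carrier L \<Longrightarrow> x \<sqinter> (x \<squnion> y) = x"
  using le_iff_join[THEN iffD1, OF _ _ join_left] by (metis join_closed)

lemma absorb_meet: "x \<in> carrier L \<Longrightarrow> y \<in> carrier L \<Longrightarrow> (x \<sqinter> y) \<squnion> y = y"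
  using le_iff_meet[THEN iffD1, OF _ _ meet_right] by (metis meet_closed)

lemma quotient_le_class:
  assumes "x \<in> carrier L" "y \<in> carrier L"
  shows "\<Theta> `` {x} \<sqsubseteq>\<^bsub>quotient_lattice L \<Theta>\<^esub> \<Theta> `` {y} \<longleftrightarrow> (x \<sqinter> y, x) \<in> \<Theta>"
  using assms by (simp add: quotient_lattice_def quotient_meet_class class_eq_iff)

lemma theta_meet_join:
  assumes "x \<in> carrier L" "y \<in> carrier L"
  shows "(x \<sqinter> y, x) \<in> \<Theta> \<longleftrightarrow> (x \<squnion> y, y) \<in> \<Theta>"
proof
  assume "(x \<sqinter> y, x) \<in> \<Theta>"
  from join_compatible[OF this theta_refl[OF assms(2)]]
  show "(x \<squnion> y, y) \<in> \<Theta>" using assms by (simp add: absorb_meet theta_sym)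
next
  assume "(x \<squnion> y, y) \<in> \<Theta>"
  from meet_compatible[OF theta_refl[OF assms(1)] this]
  show "(x \<sqinter> y, x) \<in> \<Theta>" using assms by (simp add: absorb_join theta_sym)
qed

lemma quotient_partial_order: "partial_order (quotient_lattice L \<Theta>)"
proof -
  let ?Q = "quotient_lattice L \<Theta>"
  have car: "\<exists>x \<in> carrier L. X = \<Theta> `` {x}" if "X \<in> carrier ?Q" for X
    using that by (auto simp: quotient_lattice_def elim: quotientE)
  have eq: "(.=\<^bsub>?Q\<^esub>) = (=)" by (simp add: quotient_lattice_def)
  show ?thesis
  proof (unfold_locales, unfold eq)
    fix X assume "X \<in> carrier ?Q"
    then obtain x where x: "x \<in> carrier L" "X = \<Theta> `` {x}" using car by blast
    moreover have "x \<sqinter> x = x" using x le_iff_join[of x x] by simp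
    ultimately show "X \<sqsubseteq>\<^bsub>?Q\<^esub> X" by (simp add: quotient_le_class theta_refl)
  next
    fix X Y assume le: "X \<sqsubseteq>\<^bsub>?Q\<^esub> Y" "Y \<sqsubseteq>\<^bsub>?Q\<^esub> X" and "X \<in> carrier ?Q" "Y \<in> carrier ?Q"
    then obtain x y where x: "x \<in> carrier L" "X = \<Theta> `` {x}" and y: "y \<in> carrier L" "Y = \<Theta> `` {y}"
      using car by blast
    then have "(x \<sqinter> y, x) \<in> \<Theta>" "(y \<sqinter> x, y) \<in> \<Theta>" using le by (simp_all add: quotient_le_class)
    then have "(x, y) \<in> \<Theta>" by (metis meet_comm theta_sym theta_trans)
    then show "X = Y" using x y class_eq_iff by blast
  next
    fix X Y Z assume le: "X \<sqsubseteq>\<^bsub>?Q\<^esub> Y" "Y \<sqsubseteq>\<^bsub>?Q\<^esub> Z"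
      and "X \<in> carrier ?Q" "Y \<in> carrier ?Q" "Z \<in> carrier ?Q"
    then obtain x y z where x: "x \<in> carrier L" "X = \<Theta> `` {x}" and y: "y \<in> carrier L" "Y = \<Theta> `` {y}"
      and z: "z \<in> carrier L" "Z = \<Theta> `` {z}" using car by metis
    then have 1: "(x \<sqinter> y, x) \<in> \<Theta>" and 2: "(y \<sqinter> z, y) \<in> \<Theta>"
      using le by (simp_all add: quotient_le_class)
    have "((x \<sqinter> y) \<sqinter> z, x \<sqinter> z) \<in> \<Theta>" using meet_compatible[OF 1 theta_refl] z by simp
    moreover have "(x \<sqinter> (y \<sqinter> z), x \<sqinter> y) \<in> \<Theta>" using meet_compatible[OF theta_refl 2] x by simp
    moreover have "(x \<sqinter> y) \<sqinter> z = x \<sqinter> (y \<sqinter> z)" using x y z by (simp add: meet_assoc)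
    ultimately have "(x \<sqinter> z, x) \<in> \<Theta>" using 1 by (metis theta_sym theta_trans)
    then show "X \<sqsubseteq>\<^bsub>?Q\<^esub> Z" using x z by (simp add: quotient_le_class)
  qed auto
qed

lemma quotient_greatest:
  assumes x: "x \<in> carrier L" and y: "y \<in> carrier L"
  shows "greatest (quotient_lattice L \<Theta>) (\<Theta> `` {x \<sqinter> y})
           (Lower (quotient_lattice L \<Theta>) {\<Theta> `` {x}, \<Theta> `` {y}})" (is "greatest ?Q _ _")
proof (rule greatest_LowerI)
  fix Z assume "Z \<in> {\<Theta> `` {x}, \<Theta> `` {y}}"
  moreover have "(x \<sqinter> y) \<sqinter> x = x \<sqinter> y" "(x \<sqinter> y) \<sqinter> y = x \<sqinter> y"
    using le_iff_join[THEN iffD1, OF _ _ meet_left[OF x y]] le_iff_join[THEN iffD1, OF _ _ meet_right[OF x y]]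
      x y meet_closed by auto
  ultimately show "\<Theta> `` {x \<sqinter> y} \<sqsubseteq>\<^bsub>?Q\<^esub> Z"
    using x y by (auto simp: quotient_le_class theta_refl)
next
  fix Z assume Z: "Z \<in> Lower ?Q {\<Theta> `` {x}, \<Theta> `` {y}}"
  then have "Z \<in> carrier ?Q" by (simp add: Lower_def)
  then obtain z where z: "z \<in> carrier L" "Z = \<Theta> `` {z}"
    by (auto simp: quotient_lattice_def elim: quotientE)
  have "\<Theta> `` {x} \<in> carrier ?Q" "\<Theta> `` {y} \<in> carrier ?Q"
    using x y by (auto simp: quotient_lattice_def quotientI)
  then have "Z \<sqsubseteq>\<^bsub>?Q\<^esub> \<Theta> `` {x}" "Z \<sqsubseteq>\<^bsub>?Q\<^esub> \<Theta> `` {y}" using Z by (auto simp: Lower_def)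
  then have 1: "(z \<sqinter> x, z) \<in> \<Theta>" and 2: "(z \<sqinter> y, z) \<in> \<Theta>"
    using x y z by (simp_all add: quotient_le_class)
  have "((z \<sqinter> x) \<sqinter> y, z \<sqinter> y) \<in> \<Theta>" using meet_compatible[OF 1 theta_refl] y by simp
  then have "(z \<sqinter> (x \<sqinter> y), z) \<in> \<Theta>" using 2 x y z by (metis meet_assoc theta_trans)
  then show "Z \<sqsubseteq>\<^bsub>?Q\<^esub> \<Theta> `` {x \<sqinter> y}" using x y z by (simp add: quotient_le_class)
qed (use x y in \<open>auto simp: quotient_lattice_def quotientI\<close>)

lemma quotient_least:
  assumes x: "x \<in> carrier L" and y: "y \<in> carrier L"
  shows "least (quotient_lattice L \<Theta>) (\<Theta> `` {x \<squnion> y})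
           (Upper (quotient_lattice L \<Theta>) {\<Theta> `` {x}, \<Theta> `` {y}})" (is "least ?Q _ _")
proof (rule least_UpperI)
  fix Z assume "Z \<in> {\<Theta> `` {x}, \<Theta> `` {y}}"
  moreover have "x \<sqinter> (x \<squnion> y) = x" "y \<sqinter> (x \<squnion> y) = y"
    using x y by (metis absorb_join join_comm)+
  ultimately show "Z \<sqsubseteq>\<^bsub>?Q\<^esub> \<Theta> `` {x \<squnion> y}"
    using x y by (auto simp: quotient_le_class theta_refl)
next
  fix Z assume Z: "Z \<in> Upper ?Q {\<Theta> `` {x}, \<Theta> `` {y}}"
  then have "Z \<in> carrier ?Q" by (simp add: Upper_def)
  then obtain z where z: "z \<in> carrier L" "Z = \<Theta> `` {z}"
    by (auto simp: quotient_lattice_def elim: quotientE)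
  have "\<Theta> `` {x} \<in> carrier ?Q" "\<Theta> `` {y} \<in> carrier ?Q"
    using x y by (auto simp: quotient_lattice_def quotientI)
  then have "\<Theta> `` {x} \<sqsubseteq>\<^bsub>?Q\<^esub> Z" "\<Theta> `` {y} \<sqsubseteq>\<^bsub>?Q\<^esub> Z" using Z by (auto simp: Upper_def)
  then have 1: "(x \<squnion> z, z) \<in> \<Theta>" and 2: "(y \<squnion> z, z) \<in> \<Theta>"
    using x y z by (simp_all add: quotient_le_class theta_meet_join)
  have "(x \<squnion> (y \<squnion> z), x \<squnion> z) \<in> \<Theta>" using join_compatible[OF theta_refl 2] x by simp
  then have "((x \<squnion> y) \<squnion> z, z) \<in> \<Theta>" using 1 x y z by (metis join_assoc theta_trans)
  then show "\<Theta> `` {x \<squnion> y} \<sqsubseteq>\<^bsub>?Q\<^esub> Z"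
    using x y z by (simp add: quotient_le_class theta_meet_join)
qed (use x y in \<open>auto simp: quotient_lattice_def quotientI\<close>)

lemma quotient_is_lattice: "lattice (quotient_lattice L \<Theta>)" (is "lattice ?Q")
proof -
  interpret Q: partial_order ?Q by (rule quotient_partial_order)
  have car: "\<exists>x \<in> carrier L. X = \<Theta> `` {x}" if "X \<in> carrier ?Q" for X
    using that by (auto simp: quotient_lattice_def elim: quotientE)
  show ?thesis
    by unfold_locales (metis car quotient_least, metis car quotient_greatest)
qed

lemma quotient_meet_join:
  assumes X: "X \<in> carrier (quotient_lattice L \<Theta>)" and Y: "Y \<in> carrier (quotient_lattice L \<Theta>)"
  shows "X \<sqinter>\<^bsub>quotient_lattice L \<Theta>\<^esub> Y = quotient_meet L \<Theta> X Y"
    and "X \<squnion>\<^bsub>quotient_lattice L \<Theta>\<^esub> Y = quotient_join L \<Theta> X Y"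
proof -
  let ?Q = "quotient_lattice L \<Theta>"
  interpret Q: lattice ?Q by (rule quotient_is_lattice)
  obtain x y where x: "x \<in> carrier L" "X = \<Theta> `` {x}" and y: "y \<in> carrier L" "Y = \<Theta> `` {y}"
    using X Y by (auto simp: quotient_lattice_def elim!: quotientE)
  show "X \<sqinter>\<^bsub>?Q\<^esub> Y = quotient_meet L \<Theta> X Y"
    using Q.meetI[of X Y "\<lambda>z. z = quotient_meet L \<Theta> X Y"] X Y
      Q.greatest_unique[OF _ quotient_greatest[OF x(1) y(1)]] x y quotient_meet_class by metis
  show "X \<squnion>\<^bsub>?Q\<^esub> Y = quotient_join L \<Theta> X Y"
    using Q.joinI[of X Y "\<lambda>z. z = quotient_join L \<Theta> X Y"] X Y
      Q.least_unique[OF _ quotient_least[OF x(1) y(1)]] x y quotient_join_class by metis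
qed

end

text \<open>\<open>join_pres\<close> and \<open>meet_pres\<close> include that both structures are lattices.\<close>

definition lattice_isomorphic :: "('a, 'c) gorder_scheme \<Rightarrow> ('b, 'd) gorder_scheme \<Rightarrow> bool" where
  "lattice_isomorphic L M \<longleftrightarrow>
     (\<exists>f. bij_betw f (carrier L) (carrier M) \<and> meet_pres L M f \<and> join_pres L M f)"

end

theory Submission
  imports Defs Complex_Main
begin

text \<open>Everything is read off from the root system. The set \<open>N w\<close> of positive roots that \<open>w\<inverse>\<close>
makes negative corresponds to the inversion set of \<open>w\<close>, so the weak order is inclusion of the sets
\<open>N w\<close>, and the theorem amounts to the sortable elements being the image of an interior operator of
the weak order that preserves joins.

A word \<open>a\<^sub>1 \<dots> a\<^sub>n\<close> for \<open>c\<close> defines the Euler form \<open>E\<close>: on simple roots, \<open>E(\<alpha>\<^sub>i, \<alpha>\<^sub>j)\<close> is \<open>1\<close> for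
\<open>i = j\<close>, the Cartan entry if \<open>i\<close> comes before \<open>j\<close>, and \<open>0\<close> otherwise. Its symmetrization is the invariant
form; let \<open>\<omega>(f, g) = E(g, f) - E(f, g)\<close>. Call \<open>w\<close> aligned if \<open>f\<close> is in \<open>N w\<close> whenever a positive combination
of positive roots \<open>f\<close> and \<open>g\<close> with \<open>\<omega>(f, g) > 0\<close> is in \<open>N w\<close>; compare the closure
of torsion classes of quiver representations under quotients. The proof has four parts.

(1) Aligned elements are the sortable ones. Both classes obey the same recursion on the first letter
\<open>s\<close> of the word: if \<open>s \<le> w\<close>, then \<open>w\<close> belongs to the class iff \<open>s w\<close> does for the word in which \<open>s\<close>
has moved to the end (\<open>aligned_shift\<close>, because \<open>E\<close> is invariant under this rotation); otherwise \<open>w\<close>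
belongs to the class iff it does for the word without \<open>s\<close>. For aligned elements the second rule needs
that \<open>w\<close> lies in the parabolic subgroup without \<open>s\<close> (\<open>aligned_avoids_first\<close>), which is the
place where the triangular shape of \<open>E\<close> is used. The sortable side is bookkeeping with positions.
Moreover \<open>E\<close> depends only on \<open>c\<close>, because two words for \<open>c\<close> differ by commutations
(\<open>euler_depends_on_product\<close>).

(2) Below every \<open>w\<close> there is a greatest aligned element, called \<open>proj w\<close> here
(\<open>ex_greatest_aligned\<close>). By the recursion the only problem is an aligned \<open>u \<le> w\<close> with \<open>s \<le> w\<close>
but not \<open>s \<le> u\<close>. It is solved with \<open>Y = s \<or> u\<close>, which covers \<open>s Y\<close>. In the rotated word \<open>s\<close> is the last
letter, and an aligned element above the last letter can lose that letter without any other change to its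
inversions (\<open>aligned_last_descent\<close>). Let \<open>v'\<close> be the greatest element below \<open>s Y\<close> that is aligned for the
rotated word, which exists by induction. Then any element below \<open>Y\<close> that is aligned for this word and lies above \<open>s\<close>
and \<open>v'\<close> inverts only \<open>\<alpha>\<^sub>s\<close> in addition to the inversions of \<open>v'\<close>, and is \<open>s v'\<close> (\<open>cover_by_last\<close>).
Such an element is found by a further step of the recursion, so \<open>u \<le> v' \<le> s v'\<close>, and \<open>s v'\<close> is aligned and above \<open>s\<close>.

(3) The map \<open>proj\<close> preserves joins (\<open>proj_wjoin\<close>). The recursion reduces this to
\<open>proj (s \<or> y) \<le> s \<or> proj y\<close> for \<open>y\<close> not above \<open>s\<close>. The element \<open>v = proj (s \<or> y)\<close> covers \<open>s v\<close>. To
each aligned element belongs a set of signed roots, its walls, which contains the negatives of all roots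
that are lost in going down a cover from it, and any two of which are \<open>E\<close>-orthogonal in at least one order
(\<open>wall_orthogonal\<close>, \<open>lower_wall\<close>). If \<open>\<beta>\<close> is a root other than \<open>\<alpha>\<^sub>s\<close> lost in going down a cover from \<open>v\<close>, then
\<open>E(\<beta>, \<alpha>\<^sub>s)\<close> is the coefficient of \<open>\<alpha>\<^sub>s\<close> in \<open>\<beta>\<close>. Were it nonzero, then \<open>E(\<alpha>\<^sub>s, \<beta>) = 0\<close>, so the inner product
of \<open>\<alpha>\<^sub>s\<close> and \<open>\<beta>\<close> would be positive, which is impossible for two walls of a chamber. Thus every root other than \<open>\<alpha>\<^sub>s\<close> that
is lost in going down a cover from \<open>v\<close> lies in the parabolic subgroup without \<open>s\<close>, which makes \<open>v\<close> the join of \<open>s\<close>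
with its parabolic part; and the parabolic part of \<open>s \<or> y\<close> is below \<open>y\<close>.

(4) An interior operator that preserves joins has a congruence as its kernel. The bottom elements of this
congruence are the fixed points, and the fixed points with the induced order are isomorphic to the quotient lattice.

The facts about Coxeter groups that enter are derived from the presentation: it provides the geometric
representation, and splitting off dihedral subgroups shows that every root is positive or negative.\<close>

section \<open>Coefficient vectors and the dihedral recursion\<close>

definition comb :: "real \<Rightarrow> ('a \<Rightarrow> real) \<Rightarrow> real \<Rightarrow> ('a \<Rightarrow> real) \<Rightarrow> 'a \<Rightarrow> real" where
  "comb a f b g = (\<lambda>i. a * f i + b * g i)"

lemma uminus_uminus_fun [simp]: "- (- f) = (f :: 'a \<Rightarrow> real)"
  by (rule ext) simp

definition nonneg :: "('a \<Rightarrow> real) \<Rightarrow> bool" where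
  "nonneg f \<longleftrightarrow> (\<forall>i. 0 \<le> f i)"

lemma nonneg_comb: "nonneg f \<Longrightarrow> nonneg g \<Longrightarrow> 0 \<le> a \<Longrightarrow> 0 \<le> b \<Longrightarrow> nonneg (comb a f b g)"
  by (auto simp: nonneg_def comb_def)

definition simple_root :: "'a \<Rightarrow> 'a \<Rightarrow> real" where
  "simple_root s = (\<lambda>i. if i = s then 1 else 0)"

lemma simple_root_apply: "simple_root s i = (if i = s then 1 else 0)"
  by (simp add: simple_root_def)

lemma nonneg_simple_root [simp]: "nonneg (simple_root s)"
  by (simp add: nonneg_def simple_root_def)

text \<open>With \<open>q = 2 cos(\<pi> / n)\<close> this recursion, the one of the Chebyshev polynomials, governs the orbits and the root
coefficients of a dihedral group of order \<open>2 n\<close>; a solution is \<open>sin (k \<pi> / n)\<close>.\<close>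

fun dihedral_rec :: "real \<Rightarrow> real \<Rightarrow> real \<Rightarrow> nat \<Rightarrow> real" where
  "dihedral_rec q x y 0 = x"
| "dihedral_rec q x y (Suc 0) = y"
| "dihedral_rec q x y (Suc (Suc n)) = q * dihedral_rec q x y (Suc n) - dihedral_rec q x y n"

lemma dihedral_rec_sin:
  "dihedral_rec (2 * cos \<theta>) x y n * sin \<theta> = y * sin (real n * \<theta>) - x * sin ((real n - 1) * \<theta>)"
proof (induction "2 * cos \<theta>" x y n rule: dihedral_rec.induct)
  case (3 x y n)
  have step: "sin (a + \<theta>) = 2 * cos \<theta> * sin a - sin (a - \<theta>)" for a
    by (simp add: sin_add sin_diff)
  have e1: "sin (real (Suc (Suc n)) * \<theta>) = 2 * cos \<theta> * sin (real (Suc n) * \<theta>) - sin (real n * \<theta>)"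
    using step[of "real (Suc n) * \<theta>"] by (simp add: distrib_right)
  have e2: "sin ((real (Suc (Suc n)) - 1) * \<theta>) = 2 * cos \<theta> * sin ((real (Suc n) - 1) * \<theta>) - sin ((real n - 1) * \<theta>)"
    using step[of "real n * \<theta>"] by (simp add: distrib_right left_diff_distrib add.commute)
  have "dihedral_rec (2 * cos \<theta>) x y (Suc (Suc n)) * sin \<theta> =
      2 * cos \<theta> * (dihedral_rec (2 * cos \<theta>) x y (Suc n) * sin \<theta>) - dihedral_rec (2 * cos \<theta>) x y n * sin \<theta>"
    by (simp add: left_diff_distrib)
  also have "\<dots> = y * sin (real (Suc (Suc n)) * \<theta>) - x * sin ((real (Suc (Suc n)) - 1) * \<theta>)"
    unfolding 3 e1 e2 by (simp add: right_diff_distrib mult.left_commute)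
  finally show ?case .
qed (auto simp: algebra_simps)

lemma dihedral_rec_period:
  assumes "n \<ge> 2"
  shows "dihedral_rec (2 * cos (pi / real n)) x y (j + 2 * n) = dihedral_rec (2 * cos (pi / real n)) x y j"
proof -
  let ?t = "pi / real n"
  have s: "sin ?t > 0" using assms by (intro sin_gt_zero) (auto simp: field_simps)
  have a: "real (j + 2 * n) * ?t = real j * ?t + 2 * pi" "(real (j + 2 * n) - 1) * ?t = (real j - 1) * ?t + 2 * pi"
    using assms by (auto simp: field_simps)
  have "dihedral_rec (2 * cos ?t) x y (j + 2 * n) * sin ?t = dihedral_rec (2 * cos ?t) x y j * sin ?t"
    unfolding dihedral_rec_sin a by simp
  then show ?thesis using s by simp
qed

text \<open>By periodicity both sums run over a full period, so summing the recursion gives \<open>2 E = q O\<close> and \<open>2 O = q E\<close> for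
the sums \<open>O\<close> over odd and \<open>E\<close> over even indices. As \<open>\<bar>q\<bar> < 2\<close>, both are zero. The sums are the total changes of two
coordinates under \<open>(s t)\<^sup>n\<close>.\<close>

lemma dihedral_rec_sums_vanish:
  fixes x y :: real
  assumes n: "n \<ge> 2"
  defines "z \<equiv> dihedral_rec (2 * cos (pi / real n)) x y"
  shows "(\<Sum>l<n. z (2 * l + 1)) = 0" "(\<Sum>l<n. z (2 * l + 2)) = 0"
proof -
  let ?q = "2 * cos (pi / real n)"
  have per: "z (j + 2 * n) = z j" for j unfolding z_def by (rule dihedral_rec_period[OF n])
  have rec: "z (Suc (Suc j)) = ?q * z (Suc j) - z j" for j by (simp add: z_def)
  define O' where "O' = (\<Sum>l<n. z (2 * l + 1))"
  define E' where "E' = (\<Sum>l<n. z (2 * l + 2))"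
  \<comment> \<open>Periodicity lets the sums over shifted indices be replaced by the sums themselves.\<close>
  have sh: "(\<Sum>l<n. z (2 * l)) = E'"
  proof -
    have "(\<Sum>l<Suc n. z (2 * l)) = z 0 + E'" unfolding E'_def by (subst sum.lessThan_Suc_shift) simp
    then show ?thesis using per[of 0] by simp
  qed
  have sh2: "(\<Sum>l<n. z (2 * l + 3)) = O'"
  proof -
    have "(\<Sum>l<Suc n. z (2 * l + 1)) = z 1 + (\<Sum>l<n. z (2 * l + 3))"
      by (subst sum.lessThan_Suc_shift) (simp add: numeral_3_eq_3)
    then show ?thesis using per[of 1] unfolding O'_def by (simp add: add.commute)
  qed
  have 1: "E' = ?q * O' - E'"
  proof -
    have "E' = (\<Sum>l<n. ?q * z (2 * l + 1) - z (2 * l))" unfolding E'_def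
      by (rule sum.cong) (use rec in auto)
    also have "\<dots> = ?q * O' - E'" by (simp add: sum_subtractf sum_distrib_left sh O'_def)
    finally show ?thesis .
  qed
  have 2: "O' = ?q * E' - O'"
  proof -
    have "O' = (\<Sum>l<n. ?q * z (2 * l + 2) - z (2 * l + 1))" unfolding sh2[symmetric]
      by (rule sum.cong) (use rec in \<open>auto simp: numeral_3_eq_3\<close>)
    also have "\<dots> = ?q * E' - O'" by (simp add: sum_subtractf sum_distrib_left O'_def E'_def)
    finally show ?thesis .
  qed
  have c: "\<bar>cos (pi / real n)\<bar> < 1"
  proof -
    have "sin (pi / real n) > 0" using n by (intro sin_gt_zero) (auto simp: field_simps)
    then have "(cos (pi / real n))\<^sup>2 < 1" using sin_cos_squared_add[of "pi / real n"]
      by (smt (verit) zero_less_power)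
    then show ?thesis by (simp add: abs_square_less_1)
  qed
  have "E' = cos (pi / real n) * O'" "O' = cos (pi / real n) * E'" using 1 2 by auto
  then have "E' = (cos (pi / real n))\<^sup>2 * E'" by (simp add: power2_eq_square)
  then have "E' * (1 - (cos (pi / real n))\<^sup>2) = 0" by (simp add: algebra_simps)
  moreover have "1 - (cos (pi / real n))\<^sup>2 \<noteq> 0" using c abs_square_less_1[of "cos (pi / real n)"] by auto
  ultimately have "E' = 0" by simp
  with \<open>O' = cos (pi / real n) * E'\<close> show "(\<Sum>l<n. z (2 * l + 1)) = 0" "(\<Sum>l<n. z (2 * l + 2)) = 0"
    by (auto simp: O'_def E'_def)
qed

lemma dihedral_rec_nonneg:
  assumes "n \<ge> 2" "k \<le> n"
  shows "0 \<le> dihedral_rec (2 * cos (pi / real n)) 0 1 k"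
proof -
  let ?t = "pi / real n"
  have s: "sin ?t > 0" using assms by (intro sin_gt_zero) (auto simp: field_simps)
  have "0 \<le> sin (real k * ?t)" using assms by (intro sin_ge_zero) (auto simp: field_simps)
  then have "0 \<le> dihedral_rec (2 * cos ?t) 0 1 k * sin ?t" by (simp add: dihedral_rec_sin)
  then show ?thesis using s by (simp add: zero_le_mult_iff)
qed

lemma dihedral_rec_2: "dihedral_rec 2 0 1 k = real k"
  by (induction "2::real" "0::real" "1::real" k rule: dihedral_rec.induct) auto

context coxeter_system
begin

section \<open>Words and the presentation\<close>

abbreviation wp :: "'a list \<Rightarrow> 'a" where "wp \<equiv> word_prod W"

lemma gen_closed: "s \<in> S \<Longrightarrow> s \<in> carrier W"
  using generators_closed by blast

lemma wp_Nil [simp]: "wp [] = \<one>" and wp_Cons [simp]: "wp (s # ws) = s \<otimes> wp ws"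
  by (simp_all add: word_prod_def)

lemma wp_closed [simp]: "ws \<in> lists S \<Longrightarrow> wp ws \<in> carrier W"
  by (induction ws) (auto simp: gen_closed)

lemma wp_append: "us \<in> lists S \<Longrightarrow> vs \<in> lists S \<Longrightarrow> wp (us @ vs) = wp us \<otimes> wp vs"
  by (induction us) (auto simp: gen_closed m_assoc)

definition positive_word :: "'a list \<Rightarrow> ('a \<times> bool) list" where
  "positive_word ws = map (\<lambda>s. (s, True)) ws"

lemma signed_prod_positive: "signed_prod W (positive_word ws) = wp ws"
  by (simp add: signed_prod_def positive_word_def comp_def)

lemma positive_in_lists: "ws \<in> lists S \<Longrightarrow> positive_word ws \<in> lists (S \<times> UNIV)"
  by (auto simp: positive_word_def)

lemma relation_holds:
  assumes "s \<in> S" "t \<in> S" "m s t = enat n"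
  shows "wp (concat (replicate n [s, t])) = \<one>"
proof -
  have c: "concat (replicate n [(s, True), (t, True)]) = positive_word (concat (replicate n [s, t]))"
    by (induction n) (auto simp: positive_word_def)
  have L: "concat (replicate n [s, t]) \<in> lists S" using assms by (auto simp: set_replicate_conv_if split: if_splits)
  have "pres_step S (coxeter_relators S m) ([] @ positive_word (concat (replicate n [s, t])) @ []) ([] @ [])"
  proof (rule pres_step.relator)
    show "positive_word (concat (replicate n [s, t])) \<in> coxeter_relators S m"
      unfolding coxeter_relators_def c[symmetric] using assms by blast
  qed
  then have "equivclp (pres_step S (coxeter_relators S m)) (positive_word (concat (replicate n [s, t]))) (positive_word [])"
    by (simp add: r_into_equivclp positive_word_def)
  then have "signed_prod W (positive_word (concat (replicate n [s, t]))) = signed_prod W (positive_word [])"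
    using presentation positive_in_lists[OF L] positive_in_lists[of "[]"] unfolding has_presentation_def by blast
  then show ?thesis by (simp add: signed_prod_positive)
qed

lemma gen_involution [simp]: "s \<in> S \<Longrightarrow> s \<otimes> s = \<one>"
  using relation_holds[of s s 1] m_diag[of s] by (simp add: one_enat_def gen_closed)

lemma gen_inv [simp]: "s \<in> S \<Longrightarrow> inv s = s"
  using gen_involution gen_closed by (metis inv_equality)

lemma gen_cancel_left [simp]: "s \<in> S \<Longrightarrow> w \<in> carrier W \<Longrightarrow> s \<otimes> (s \<otimes> w) = w"
  by (metis gen_closed gen_involution l_one m_assoc)

lemma gen_cancel_right [simp]: "s \<in> S \<Longrightarrow> w \<in> carrier W \<Longrightarrow> w \<otimes> s \<otimes> s = w"
  by (metis gen_closed gen_involution r_one m_assoc)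

lemma wp_rev: "ws \<in> lists S \<Longrightarrow> inv (wp ws) = wp (rev ws)"
proof (induction ws)
  case (Cons s ws)
  then have "inv (wp (s # ws)) = wp (rev ws) \<otimes> s"
    by (simp add: inv_mult_group gen_closed)
  then show ?case using Cons by (subst rev.simps, subst wp_append) (auto simp: gen_closed)
qed simp

lemma ex_word:
  assumes "w \<in> carrier W"
  shows "\<exists>ws \<in> lists S. wp ws = w"
proof -
  have "w \<in> generate W S" using presentation assms by (simp add: has_presentation_def)
  then show ?thesis
  proof (induction rule: generate.induct)
    case one show ?case by (intro bexI[of _ "[]"]) auto
  next
    case (incl h) then show ?case by (intro bexI[of _ "[h]"]) (auto simp: gen_closed)
  next
    case (inv h) then show ?case by (intro bexI[of _ "[h]"]) (auto simp: gen_closed)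
  next
    case (eng h1 h2)
    then obtain us vs where "us \<in> lists S" "wp us = h1" "vs \<in> lists S" "wp vs = h2" by blast
    then show ?case by (intro bexI[of _ "us @ vs"]) (auto simp: wp_append)
  qed
qed

text \<open>The universal property of the presentation, for functions on words: what the cancellations and the
relators leave unchanged depends only on the product.\<close>

lemma word_invariant:
  fixes g :: "('a \<times> bool) list \<Rightarrow> 'c"
  assumes step: "\<And>u v. pres_step S (coxeter_relators S m) u v \<Longrightarrow> g u = g v"
    and us: "us \<in> lists S" and vs: "vs \<in> lists S" and eq: "wp us = wp vs"
  shows "g (positive_word us) = g (positive_word vs)"
proof -
  have "equivclp (pres_step S (coxeter_relators S m)) (positive_word us) (positive_word vs)"
    using presentation positive_in_lists[OF us] positive_in_lists[OF vs] eq signed_prod_positive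
    unfolding has_presentation_def by metis
  then show ?thesis
    unfolding equivclp_def
    by (induction rule: rtranclp_induct) (auto simp: symclp_def dest: step)
qed

lemma parity_invariant:
  assumes "us \<in> lists S" "vs \<in> lists S" "wp us = wp vs"
  shows "even (length us) = even (length vs)"
proof -
  have rel: "even (length r)" if "r \<in> coxeter_relators S m" for r
    using that by (auto simp: coxeter_relators_def length_concat sum_list_replicate)
  have "even (length (positive_word us)) = even (length (positive_word vs))"
    by (rule word_invariant[OF _ assms]) (auto elim!: pres_step.cases dest: rel)
  then show ?thesis by (simp add: positive_word_def)
qed

section \<open>The geometric representation\<close>

text \<open>The value \<open>-2\<close> for \<open>m = \<infinity>\<close> is the limit of the values for finite \<open>m\<close>.\<close>

definition cartan :: "'a \<Rightarrow> 'a \<Rightarrow> real" where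
  "cartan s t = (case m s t of enat n \<Rightarrow> - 2 * cos (pi / real n) | \<infinity> \<Rightarrow> - 2)"

lemma cartan_diag [simp]: "s \<in> S \<Longrightarrow> cartan s s = 2"
  by (simp add: cartan_def m_diag one_enat_def)

lemma cartan_sym: "s \<in> S \<Longrightarrow> t \<in> S \<Longrightarrow> cartan s t = cartan t s"
  by (simp add: cartan_def m_sym)

lemma m_enat_ge2: "\<lbrakk>s \<in> S; t \<in> S; s \<noteq> t; m s t = enat n\<rbrakk> \<Longrightarrow> 2 \<le> n"
  using m_off_diag[of s t] by (simp add: numeral_eq_enat)

lemma cartan_nonpos:
  assumes "s \<in> S" "t \<in> S" "s \<noteq> t"
  shows "cartan s t \<le> 0"
proof (cases "m s t")
  case (enat n)
  then have "2 \<le> n" using m_enat_ge2 assms by blast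
  then have "pi / real n \<le> pi / 2" by (intro divide_left_mono) auto
  moreover have "0 \<le> pi / real n" by simp
  ultimately have "0 \<le> cos (pi / real n)" by (intro cos_ge_zero) linarith+
  then show ?thesis using enat by (simp add: cartan_def)
qed (simp add: cartan_def)

definition pairing :: "'a \<Rightarrow> ('a \<Rightarrow> real) \<Rightarrow> real" where
  "pairing s f = (\<Sum>j\<in>S. cartan s j * f j)"

text \<open>The geometric representation acts on coefficient vectors with respect to the simple roots. A generator
\<open>s\<close> changes only the coordinate \<open>s\<close>.\<close>

definition reflect :: "'a \<Rightarrow> ('a \<Rightarrow> real) \<Rightarrow> 'a \<Rightarrow> real" where
  "reflect s f = f(s := f s - pairing s f)"

lemma pairing_comb: "pairing s (comb a f b g) = a * pairing s f + b * pairing s g"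
  by (simp add: pairing_def comb_def sum.distrib sum_distrib_left algebra_simps)

lemma pairing_simple [simp]: "t \<in> S \<Longrightarrow> pairing s (simple_root t) = cartan s t"
  using finite_generators by (simp add: pairing_def simple_root_def if_distrib [of "\<lambda>x. _ * x"] cong: if_cong)

lemma pairing_upd: "t \<in> S \<Longrightarrow> pairing s (f(t := x)) = pairing s f + cartan s t * (x - f t)"
  unfolding pairing_def using finite_generators
  by (simp add: sum.remove[of S t] algebra_simps)

lemma reflect_eq_comb: "reflect s f = comb 1 f (- pairing s f) (simple_root s)"
  by (auto simp: reflect_def comb_def simple_root_def)

lemma reflect_comb: "reflect s (comb a f b g) = comb a (reflect s f) b (reflect s g)"
  by (rule ext) (simp add: reflect_eq_comb pairing_comb, simp add: comb_def algebra_simps)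

lemma pairing_reflect: "s \<in> S \<Longrightarrow> pairing t (reflect s f) = pairing t f - cartan t s * pairing s f"
  by (simp add: reflect_def pairing_upd)

lemma reflect_reflect [simp]: "s \<in> S \<Longrightarrow> reflect s (reflect s f) = f"
  by (rule ext) (auto simp: reflect_def pairing_upd)

lemma reflect_uminus: "reflect s (- f) = - reflect s f"
  by (rule ext) (auto simp: reflect_def pairing_def sum_negf)

text \<open>The product \<open>s t\<close> moves only the coordinates \<open>s\<close> and \<open>t\<close>, and the amounts by which it moves them
satisfy the recursion, whatever the other coordinates are.\<close>

lemma dihedral_iterate:
  fixes f :: "'a \<Rightarrow> real"
  assumes s: "s \<in> S" and t: "t \<in> S" and st: "s \<noteq> t"
  defines "z \<equiv> dihedral_rec (- cartan s t) (- pairing s f) (pairing t f)"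
  shows "((\<lambda>g. reflect s (reflect t g)) ^^ i) f =
           f(t := f t - (\<Sum>l<i. z (2 * l + 1)), s := f s - (\<Sum>l<i. z (2 * l + 2))) \<and>
         pairing s (((\<lambda>g. reflect s (reflect t g)) ^^ i) f) = - z (2 * i) \<and>
         pairing t (((\<lambda>g. reflect s (reflect t g)) ^^ i) f) = z (2 * i + 1)"
proof (induction i)
  case 0 then show ?case by (simp add: z_def)
next
  case (Suc i)
  define g where "g = ((\<lambda>g. reflect s (reflect t g)) ^^ i) f"
  have g: "g = f(t := f t - (\<Sum>l<i. z (2 * l + 1)), s := f s - (\<Sum>l<i. z (2 * l + 2)))"
    and gs: "pairing s g = - z (2 * i)" and gt: "pairing t g = z (2 * i + 1)"
    using Suc unfolding g_def by blast+
  have rec: "z (Suc (Suc j)) = - cartan s t * z (Suc j) - z j" for j by (simp add: z_def)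
  have ps: "pairing s (reflect t g) = z (2 * i + 2)"
    using gs gt s t rec[of "2 * i"] by (simp add: pairing_reflect)
  have pt: "pairing t (reflect t g) = - z (2 * i + 1)"
    using gt s t by (simp add: pairing_reflect)
  have 1: "pairing t (reflect s (reflect t g)) = z (2 * i + 3)"
    using ps pt s t rec[of "2 * i + 1"] by (simp add: pairing_reflect cartan_sym[of t s] numeral_3_eq_3)
  have 2: "pairing s (reflect s (reflect t g)) = - z (2 * i + 2)"
    using ps s by (simp add: pairing_reflect)
  have rt: "reflect t g = g(t := g t - z (2 * i + 1))" using gt by (simp add: reflect_def)
  have rs: "reflect s (reflect t g) = (reflect t g)(s := reflect t g s - z (2 * i + 2))"
    using ps by (simp add: reflect_def)
  have 3: "reflect s (reflect t g) =
      f(t := f t - (\<Sum>l<Suc i. z (2 * l + 1)), s := f s - (\<Sum>l<Suc i. z (2 * l + 2)))"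
    by (subst rs, subst (1 2) rt) (use st in \<open>simp add: g fun_eq_iff\<close>)
  have "((\<lambda>g. reflect s (reflect t g)) ^^ Suc i) f = reflect s (reflect t g)" by (simp add: g_def)
  moreover have "2 * i + 3 = 2 * Suc i + 1" "2 * i + 2 = 2 * Suc i" by simp_all
  ultimately show ?case using 1 2 3 by metis
qed

lemma dihedral_relation:
  assumes "s \<in> S" "t \<in> S" "m s t = enat n"
  shows "((\<lambda>g. reflect s (reflect t g)) ^^ n) f = f"
proof (cases "s = t")
  case True
  then have "n = 1" using m_diag assms by (simp add: one_enat_def)
  then show ?thesis using True assms by simp
next
  case False
  have n: "n \<ge> 2" using m_enat_ge2 assms False by blast
  have "- cartan s t = 2 * cos (pi / real n)" using assms by (simp add: cartan_def)
  then show ?thesis using dihedral_iterate[OF assms(1,2) False, where i = n and f = f] dihedral_rec_sums_vanish[OF n]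
    by (auto simp: fun_eq_iff)
qed

text \<open>The signs of the letters are ignored, since reflections are involutions.\<close>

definition signed_act :: "('a \<times> bool) list \<Rightarrow> ('a \<Rightarrow> real) \<Rightarrow> 'a \<Rightarrow> real" where
  "signed_act u = foldr (\<lambda>x. reflect (fst x)) u"

definition word_act :: "'a list \<Rightarrow> ('a \<Rightarrow> real) \<Rightarrow> 'a \<Rightarrow> real" where
  "word_act ws = foldr reflect ws"

lemma word_act_Nil [simp]: "word_act [] f = f"
  and word_act_Cons [simp]: "word_act (s # ws) f = reflect s (word_act ws f)"
  and word_act_append: "word_act (us @ vs) f = word_act us (word_act vs f)"
  by (simp_all add: word_act_def)

lemma word_act_eq:
  assumes "us \<in> lists S" "vs \<in> lists S" "wp us = wp vs"
  shows "word_act us = word_act vs"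
proof -
  have rel: "signed_act r = id" if rr: "r \<in> coxeter_relators S m" for r
  proof -
    obtain s t n where r: "r = concat (replicate n [(s, True), (t, True)])" "s \<in> S" "t \<in> S" "m s t = enat n"
      using rr unfolding coxeter_relators_def by blast
    have "signed_act (concat (replicate i [(s, True), (t, True)])) f = ((\<lambda>g. reflect s (reflect t g)) ^^ i) f" for i f
      by (induction i) (auto simp: signed_act_def)
    then show ?thesis using dihedral_relation[OF r(2-4)] r(1) by auto
  qed
  have app: "signed_act (u @ v) = signed_act u \<circ> signed_act v" for u v
    by (rule ext) (simp add: signed_act_def)
  have "signed_act (positive_word us) = signed_act (positive_word vs)"
  proof (rule word_invariant[OF _ assms])
    fix u v assume "pres_step S (coxeter_relators S m) u v"
    then show "signed_act u = signed_act v"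
    proof cases
      case (cancel s u' b v')
      have "signed_act [(s, b), (s, \<not> b)] = id" using cancel by (auto simp: signed_act_def)
      then show ?thesis using cancel by (simp only: app) (simp add: fun_eq_iff)
    next
      case (relator r u' v')
      then show ?thesis using rel by (simp add: app)
    qed
  qed
  moreover have "signed_act (positive_word ws) = word_act ws" for ws
    by (induction ws) (simp_all add: signed_act_def positive_word_def word_act_def)
  ultimately show ?thesis by simp
qed

definition act :: "'a \<Rightarrow> ('a \<Rightarrow> real) \<Rightarrow> 'a \<Rightarrow> real" where
  "act w = word_act (SOME ws. ws \<in> lists S \<and> wp ws = w)"

lemma act_wp: "ws \<in> lists S \<Longrightarrow> act (wp ws) = word_act ws"
  unfolding act_def by (rule someI2[of _ ws]) (auto intro: word_act_eq)

lemma act_mult: "x \<in> carrier W \<Longrightarrow> y \<in> carrier W \<Longrightarrow> act (x \<otimes> y) f = act x (act y f)"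
  using ex_word[of x] ex_word[of y] by (metis act_wp append_in_lists_conv word_act_append wp_append)

lemma act_one [simp]: "act \<one> f = f"
  using act_wp[of "[]"] by simp

lemma act_gen [simp]: "s \<in> S \<Longrightarrow> act s = reflect s"
  using act_wp[of "[s]"] by (auto simp: gen_closed)

lemma act_inv_act [simp]: "w \<in> carrier W \<Longrightarrow> act (inv w) (act w f) = f"
  and act_act_inv [simp]: "w \<in> carrier W \<Longrightarrow> act w (act (inv w) f) = f"
  by (metis act_mult act_one inv_closed l_inv, metis act_mult act_one inv_closed r_inv)

lemma word_act_comb: "word_act ws (comb a f b g) = comb a (word_act ws f) b (word_act ws g)"
  by (induction ws) (auto simp: reflect_comb)

lemma act_comb: "act w (comb a f b g) = comb a (act w f) b (act w g)"
  by (simp add: act_def word_act_comb)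

lemma act_uminus: "act w (- f) = - act w f"
proof -
  have "- f = comb (-1) f 0 f" "- act w f = comb (-1) (act w f) 0 (act w f)" by (auto simp: comb_def)
  then show ?thesis by (simp add: act_comb)
qed

end

section \<open>Lengths and the positivity of roots\<close>

fun altw :: "nat \<Rightarrow> 'a \<Rightarrow> 'a \<Rightarrow> 'a list" where
  "altw 0 a b = []"
| "altw (Suc k) a b = altw k b a @ [a]"

lemma length_altw [simp]: "length (altw k a b) = k"
  by (induction k arbitrary: a b) auto

lemma set_altw: "set (altw k a b) \<subseteq> {a, b}"
  by (induction k a b rule: altw.induct) auto

lemma altw_in_lists: "a \<in> S \<Longrightarrow> b \<in> S \<Longrightarrow> altw k a b \<in> lists S"
  using set_altw[of k a b] by auto

lemma alternating_word:
  assumes "us \<in> lists {s, t}" "\<And>x a y. us \<noteq> x @ [a, a] @ y"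
  shows "us = altw (length us) s t \<or> us = altw (length us) t s"
  using assms
proof (induction us rule: rev_induct)
  case (snoc c us)
  have ih: "us = altw (length us) s t \<or> us = altw (length us) t s"
  proof (rule snoc.IH)
    show "us \<noteq> x @ [a, a] @ y" for x a y using snoc.prems(2)[of x a "y @ [c]"] by auto
  qed (use snoc.prems in auto)
  have no: "us \<noteq> altw k c d" if k: "us \<noteq> []" "length us = k" for d k
  proof
    assume "us = altw k c d"
    then have "\<exists>x. us = x @ [c]" using k by (cases k) auto
    then obtain x where "us = x @ [c]" ..
    then show False using snoc.prems(2)[of x c "[]"] by simp
  qed
  show ?case
  proof (cases "us = []")
    case True then show ?thesis using snoc.prems(1) by auto
  next
    case False
    have c: "c = s \<or> c = t" using snoc.prems(1) by auto
    show ?thesis using ih no[OF False refl, of s] no[OF False refl, of t] c by auto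
  qed
qed simp

lemma altw_even: "altw (2 * j) t s = concat (replicate j [s, t])"
proof (induction j)
  case (Suc j)
  have "altw (2 * Suc j) t s = altw (2 * j) t s @ [s, t]" by simp
  also have "\<dots> = concat (replicate j [s, t] @ replicate 1 [s, t])" using Suc by simp
  also have "\<dots> = concat (replicate (Suc j) [s, t])"
    by (simp only: replicate_add[symmetric]) simp
  finally show ?case .
qed simp

lemma altw_odd: "altw (2 * j + 1) t s = t # concat (replicate j [s, t])"
proof (induction j)
  case (Suc j)
  have "altw (2 * Suc j + 1) t s = altw (2 * j + 1) t s @ [s, t]" by simp
  also have "\<dots> = t # concat (replicate j [s, t] @ replicate 1 [s, t])" using Suc by simp
  also have "\<dots> = t # concat (replicate (Suc j) [s, t])"
    by (simp only: replicate_add[symmetric]) simp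
  finally show ?case .
qed simp

lemma rev_concat_replicate: "rev (concat (replicate j [s, t])) = concat (replicate j [t, s])"
  by (simp add: rev_concat map_replicate)

context coxeter_system
begin

abbreviation len :: "'a \<Rightarrow> nat" where "len \<equiv> cox_length W S"

lemma len_wp_le: "ws \<in> lists S \<Longrightarrow> len (wp ws) \<le> length ws"
  unfolding cox_length_def by (rule Least_le) blast

lemma ex_reduced:
  assumes "w \<in> carrier W"
  obtains ws where "ws \<in> lists S" "wp ws = w" "length ws = len w"
proof -
  have "\<exists>n. \<exists>ws \<in> lists S. length ws = n \<and> wp ws = w" using ex_word[OF assms] by blast
  from LeastI_ex[OF this] show ?thesis using that unfolding cox_length_def by blast
qed

lemma len_one [simp]: "len \<one> = 0"
  using len_wp_le[of "[]"] by simp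

lemma even_len: "ws \<in> lists S \<Longrightarrow> even (len (wp ws)) = even (length ws)"
  by (metis ex_reduced parity_invariant wp_closed)

lemma len_mult_le: "x \<in> carrier W \<Longrightarrow> ws \<in> lists S \<Longrightarrow> len (x \<otimes> wp ws) \<le> len x + length ws"
  by (metis ex_reduced append_in_lists_conv len_wp_le length_append wp_append)

lemma len_mult_gen_le: "x \<in> carrier W \<Longrightarrow> s \<in> S \<Longrightarrow> len (x \<otimes> s) \<le> len x + 1"
  using len_mult_le[of x "[s]"] by (simp add: gen_closed)

lemma len_mult_gen_ne:
  assumes "x \<in> carrier W" "s \<in> S"
  shows "len (x \<otimes> s) \<noteq> len x"
proof -
  obtain ws where ws: "ws \<in> lists S" "wp ws = x" using ex_word assms by blast
  then have "wp (ws @ [s]) = x \<otimes> s" using assms by (simp add: wp_append gen_closed)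
  then have "even (len (x \<otimes> s)) = even (length ws + 1)" using even_len[of "ws @ [s]"] ws assms by simp
  then show ?thesis using even_len[OF ws(1)] ws by auto
qed

lemma len_mult_gen:
  assumes "x \<in> carrier W" "s \<in> S"
  shows "len (x \<otimes> s) = len x + 1 \<or> len x = len (x \<otimes> s) + 1"
  using len_mult_gen_le[of x s] len_mult_gen_le[of "x \<otimes> s" s] len_mult_gen_ne[of x s] assms
  by (simp add: gen_closed) linarith

lemma len_inv:
  assumes "w \<in> carrier W"
  shows "len (inv w) = len w"
proof -
  have le: "len (inv x) \<le> len x" if "x \<in> carrier W" for x
  proof -
    obtain ws where ws: "ws \<in> lists S" "wp ws = x" "length ws = len x" using ex_reduced \<open>x \<in> carrier W\<close> .
    have "rev ws \<in> lists S" using ws by auto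
    then show ?thesis using wp_rev[of ws] len_wp_le[of "rev ws"] ws by auto
  qed
  show ?thesis using le[of w] le[of "inv w"] assms by simp
qed

lemma ex_right_descent:
  assumes "w \<in> carrier W" "w \<noteq> \<one>"
  obtains s where "s \<in> S" "len (w \<otimes> s) < len w"
proof -
  obtain ws where ws: "ws \<in> lists S" "wp ws = w" "length ws = len w" using ex_reduced assms by blast
  then obtain us s where us: "ws = us @ [s]" using assms by (cases ws rule: rev_cases) auto
  have us': "us \<in> lists S" "s \<in> S" using ws us by auto
  then have "w = wp us \<otimes> s" using ws us by (simp add: wp_append gen_closed)
  then have "w \<otimes> s = wp us" using us' by simp
  then have "len (w \<otimes> s) < len w" using len_wp_le[of us] ws us by auto
  then show ?thesis using that us ws by auto
qed

text \<open>Cut the relation \<open>(s t)\<^sup>n = 1\<close> in the middle and invert one half.\<close>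

lemma braid_relation:
  assumes "s \<in> S" "t \<in> S" "m s t = enat n"
  shows "wp (altw n s t) = wp (altw n t s)"
proof -
  have L: "concat (replicate i [a, b]) \<in> lists S" if "a \<in> S" "b \<in> S" for i a b
    using that by (auto simp: set_replicate_conv_if split: if_splits)
  have one: "wp (concat (replicate n [s, t])) = \<one>" by (rule relation_holds[OF assms])
  consider j where "n = 2 * j" | j where "n = 2 * j + 1" by (meson oddE evenE)
  then show ?thesis
  proof cases
    case 1
    let ?r = "concat (replicate j [s, t])"
    have "concat (replicate n [s, t]) = ?r @ ?r" using 1
      by (simp only: mult_2 replicate_add concat_append)
    then have "wp ?r \<otimes> wp ?r = \<one>" using one wp_append L assms by metis
    then have "inv (wp ?r) = wp ?r" using L assms by (simp add: inv_equality)
    then show ?thesis using 1 wp_rev[of ?r] L assms by (simp only: altw_even rev_concat_replicate)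
  next
    case 2
    let ?r = "concat (replicate j [s, t])"
    have "concat (replicate n [s, t]) = concat (replicate j [s, t] @ [[s, t]] @ replicate j [s, t])"
    proof -
      have "n = j + (1 + j)" using 2 by simp
      then show ?thesis by (simp only: replicate_add) simp
    qed
    then have "concat (replicate n [s, t]) = (?r @ [s]) @ (t # ?r)" by simp
    moreover have "?r @ [s] \<in> lists S" "t # ?r \<in> lists S" using L[of s t j] assms by auto
    ultimately have "wp (?r @ [s]) \<otimes> wp (t # ?r) = \<one>" using one wp_append by metis
    then have "wp (t # ?r) = inv (wp (?r @ [s]))"
      using \<open>?r @ [s] \<in> lists S\<close> \<open>t # ?r \<in> lists S\<close> by (metis inv_equality inv_inv wp_closed inv_closed)
    also have "\<dots> = wp (s # concat (replicate j [t, s]))"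
      using wp_rev[OF \<open>?r @ [s] \<in> lists S\<close>] by (simp only: rev_append rev_concat_replicate) simp
    finally show ?thesis using 2 by (simp only: altw_odd)
  qed
qed

lemma dihedral_root:
  assumes "s \<in> S" "t \<in> S" "s \<noteq> t"
  defines "c \<equiv> dihedral_rec (- cartan s t) 0 1"
  shows "word_act (altw k t s) (simple_root s) =
      (if even k then comb (c (k + 1)) (simple_root s) (c k) (simple_root t)
       else comb (c k) (simple_root s) (c (k + 1)) (simple_root t))"
  using assms(1-3) unfolding c_def
proof (induction k arbitrary: s t rule: nat_less_induct)
  case (1 k s t)
  let ?c = "dihedral_rec (- cartan s t) 0 1"
  have sym: "cartan t s = cartan s t" using 1 cartan_sym by blast
  consider "k = 0" | "k = 1" | j where "k = Suc (Suc j)" by (metis One_nat_def not0_implies_Suc)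
  then show ?case
  proof cases
    case 1 then show ?thesis by (auto simp: comb_def)
  next
    case 2
    then show ?thesis using \<open>s \<in> S\<close> sym by (auto simp: reflect_eq_comb comb_def)
  next
    case 3
    have r: "reflect t (simple_root s) = comb 1 (simple_root s) (- cartan s t) (simple_root t)"
      using \<open>s \<in> S\<close> sym by (simp add: reflect_eq_comb)
    have rs: "reflect s (simple_root s) = comb (-1) (simple_root s) 0 (simple_root s)"
      using \<open>s \<in> S\<close> by (auto simp: reflect_eq_comb comb_def)
    have "word_act (altw k t s) (simple_root s) =
        comb 1 (word_act (altw j t s) (reflect s (simple_root s))) (- cartan s t) (word_act (altw (Suc j) s t) (simple_root t))"
      using 3 by (simp add: word_act_append r word_act_comb reflect_comb)
    also have "\<dots> = comb (-1) (word_act (altw j t s) (simple_root s)) (- cartan s t) (word_act (altw (Suc j) s t) (simple_root t))"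
      unfolding rs word_act_comb by (auto simp: comb_def)
    finally show ?thesis
      using "1"(1)[rule_format, of j s t] "1"(1)[rule_format, of "Suc j" t s] "1"(2-4) 3
      by (auto simp: sym comb_def fun_eq_iff algebra_simps)
  qed
qed

text \<open>Induction on the length of \<open>w\<close>, with some descent \<open>t\<close> of \<open>w\<close>. Write \<open>w = v u\<close> with \<open>u\<close> in the
dihedral group of \<open>s\<close> and \<open>t\<close>, lengths adding up, and \<open>v\<close> as short as possible. Then \<open>v\<close> has neither \<open>s\<close>
nor \<open>t\<close> as a descent, so by induction \<open>v\<close> maps \<open>\<alpha>\<^sub>s\<close> and \<open>\<alpha>\<^sub>t\<close> to positive roots. The word \<open>u\<close> alternates and does
not end in \<open>s\<close>; if it had \<open>m(s, t)\<close> letters, then a braid relation would make it end in \<open>s\<close>, and \<open>w s\<close> would be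
shorter. So \<open>u \<alpha>\<^sub>s\<close> is in the range where the solution of the recursion is nonnegative.\<close>

lemma root_positivity:
  assumes "w \<in> carrier W" "s \<in> S" "len w < len (w \<otimes> s)"
  shows "nonneg (act w (simple_root s))"
  using assms
proof (induction "len w" arbitrary: w s rule: less_induct)
  case less
  show ?case
  proof (cases "w = \<one>")
    case True then show ?thesis by simp
  next
    case False
    then obtain t where t: "t \<in> S" "len (w \<otimes> t) < len w" using ex_right_descent less by blast
    then have st: "s \<noteq> t" using less by auto
    define P where "P = (\<lambda>(v, us). v \<in> carrier W \<and> us \<in> lists {s, t} \<and> w = v \<otimes> wp us \<and> len w = len v + length us)"
    have wt: "len w = len (w \<otimes> t) + 1" using len_mult_gen[of w t] less t by auto
    have "P (w \<otimes> t, [t])" using t less wt by (auto simp: P_def gen_closed)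
    from ex_has_least_nat[of P _ "\<lambda>x. len (fst x)", OF this]
    obtain v us where vu: "P (v, us)" and least: "\<And>v' us'. P (v', us') \<Longrightarrow> len v \<le> len v'" by auto
    have lvw: "len v < len w" using least[OF \<open>P (w \<otimes> t, [t])\<close>] wt by auto
    have v: "v \<in> carrier W" and us: "us \<in> lists {s, t}" and w: "w = v \<otimes> wp us" and lw: "len w = len v + length us"
      using vu by (auto simp: P_def)
    have L: "ws \<in> lists S" if "ws \<in> lists {s, t}" for ws using that t less by auto
    have up: "len v < len (v \<otimes> a)" if a: "a \<in> {s, t}" for a
    proof (rule ccontr)
      have aS: "a \<in> S" using a t less by auto
      assume "\<not> len v < len (v \<otimes> a)"
      then have va: "len v = len (v \<otimes> a) + 1" using len_mult_gen[OF v aS] by auto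
      have "v \<otimes> a \<otimes> wp (a # us) = w" using w v aS L[OF us] by (simp add: m_assoc gen_closed)
      then have "P (v \<otimes> a, a # us)" using va lw v aS us a by (auto simp: P_def gen_closed)
      then show False using least va by fastforce
    qed
    have pos: "nonneg (act v (simple_root a))" if "a \<in> {s, t}" for a
      using less.hyps[OF lvw v _ up[OF that]] that t less by auto
    have nodouble: "us \<noteq> x @ [a, a] @ y" for x a y
    proof
      assume e: "us = x @ [a, a] @ y"
      then have l: "x \<in> lists S" "a \<in> S" "y \<in> lists S" using L[OF us] by auto
      then have "wp us = wp (x @ y)" using e by (simp add: wp_append gen_closed)
      then have "len w \<le> len v + length (x @ y)" using len_mult_le[OF v, of "x @ y"] l w by auto
      then show False using lw e by simp
    qed
    have notend: "us' \<noteq> ws @ [s]" if us': "us' \<in> lists {s, t}" "wp us' = wp us" "length us' = length us" for us' ws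
    proof
      assume e: "us' = ws @ [s]"
      have ws: "ws \<in> lists S" using e us' L by auto
      have "w = v \<otimes> wp ws \<otimes> s" using w e us' ws v less by (metis append_in_lists_conv gen_closed m_assoc wp_Cons wp_Nil wp_append wp_closed r_one L)
      then have "w \<otimes> s = v \<otimes> wp ws" using ws v less by simp
      then have "len (w \<otimes> s) \<le> len v + length ws" using len_mult_le[OF v ws] by simp
      then show False using less lw us' e by simp
    qed
    define k where "k = length us"
    have "us = altw k s t \<or> us = altw k t s" unfolding k_def by (rule alternating_word[OF us nodouble])
    moreover have "us = altw k t s" if "us = altw k s t"
      using that notend[OF us refl refl] by (cases k) auto
    ultimately have usk: "us = altw k t s" by blast
    have small: "k < n" if n: "m s t = enat n" for n
    proof (rule ccontr)
      assume "\<not> k < n"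
      then obtain j where j: "k = j + n" by (metis add.commute le_iff_add not_less)
      have n2: "n \<ge> 2" using m_enat_ge2 n t less st by blast
      \<comment> \<open>An alternating word of at least \<open>n\<close> letters ends with the alternating word of \<open>n\<close> letters.\<close>
      have dec: "\<exists>x. altw (j' + n') a b = x @ altw n' a b \<and> x \<in> lists {a, b}" for j' n' and a b :: 'a
      proof (induction n' arbitrary: a b)
        case 0 then show ?case using set_altw[of j' a b] by auto
      next
        case (Suc n')
        obtain x where "altw (j' + n') b a = x @ altw n' b a" "x \<in> lists {b, a}" using Suc[of b a] by blast
        then show ?case by (intro exI[of _ x]) auto
      qed
      obtain x where x: "altw k t s = x @ altw n t s" "x \<in> lists {s, t}" using dec[of j n t s] j by (auto simp: insert_commute)
      have xs: "x \<in> lists S" using x(2) L by blast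
      have "wp (x @ altw n s t) = wp us"
        using x xs usk braid_relation[of s t n] n t less by (simp add: wp_append altw_in_lists)
      moreover have "x @ altw n s t \<in> lists {s, t}" using x set_altw[of n s t] by auto
      moreover have "length (x @ altw n s t) = length us" using x usk by (metis length_altw length_append)
      moreover obtain n' where "n = Suc n'" using n2 by (cases n) auto
      ultimately show False using notend[of "x @ altw n s t" "x @ altw n' t s"] by simp
    qed
    let ?c = "dihedral_rec (- cartan s t) 0 1"
    have c: "0 \<le> ?c k" "0 \<le> ?c (k + 1)"
    proof -
      have "0 \<le> ?c k \<and> 0 \<le> ?c (k + 1)"
      proof (cases "m s t")
        case (enat n)
        have q: "- cartan s t = 2 * cos (pi / real n)" using enat by (simp add: cartan_def)
        show ?thesis unfolding q using dihedral_rec_nonneg[of n] small[OF enat] m_enat_ge2[OF _ _ st enat] less t by auto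
      next
        case infinity
        then show ?thesis by (simp only: cartan_def enat.case minus_minus dihedral_rec_2) auto
      qed
      then show "0 \<le> ?c k" "0 \<le> ?c (k + 1)" by auto
    qed
    have "act w (simple_root s) = act v (word_act us (simple_root s))"
      using w v us L by (simp add: act_mult act_wp)
    also have "\<dots> = (if even k then comb (?c (k + 1)) (act v (simple_root s)) (?c k) (act v (simple_root t))
       else comb (?c k) (act v (simple_root s)) (?c (k + 1)) (act v (simple_root t)))"
      using dihedral_root[of s t k] usk t less st by (simp add: act_comb)
    finally show ?thesis using c pos by (auto intro!: nonneg_comb)
  qed
qed

end

section \<open>Roots and inversion sets\<close>

locale finite_coxeter_system = coxeter_system +
  assumes finite_W: "finite (carrier W)"

context coxeter_system
begin

definition form :: "('a \<Rightarrow> real) \<Rightarrow> ('a \<Rightarrow> real) \<Rightarrow> real" where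
  "form f g = (\<Sum>i\<in>S. f i * pairing i g)"

lemma form_comb_left: "form (comb a f b g) h = a * form f h + b * form g h"
  by (simp add: form_def comb_def sum.distrib sum_distrib_left algebra_simps)

lemma form_comb_right: "form h (comb a f b g) = a * form h f + b * form h g"
  by (simp add: form_def pairing_comb sum.distrib sum_distrib_left algebra_simps)

lemma form_sym: "form f g = form g f"
proof -
  have "form f g = (\<Sum>i\<in>S. \<Sum>j\<in>S. f i * cartan i j * g j)"
    by (simp add: form_def pairing_def sum_distrib_left mult.assoc)
  also have "\<dots> = (\<Sum>j\<in>S. \<Sum>i\<in>S. g j * cartan j i * f i)"
    by (subst sum.swap) (intro sum.cong refl, simp add: cartan_sym)
  also have "\<dots> = form g f"
    by (simp add: form_def pairing_def sum_distrib_left mult.assoc)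
  finally show ?thesis .
qed

lemma form_simple_left: "s \<in> S \<Longrightarrow> form (simple_root s) f = pairing s f"
  using finite_generators
  by (simp add: form_def simple_root_def if_distrib [of "\<lambda>x. x * _"] cong: if_cong)

lemma form_uminus_left [simp]: "form (- f) g = - form f g"
  by (simp add: form_def sum_negf)

lemma form_uminus_right [simp]: "form f (- g) = - form f g"
  by (metis form_sym form_uminus_left)

lemma form_reflect:
  assumes "s \<in> S"
  shows "form (reflect s f) (reflect s g) = form f g"
  using assms form_sym[of f "simple_root s"]
  by (simp add: reflect_eq_comb form_comb_left form_comb_right form_simple_left algebra_simps)

lemma form_act:
  assumes "w \<in> carrier W"
  shows "form (act w f) (act w g) = form f g"
proof -
  obtain ws where ws: "ws \<in> lists S" "wp ws = w" using ex_word assms by blast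
  have "form (word_act ws f) (word_act ws g) = form f g"
    using ws(1) by (induction ws) (auto simp: form_reflect)
  then show ?thesis using ws act_wp[OF ws(1)] by simp
qed

lemma act_outside:
  assumes "w \<in> carrier W" "i \<notin> S"
  shows "act w f i = f i"
proof -
  obtain ws where ws: "ws \<in> lists S" "wp ws = w" using ex_word assms by blast
  have "word_act ws f i = f i"
    using ws(1) assms by (induction ws) (auto simp: reflect_def)
  then show ?thesis using ws act_wp[OF ws(1)] by simp
qed

definition roots :: "('a \<Rightarrow> real) set" where
  "roots = {act w (simple_root s) | w s. w \<in> carrier W \<and> s \<in> S}"

definition posroots :: "('a \<Rightarrow> real) set" where
  "posroots = {f \<in> roots. nonneg f}"

lemma rootI: "w \<in> carrier W \<Longrightarrow> s \<in> S \<Longrightarrow> act w (simple_root s) \<in> roots"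
  by (auto simp: roots_def)

lemma rootE:
  assumes "f \<in> roots"
  obtains w s where "w \<in> carrier W" "s \<in> S" "f = act w (simple_root s)"
  using assms by (auto simp: roots_def)

lemma act_root: "w \<in> carrier W \<Longrightarrow> f \<in> roots \<Longrightarrow> act w f \<in> roots"
  by (metis act_mult m_closed rootE rootI)

lemma reflect_root: "s \<in> S \<Longrightarrow> f \<in> roots \<Longrightarrow> reflect s f \<in> roots"
  by (metis act_gen act_root gen_closed)

lemma root_norm: "f \<in> roots \<Longrightarrow> form f f = 2"
  by (erule rootE) (simp add: form_act form_simple_left)

lemma root_supp: "f \<in> roots \<Longrightarrow> i \<notin> S \<Longrightarrow> f i = 0"
  by (erule rootE) (auto simp: act_outside simple_root_def)

lemma reflect_simple: "s \<in> S \<Longrightarrow> reflect s (simple_root s) = - simple_root s"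
  by (rule ext) (simp add: reflect_eq_comb comb_def)

lemma act_mult_gen_simple:
  "w \<in> carrier W \<Longrightarrow> s \<in> S \<Longrightarrow> act (w \<otimes> s) (simple_root s) = - act w (simple_root s)"
  by (simp add: act_mult gen_closed reflect_simple act_uminus)

lemma uminus_root: "f \<in> roots \<Longrightarrow> - f \<in> roots"
  by (metis act_mult_gen_simple gen_closed m_closed rootE rootI)

lemma act_simple_sign:
  assumes "w \<in> carrier W" "s \<in> S"
  shows "len w < len (w \<otimes> s) \<Longrightarrow> nonneg (act w (simple_root s))"
    and "len (w \<otimes> s) < len w \<Longrightarrow> nonneg (- act w (simple_root s))"
  using root_positivity[of w s] root_positivity[of "w \<otimes> s" s] assms
  by (auto simp: gen_closed act_mult_gen_simple)

lemma root_cases: "f \<in> roots \<Longrightarrow> nonneg f \<or> nonneg (- f)"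
  by (metis act_simple_sign len_mult_gen_ne linorder_neqE_nat rootE)

lemma root_not_both: "f \<in> roots \<Longrightarrow> nonneg f \<Longrightarrow> nonneg (- f) \<Longrightarrow> False"
proof -
  assume "f \<in> roots" "nonneg f" "nonneg (- f)"
  then have "f = (\<lambda>i. 0)" by (auto simp: nonneg_def fun_eq_iff intro: antisym)
  then have "form f f = 0" by (simp add: form_def)
  then show False using root_norm[OF \<open>f \<in> roots\<close>] by simp
qed

lemma posrootD [dest]: "f \<in> posroots \<Longrightarrow> f \<in> roots \<and> nonneg f"
  by (simp add: posroots_def)

lemma posrootI: "f \<in> roots \<Longrightarrow> nonneg f \<Longrightarrow> f \<in> posroots"
  by (simp add: posroots_def)

lemma simple_root_root [simp]: "s \<in> S \<Longrightarrow> simple_root s \<in> roots"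
  using rootI[of \<one> s] by simp

lemma simple_posroot [simp]: "s \<in> S \<Longrightarrow> simple_root s \<in> posroots"
  by (simp add: posroots_def)

lemma posroot_coeff_nonneg: "f \<in> posroots \<Longrightarrow> 0 \<le> f i"
  by (simp add: posroots_def nonneg_def)

lemma posroot_of_pos_coeff: "f \<in> roots \<Longrightarrow> 0 < f i \<Longrightarrow> f \<in> posroots"
proof -
  assume a: "f \<in> roots" "0 < f i"
  have "\<not> nonneg (- f)"
  proof
    assume "nonneg (- f)"
    then have "0 \<le> (- f) i" unfolding nonneg_def by blast
    then show False using a by simp
  qed
  then show ?thesis using root_cases a by (auto simp: posroots_def)
qed

text \<open>All roots have the same norm.\<close>

lemma posroot_single:
  assumes "f \<in> posroots" "s \<in> S" "\<And>i. i \<noteq> s \<Longrightarrow> f i = 0"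
  shows "f = simple_root s"
proof -
  have e: "f = comb (f s) (simple_root s) 0 (simple_root s)"
    using assms(3) by (auto simp: comb_def simple_root_def)
  have "form f f = 2 * (f s)\<^sup>2"
    by (subst (1 2) e) (use assms(2) in \<open>simp add: form_comb_left form_comb_right form_simple_left power2_eq_square\<close>)
  then have "(f s)\<^sup>2 = 1" using root_norm assms(1) by auto
  then have "f s = 1" using posroot_coeff_nonneg[OF assms(1), of s] by (simp add: power2_eq_1_iff)
  then show ?thesis using e by (auto simp: comb_def)
qed

text \<open>The reflection changes the coordinate \<open>s\<close> alone, so another positive coordinate survives.\<close>

lemma reflect_posroot:
  assumes "f \<in> posroots" "s \<in> S" "f \<noteq> simple_root s"
  shows "reflect s f \<in> posroots"
proof -
  obtain i where i: "i \<noteq> s" "f i \<noteq> 0" using posroot_single assms by blast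
  then have "0 < reflect s f i" using posroot_coeff_nonneg[OF assms(1), of i] by (simp add: reflect_def)
  then show ?thesis using posroot_of_pos_coeff reflect_root assms by blast
qed

lemma reflect_ne_simple:
  assumes "f \<in> posroots" "s \<in> S"
  shows "reflect s f \<noteq> simple_root s"
proof
  assume "reflect s f = simple_root s"
  then have "f = - simple_root s" using reflect_reflect[OF assms(2), of f] reflect_simple assms by metis
  then show False using assms(1) root_not_both[of f] assms(2) by (auto dest!: posrootD)
qed

text \<open>These are the roots of the reflections in the inversion set of \<open>w\<close>, see \<open>inversions_iff\<close>.\<close>

definition inv_roots :: "'a \<Rightarrow> ('a \<Rightarrow> real) set" where
  "inv_roots w = {f \<in> posroots. nonneg (- act (inv w) f)}"

abbreviation (input) N where "N \<equiv> inv_roots"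

lemma inv_rootsD: "f \<in> N w \<Longrightarrow> f \<in> posroots" "f \<in> N w \<Longrightarrow> nonneg (- act (inv w) f)"
  by (auto simp: inv_roots_def)

lemma inv_roots_subset: "N w \<subseteq> posroots" by (auto simp: inv_roots_def)

lemma notin_inv_roots:
  "w \<in> carrier W \<Longrightarrow> f \<in> posroots \<Longrightarrow> f \<notin> N w \<longleftrightarrow> nonneg (act (inv w) f)"
  using root_cases[of "act (inv w) f"] root_not_both[of "act (inv w) f"] act_root[of "inv w" f]
  by (auto simp: inv_roots_def)

lemma inv_roots_one [simp]: "N \<one> = {}"
proof -
  have "f \<notin> N \<one>" for f
    using root_not_both[of f] by (auto simp: inv_roots_def posroots_def)
  then show ?thesis by blast
qed

lemma inv_roots_closed:
  assumes "f \<in> N w" "g \<in> N w" "0 \<le> a" "0 \<le> b" "comb a f b g \<in> posroots"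
  shows "comb a f b g \<in> N w"
proof -
  have "- act (inv w) (comb a f b g) = comb a (- act (inv w) f) b (- act (inv w) g)"
    unfolding act_comb by (rule ext) (simp add: comb_def)
  moreover have "nonneg (comb a (- act (inv w) f) b (- act (inv w) g))"
    by (rule nonneg_comb) (use assms inv_rootsD in blast)+
  ultimately show ?thesis using assms(5) by (simp add: inv_roots_def)
qed

lemma simple_in_inv_roots:
  assumes "w \<in> carrier W" "s \<in> S"
  shows "simple_root s \<in> N w \<longleftrightarrow> len (s \<otimes> w) < len w"
proof -
  have i: "len (inv w \<otimes> s) = len (s \<otimes> w)" using len_inv[of "s \<otimes> w"] assms
    by (simp add: inv_mult_group gen_closed)
  have l: "len (inv w) = len w" using len_inv assms by blast
  show ?thesis
    using act_simple_sign[of "inv w" s] root_not_both[of "act (inv w) (simple_root s)"] rootI[of "inv w" s]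
      len_mult_gen_ne[of "inv w" s] assms i l linorder_neqE_nat[of "len (s \<otimes> w)" "len w"]
    by (auto simp: inv_roots_def)
qed

lemma inv_roots_mult_gen_left:
  assumes w: "w \<in> carrier W" and s: "s \<in> S" and n: "simple_root s \<notin> N w"
  shows "N (s \<otimes> w) = insert (simple_root s) (reflect s ` N w)"
proof -
  have i: "act (inv (s \<otimes> w)) f = act (inv w) (reflect s f)" for f
    using w s by (simp add: inv_mult_group gen_closed act_mult)
  have "nonneg (act (inv w) (simple_root s))"
    using notin_inv_roots[OF w simple_posroot[OF s]] n by blast
  then have ss: "simple_root s \<in> N (s \<otimes> w)"
    using s by (simp add: inv_roots_def i reflect_simple act_uminus)
  have iff: "f \<in> N (s \<otimes> w) \<longleftrightarrow> reflect s f \<in> N w" if "f \<in> posroots" "f \<noteq> simple_root s" for f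
    unfolding inv_roots_def i using reflect_posroot[OF that(1) s that(2)] that by simp
  show ?thesis
  proof (intro subset_antisym subsetI)
    fix f assume "f \<in> N (s \<otimes> w)"
    then show "f \<in> insert (simple_root s) (reflect s ` N w)"
      using iff[of f] inv_rootsD(1)[of f] reflect_reflect[OF s, of f] by (metis image_eqI insert_iff)
  next
    fix f assume "f \<in> insert (simple_root s) (reflect s ` N w)"
    then consider "f = simple_root s" | g where "g \<in> N w" "f = reflect s g" by blast
    then show "f \<in> N (s \<otimes> w)"
    proof cases
      case 2
      then have g: "g \<in> posroots" "g \<noteq> simple_root s" using inv_rootsD n by auto
      then show ?thesis using iff[of f] 2 reflect_posroot[OF g(1) s g(2)] reflect_ne_simple[OF g(1) s] s by simp
    qed (use ss in simp)
  qed
qed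

lemma inv_roots_mult_gen_left':
  assumes w: "w \<in> carrier W" and s: "s \<in> S" and n: "simple_root s \<in> N w"
  shows "N (s \<otimes> w) = reflect s ` (N w - {simple_root s})" "simple_root s \<notin> N (s \<otimes> w)"
proof -
  have c: "s \<otimes> w \<in> carrier W" using w s gen_closed by simp
  have sw: "simple_root s \<notin> N (s \<otimes> w)"
  proof -
    have "len (s \<otimes> w) < len w" by (rule iffD1[OF simple_in_inv_roots[OF w s] n])
    then have "\<not> len (s \<otimes> (s \<otimes> w)) < len (s \<otimes> w)" using w s by simp
    then show ?thesis by (simp only: simple_in_inv_roots[OF c s] not_False_eq_True)
  qed
  have "N w = insert (simple_root s) (reflect s ` N (s \<otimes> w))"
    using inv_roots_mult_gen_left[OF c s sw] w s by simp
  moreover have "simple_root s \<notin> reflect s ` N (s \<otimes> w)"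
  proof
    assume "simple_root s \<in> reflect s ` N (s \<otimes> w)"
    then obtain f where "f \<in> N (s \<otimes> w)" "simple_root s = reflect s f" ..
    then show False using reflect_ne_simple[OF inv_rootsD(1) s, of f "s \<otimes> w"] by simp
  qed
  ultimately have "N w - {simple_root s} = reflect s ` N (s \<otimes> w)" by (metis Diff_insert_absorb)
  then have "reflect s ` (N w - {simple_root s}) = (\<lambda>f. reflect s (reflect s f)) ` N (s \<otimes> w)"
    by (simp only: image_image)
  then show "N (s \<otimes> w) = reflect s ` (N w - {simple_root s})" using s by simp
  show "simple_root s \<notin> N (s \<otimes> w)" by (fact sw)
qed

lemma inv_roots_mult_gen_right:
  assumes w: "w \<in> carrier W" and s: "s \<in> S" and n: "nonneg (act w (simple_root s))"
  shows "N (w \<otimes> s) = insert (act w (simple_root s)) (N w)" "act w (simple_root s) \<notin> N w"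
    "act w (simple_root s) \<in> posroots"
proof -
  let ?b = "act w (simple_root s)"
  have i: "act (inv (w \<otimes> s)) f = reflect s (act (inv w) f)" for f
    using w s by (simp add: inv_mult_group gen_closed act_mult)
  show b: "?b \<in> posroots" using n rootI w s by (simp add: posroots_def)
  show bn: "?b \<notin> N w" using b w s notin_inv_roots by simp
  have b': "?b \<in> N (w \<otimes> s)" using b w s by (simp add: inv_roots_def i reflect_simple)
  have "f \<in> N (w \<otimes> s) \<longleftrightarrow> f \<in> N w" if f: "f \<in> posroots" "f \<noteq> ?b" for f
  proof -
    have ne: "act (inv w) f \<noteq> simple_root s" using f w by (metis act_act_inv)
    have r: "act (inv w) f \<in> roots" using f w act_root by blast
    show ?thesis
    proof (cases "nonneg (act (inv w) f)")
      case True
      then have "nonneg (reflect s (act (inv w) f))" using reflect_posroot[of "act (inv w) f" s] r s ne posrootI by blast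
      then show ?thesis using True f w s notin_inv_roots[of "w \<otimes> s" f] notin_inv_roots[of w f] by (simp add: i gen_closed)
    next
      case False
      then have neg: "nonneg (- act (inv w) f)" using root_cases r by blast
      have "f \<in> N w" using neg f by (simp add: inv_roots_def)
      have "- act (inv w) f \<noteq> simple_root s"
      proof
        assume e: "- act (inv w) f = simple_root s"
        have "f = - ?b" using f w act_act_inv[of w f] act_uminus[of w "act (inv w) f"] unfolding e by simp
        then show False using f n root_not_both[of f] by auto
      qed
      then have "nonneg (reflect s (- act (inv w) f))"
        using reflect_posroot[of "- act (inv w) f" s] neg r s uminus_root posrootI by blast
      then show ?thesis using \<open>f \<in> N w\<close> f by (simp add: inv_roots_def i reflect_uminus)
    qed
  qed
  then show "N (w \<otimes> s) = insert ?b (N w)" using b' inv_roots_subset by blast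
qed

lemma inv_roots_mult_gen_right':
  assumes w: "w \<in> carrier W" and s: "s \<in> S" and n: "nonneg (- act w (simple_root s))"
  shows "N (w \<otimes> s) = N w - {- act w (simple_root s)}" "- act w (simple_root s) \<in> N w"
proof -
  have "nonneg (act (w \<otimes> s) (simple_root s))" using n w s by (simp add: act_mult_gen_simple)
  from inv_roots_mult_gen_right[OF _ s this] w s
  show "N (w \<otimes> s) = N w - {- act w (simple_root s)}" "- act w (simple_root s) \<in> N w"
    by (auto simp: gen_closed act_mult_gen_simple)
qed

lemma eq_one_if_positive:
  assumes "w \<in> carrier W" "\<And>s. s \<in> S \<Longrightarrow> nonneg (act w (simple_root s))"
  shows "w = \<one>"
proof (rule ccontr)
  assume "w \<noteq> \<one>"
  then obtain s where "s \<in> S" "len (w \<otimes> s) < len w" using ex_right_descent assms by blast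
  then show False using act_simple_sign(2)[of w s] assms root_not_both rootI by blast
qed

lemma faithful:
  assumes "x \<in> carrier W" "y \<in> carrier W" "\<And>f. act x f = act y f"
  shows "x = y"
proof -
  have "act (inv y \<otimes> x) f = f" for f using assms by (simp add: act_mult)
  then have "inv y \<otimes> x = \<one>" using assms by (intro eq_one_if_positive) auto
  then show ?thesis using assms by (metis inv_closed inv_equality inv_inv)
qed

lemma act_conj:
  assumes "w \<in> carrier W" "s \<in> S"
  shows "act (w \<otimes> s \<otimes> inv w) f = comb 1 f (- form (act w (simple_root s)) f) (act w (simple_root s))"
proof -
  have "pairing s (act (inv w) f) = form (act w (simple_root s)) f"
    using form_act[of w "simple_root s" "act (inv w) f"] assms by (simp add: form_simple_left)
  then show ?thesis using assms by (simp add: act_mult gen_closed reflect_eq_comb act_comb)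
qed

text \<open>A reflection determines its \<open>-1\<close>-eigenspace and thus its root up to sign; conversely the root determines
the action, and the representation is faithful.\<close>

lemma conj_eq_iff:
  assumes "w \<in> carrier W" "s \<in> S" "w' \<in> carrier W" "s' \<in> S"
  shows "w \<otimes> s \<otimes> inv w = w' \<otimes> s' \<otimes> inv w' \<longleftrightarrow>
    act w (simple_root s) = act w' (simple_root s') \<or> act w (simple_root s) = - act w' (simple_root s')"
    (is "?t = ?t' \<longleftrightarrow> ?b = ?b' \<or> ?b = - ?b'")
proof
  assume e: "?t = ?t'"
  have n: "form ?b ?b = 2" "form ?b' ?b' = 2" using assms root_norm rootI by blast+
  have "act ?t ?b = - ?b" using act_conj[OF assms(1,2)] n by (auto simp: comb_def)
  moreover have "act ?t ?b = comb 1 ?b (- form ?b' ?b) ?b'" using act_conj[OF assms(3,4)] e by simp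
  ultimately have bb: "?b = comb (form ?b' ?b / 2) ?b' 0 ?b'" by (auto simp: comb_def fun_eq_iff algebra_simps)
  define c where "c = form ?b' ?b / 2"
  have "form ?b ?b = c * c * form ?b' ?b'"
    by (subst (1 2) bb) (simp add: form_comb_left form_comb_right c_def)
  then have "c = 1 \<or> c = - 1" using n by (simp add: square_eq_1_iff)
  then show "?b = ?b' \<or> ?b = - ?b'" using bb unfolding c_def[symmetric] by (auto simp: comb_def fun_eq_iff)
next
  assume "?b = ?b' \<or> ?b = - ?b'"
  then have "act ?t f = act ?t' f" for f
    unfolding act_conj[OF assms(1,2)] act_conj[OF assms(3,4)] by (auto simp: comb_def)
  then show "?t = ?t'" using assms by (intro faithful) (auto simp: gen_closed)
qed

text \<open>Applying the inverses of the letters of a reduced word for \<open>w\<close> one after the other makes the root negative at some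
letter \<open>a\<close>, just before which it has become \<open>\<alpha>\<^sub>a\<close>. Multiplying \<open>w\<close> by the reflection deletes this letter.\<close>

lemma reflection_shortens:
  assumes w: "w \<in> carrier W" and u: "u \<in> carrier W" and s: "s \<in> S" and b: "act u (simple_root s) \<in> N w"
  shows "len (u \<otimes> s \<otimes> inv u \<otimes> w) < len w"
proof -
  obtain ws where ws: "ws \<in> lists S" "wp ws = w" "length ws = len w" using ex_reduced w .
  have crossing: "\<exists>xs a ys. ws = xs @ a # ys \<and> word_act (rev xs) f = simple_root a"
    if "f \<in> posroots" "\<not> nonneg (word_act (rev ws) f)" "ws \<in> lists S" for f ws
    using that
  proof (induction ws arbitrary: f)
    case Nil then show ?case by auto
  next
    case (Cons a ws)
    show ?case
    proof (cases "f = simple_root a")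
      case True then show ?thesis by (intro exI[of _ "[]"]) auto
    next
      case False
      then have "reflect a f \<in> posroots" using Cons.prems reflect_posroot by auto
      moreover have "\<not> nonneg (word_act (rev ws) (reflect a f))" using Cons.prems(2) by (simp add: word_act_append)
      ultimately have "\<exists>xs b ys. ws = xs @ b # ys \<and> word_act (rev xs) (reflect a f) = simple_root b"
        by (rule Cons.IH) (use Cons.prems in auto)
      then obtain xs b ys where "ws = xs @ b # ys" "word_act (rev xs) (reflect a f) = simple_root b" by blast
      then show ?thesis by (intro exI[of _ "a # xs"]) (auto simp: word_act_append)
    qed
  qed
  let ?b = "act u (simple_root s)"
  have "rev ws \<in> lists S" using ws by auto
  then have "act (inv w) = word_act (rev ws)" using wp_rev[of ws] ws act_wp by auto
  then obtain xs a ys where x: "ws = xs @ a # ys" "word_act (rev xs) ?b = simple_root a"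
  proof -
    have "?b \<in> posroots" using b inv_rootsD by blast
    moreover have "\<not> nonneg (word_act (rev ws) ?b)"
      using root_not_both[OF act_root[of "inv w" ?b]] inv_rootsD[OF b] w posrootD \<open>act (inv w) = word_act (rev ws)\<close>
      by (metis inv_closed)
    ultimately show ?thesis using crossing[of ?b ws] ws(1) that by blast
  qed
  have l: "xs \<in> lists S" "a \<in> S" "ys \<in> lists S" using x ws by auto
  have "rev xs \<in> lists S" using l by auto
  then have "act (inv (wp xs)) ?b = simple_root a" using x wp_rev[of xs] l act_wp by simp
  then have "?b = act (wp xs) (simple_root a)" using l by (metis act_act_inv wp_closed)
  then have t: "u \<otimes> s \<otimes> inv u = wp xs \<otimes> a \<otimes> inv (wp xs)"
    using conj_eq_iff[OF u s wp_closed[OF l(1)] l(2)] by simp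
  have wx: "w = wp xs \<otimes> (a \<otimes> wp ys)" using x ws l by (simp add: wp_append)
  have "u \<otimes> s \<otimes> inv u \<otimes> w = wp (xs @ ys)"
  proof -
    have "inv (wp xs) \<otimes> (wp xs \<otimes> z) = z" if "z \<in> carrier W" for z
      using that l by (simp flip: m_assoc)
    then show ?thesis
      unfolding t wx using l by (simp add: wp_append m_assoc gen_closed)
  qed
  then show ?thesis using len_wp_le[of "xs @ ys"] l x ws by auto
qed

lemma inversions_iff:
  assumes w: "w \<in> carrier W" and u: "u \<in> carrier W" and s: "s \<in> S" and b: "act u (simple_root s) \<in> posroots"
  shows "u \<otimes> s \<otimes> inv u \<in> inversions W S w \<longleftrightarrow> act u (simple_root s) \<in> N w"
proof -
  let ?t = "u \<otimes> s \<otimes> inv u" and ?b = "act u (simple_root s)"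
  have t: "?t \<in> carrier W" using u s gen_closed by simp
  have neg: "act ?t ?b = - ?b"
    using root_norm[OF rootI[OF u s]] act_conj[OF u s] by (auto simp: comb_def)
  have tt: "?t \<otimes> ?t = \<one>"
  proof -
    have "inv u \<otimes> (u \<otimes> z) = z" if "z \<in> carrier W" for z using u that by (simp flip: m_assoc)
    then show ?thesis using u s by (simp add: m_assoc gen_closed)
  qed
  have ref: "?t \<in> reflections W S" using u s by (auto simp: reflections_def)
  show ?thesis
  proof
    assume "?b \<in> N w"
    then show "?t \<in> inversions W S w" using reflection_shortens[OF w u s] ref by (simp add: inversions_def)
  next
    assume i: "?t \<in> inversions W S w"
    show "?b \<in> N w"
    proof (rule ccontr)
      assume n: "?b \<notin> N w"
      have "inv (?t \<otimes> w) = inv w \<otimes> ?t" using t w inv_equality[OF tt t t] by (simp only: inv_mult_group)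
      then have "act (inv (?t \<otimes> w)) ?b = act (inv w) (act ?t ?b)" using t w by (simp add: act_mult)
      then have "- act (inv (?t \<otimes> w)) ?b = act (inv w) ?b" unfolding neg act_uminus by simp
      then have "nonneg (- act (inv (?t \<otimes> w)) ?b)" using n w b notin_inv_roots by simp
      then have "?b \<in> N (?t \<otimes> w)" using b by (simp add: inv_roots_def)
      then have "len (?t \<otimes> (?t \<otimes> w)) < len (?t \<otimes> w)" using reflection_shortens[of "?t \<otimes> w" u s] t w u s by simp
      moreover have "?t \<otimes> (?t \<otimes> w) = w" using m_assoc[OF t t w] w by (simp only: tt l_one)
      ultimately show False using i by (simp add: inversions_def)
    qed
  qed
qed

lemma inversions_subset_iff:
  assumes "v \<in> carrier W" "w \<in> carrier W"
  shows "inversions W S v \<subseteq> inversions W S w \<longleftrightarrow> N v \<subseteq> N w"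
proof
  assume i: "inversions W S v \<subseteq> inversions W S w"
  show "N v \<subseteq> N w"
  proof
    fix f assume f: "f \<in> N v"
    then obtain u s where us: "u \<in> carrier W" "s \<in> S" "f = act u (simple_root s)"
      using inv_rootsD(1) rootE by blast
    then have p: "act u (simple_root s) \<in> posroots" using inv_rootsD(1)[OF f] by simp
    have "u \<otimes> s \<otimes> inv u \<in> inversions W S v"
      using inversions_iff[OF assms(1) us(1,2) p] f us(3) by simp
    then have "u \<otimes> s \<otimes> inv u \<in> inversions W S w" by (rule subsetD[OF i])
    then show "f \<in> N w" using inversions_iff[OF assms(2) us(1,2) p] us(3) by simp
  qed
next
  assume n: "N v \<subseteq> N w"
  show "inversions W S v \<subseteq> inversions W S w"
  proof
    fix t assume t: "t \<in> inversions W S v"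
    then obtain u s where us: "u \<in> carrier W" "s \<in> S" "t = u \<otimes> s \<otimes> inv u"
      by (auto simp: inversions_def reflections_def)
    have "\<exists>u'. u' \<in> carrier W \<and> t = u' \<otimes> s \<otimes> inv u' \<and> act u' (simple_root s) \<in> posroots" (is "\<exists>u'. ?P u'")
    proof (cases "nonneg (act u (simple_root s))")
      case True
      then have "?P u" using us posrootI[OF rootI[OF us(1,2)]] by simp
      then show ?thesis by (rule exI)
    next
      case False
      then have "nonneg (act (u \<otimes> s) (simple_root s))"
        using root_cases[OF rootI[OF us(1,2)]] us by (simp add: act_mult_gen_simple)
      moreover have "t = (u \<otimes> s) \<otimes> s \<otimes> inv (u \<otimes> s)"
        unfolding us(3) using us conj_eq_iff[of u s "u \<otimes> s" s] act_mult_gen_simple[of u s] by (simp only: gen_closed m_closed) simp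
      moreover have us': "u \<otimes> s \<in> carrier W" using us gen_closed by simp
      ultimately have "?P (u \<otimes> s)" using posrootI[OF rootI[OF us' us(2)]] by simp
      then show ?thesis by (rule exI)
    qed
    then obtain u' where u': "?P u'" ..
    then show "t \<in> inversions W S w"
      using t n inversions_iff[OF assms(1), of u' s] inversions_iff[OF assms(2), of u' s] us(2) by auto
  qed
qed

text \<open>If every positive root of the form \<open>v \<alpha>\<^sub>s\<close> were outside \<open>N w\<close>, then \<open>w\<inverse> v\<close> would keep all simple roots
positive and be \<open>1\<close>.\<close>

lemma inv_roots_mono_cases:
  assumes v: "v \<in> carrier W" and w: "w \<in> carrier W" and sub: "N v \<subseteq> N w" and ne: "v \<noteq> w"
  shows "\<exists>s\<in>S. nonneg (act v (simple_root s)) \<and> act v (simple_root s) \<in> N w"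
proof (rule ccontr)
  assume no: "\<not> ?thesis"
  have "inv w \<otimes> v = \<one>"
  proof (rule eq_one_if_positive)
    fix s assume s: "s \<in> S"
    show "nonneg (act (inv w \<otimes> v) (simple_root s))"
    proof (cases "nonneg (act v (simple_root s))")
      case True
      then show ?thesis using no s v w notin_inv_roots[of w "act v (simple_root s)"] rootI posrootI
        by (auto simp: act_mult)
    next
      case False
      then have "nonneg (- act v (simple_root s))" using root_cases rootI v s by blast
      then have "- act v (simple_root s) \<in> N w" using inv_roots_mult_gen_right' v s sub by blast
      then show ?thesis using inv_rootsD(2) v w by (fastforce simp: act_mult act_uminus)
    qed
  qed (use v w in auto)
  then show False using ne v w by (metis inv_closed inv_equality inv_inv)
qed

lemma inv_roots_inj:
  assumes "v \<in> carrier W" "w \<in> carrier W" "N v = N w"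
  shows "v = w"
proof (rule ccontr)
  assume "v \<noteq> w"
  then obtain s where "s \<in> S" "nonneg (act v (simple_root s))" "act v (simple_root s) \<in> N w"
    using inv_roots_mono_cases[of v w] assms by auto
  then show False using inv_roots_mult_gen_right(2) assms by blast
qed

lemma cover_above:
  assumes "v \<in> carrier W" "w \<in> carrier W" "N v \<subseteq> N w" "v \<noteq> w"
  obtains s where "s \<in> S" "act v (simple_root s) \<in> posroots" "act v (simple_root s) \<notin> N v"
    "N (v \<otimes> s) = insert (act v (simple_root s)) (N v)" "N (v \<otimes> s) \<subseteq> N w"
  using inv_roots_mono_cases[OF assms] inv_roots_mult_gen_right[OF assms(1)] assms(3) by (metis insert_subset)

lemma cover_below:
  assumes v: "v \<in> carrier W" and w: "w \<in> carrier W" and sub: "N v \<subseteq> N w" and ne: "v \<noteq> w"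
  obtains s where "s \<in> S" "- act w (simple_root s) \<in> N w" "- act w (simple_root s) \<notin> N v"
    "N (w \<otimes> s) = N w - {- act w (simple_root s)}" "N v \<subseteq> N (w \<otimes> s)"
proof -
  have "\<exists>s\<in>S. nonneg (- act w (simple_root s)) \<and> - act w (simple_root s) \<notin> N v"
  proof (rule ccontr)
    assume no: "\<not> ?thesis"
    have "inv v \<otimes> w = \<one>"
    proof (rule eq_one_if_positive)
      fix s assume s: "s \<in> S"
      show "nonneg (act (inv v \<otimes> w) (simple_root s))"
      proof (cases "nonneg (act w (simple_root s))")
        case True
        then have "act w (simple_root s) \<in> posroots - N v" using inv_roots_mult_gen_right[OF w s] sub by blast
        then show ?thesis using notin_inv_roots v w by (auto simp: act_mult)
      next
        case False
        then have "nonneg (- act w (simple_root s))" using root_cases rootI w s by blast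
        then have "- act w (simple_root s) \<in> N v" using no s by blast
        then show ?thesis using inv_rootsD(2) v w by (fastforce simp: act_mult act_uminus)
      qed
    qed (use v w in auto)
    then show False using ne v w by (metis inv_closed inv_equality inv_inv)
  qed
  then obtain s where s: "s \<in> S" "nonneg (- act w (simple_root s))" "- act w (simple_root s) \<notin> N v" by blast
  note r = inv_roots_mult_gen_right'[OF w s(1,2)]
  have "N v \<subseteq> N (w \<otimes> s)" unfolding r(1) using sub s(3) by blast
  then show ?thesis by (rule that[OF s(1) r(2) s(3) r(1)])
qed

end

context finite_coxeter_system
begin

lemma finite_posroots: "finite posroots"
proof -
  have "roots = (\<lambda>(w, s). act w (simple_root s)) ` (carrier W \<times> S)" by (auto simp: roots_def)
  then show ?thesis using finite_W finite_generators by (auto simp: posroots_def)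
qed

lemma finite_inv_roots [simp]: "finite (inv_roots w)"
  using finite_posroots inv_roots_subset finite_subset by blast

end

section \<open>Parabolic subgroups and the lattice property\<close>

lemma ex_maximizer:
  fixes f :: "'b \<Rightarrow> nat"
  assumes "finite A" "a \<in> A"
  obtains u where "u \<in> A" "\<And>v. v \<in> A \<Longrightarrow> f v \<le> f u"
proof -
  have "Max (f ` A) \<in> f ` A" using assms by (intro Max_in) auto
  then obtain u where u: "u \<in> A" "f u = Max (f ` A)" by auto
  have "f v \<le> f u" if "v \<in> A" for v
    unfolding u(2) using assms(1) that by (intro Max_ge) auto
  then show ?thesis using that u(1) by blast
qed

text \<open>For a root this says that it belongs to the parabolic subgroup generated by \<open>J\<close>.\<close>

definition supp_in :: "'a set \<Rightarrow> ('a \<Rightarrow> real) \<Rightarrow> bool" where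
  "supp_in J f \<longleftrightarrow> (\<forall>i. i \<notin> J \<longrightarrow> f i = 0)"

lemma supp_inD: "supp_in J f \<Longrightarrow> i \<notin> J \<Longrightarrow> f i = 0"
  by (simp add: supp_in_def)

lemma supp_in_summands:
  assumes "nonneg f" "nonneg g" "0 < a" "0 < b" "supp_in J (comb a f b g)"
  shows "supp_in J f" "supp_in J g"
proof -
  have "f i = 0 \<and> g i = 0" if i: "i \<notin> J" for i
  proof -
    have "a * f i + b * g i = 0" using supp_inD[OF assms(5) i] by (simp add: comb_def)
    moreover have "0 \<le> a * f i" "0 \<le> b * g i" using assms by (auto simp: nonneg_def)
    ultimately have "a * f i = 0" "b * g i = 0" by linarith+
    then show ?thesis using assms by simp
  qed
  then show "supp_in J f" "supp_in J g" by (simp_all add: supp_in_def)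
qed

context coxeter_system
begin

text \<open>A nonnegative vector is a nonnegative combination of simple roots, so positivity of its image has to be
checked on simple roots only.\<close>

lemma nonneg_linear_image:
  assumes lin: "\<And>a f b g. h (comb a f b g) = comb a (h f) b (h g)"
    and J: "finite J" and g: "nonneg g" "supp_in J g" and pos: "\<And>j. j \<in> J \<Longrightarrow> nonneg (h (simple_root j))"
  shows "nonneg (h g)"
  using J g pos
proof (induction J arbitrary: g rule: finite_induct)
  case empty
  then have "g = comb 0 g 0 g" by (auto simp: supp_in_def comb_def)
  then have "h g = comb 0 (h g) 0 (h g)" using lin by metis
  then show ?case by (simp add: nonneg_def comb_def fun_eq_iff)
next
  case (insert j J)
  have e: "g = comb 1 (g(j := 0)) (g j) (simple_root j)"
    by (auto simp: comb_def simple_root_def)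
  have "nonneg (h (g(j := 0)))"
    by (rule insert.IH) (use insert.prems in \<open>auto simp: nonneg_def supp_in_def\<close>)
  moreover have "h g = comb 1 (h (g(j := 0))) (g j) (h (simple_root j))"
    by (subst e) (rule lin)
  moreover have "0 \<le> g j" using insert.prems by (simp add: nonneg_def)
  ultimately show ?case using insert.prems(3)[of j] by (simp add: nonneg_comb)
qed

lemma nonneg_act:
  assumes "finite J" "nonneg g" "supp_in J g" "\<And>j. j \<in> J \<Longrightarrow> nonneg (act w (simple_root j))"
  shows "nonneg (act w g)"
  by (rule nonneg_linear_image[of "act w", OF act_comb assms])

lemma nonpos_act:
  assumes "finite J" "nonneg g" "supp_in J g" "\<And>j. j \<in> J \<Longrightarrow> nonneg (- act w (simple_root j))"
  shows "nonneg (- act w g)"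
proof (rule nonneg_linear_image[of "\<lambda>f. - act w f", OF _ assms])
  fix a b :: real and f g :: "'a \<Rightarrow> real"
  show "- act w (comb a f b g) = comb a (- act w f) b (- act w g)"
    unfolding act_comb by (rule ext) (simp add: comb_def)
qed

lemma root_supp_in: "f \<in> roots \<Longrightarrow> supp_in S f"
  using root_supp by (simp add: supp_in_def)

lemma supp_in_simple [simp]: "supp_in J (simple_root s) \<longleftrightarrow> s \<in> J"
  by (auto simp: supp_in_def simple_root_def)

lemma word_act_outside: "ws \<in> lists J \<Longrightarrow> i \<notin> J \<Longrightarrow> word_act ws f i = f i"
  by (induction ws) (auto simp: reflect_def)

lemma inv_roots_word_supp:
  assumes "ws \<in> lists J" "J \<subseteq> S" "f \<in> N (wp ws)"
  shows "supp_in J f"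
  unfolding supp_in_def
proof (intro allI impI)
  fix i assume i: "i \<notin> J"
  have L: "ws \<in> lists S" "rev ws \<in> lists S" "rev ws \<in> lists J" using assms by auto
  have "act (inv (wp ws)) f = word_act (rev ws) f" using L wp_rev act_wp by simp
  then have "act (inv (wp ws)) f i = f i" using word_act_outside[OF L(3) i] by simp
  moreover have "0 \<le> (- act (inv (wp ws)) f) i" using inv_rootsD(2)[OF assms(3)] unfolding nonneg_def by (rule spec)
  moreover have "0 \<le> f i" using inv_rootsD(1)[OF assms(3)] by (rule posroot_coeff_nonneg)
  ultimately show "f i = 0" by simp
qed

lemma inv_roots_gen: "s \<in> S \<Longrightarrow> N s = {simple_root s}"
  using inv_roots_mult_gen_left[of \<one> s] by (simp add: gen_closed)

text \<open>The root \<open>w \<alpha>\<^sub>r = - \<alpha>\<^sub>s\<close> belongs to the reflections \<open>w r w\<inverse>\<close> and \<open>s\<close>, which are therefore equal.\<close>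

lemma descent_commute:
  assumes "w \<in> carrier W" "r \<in> S" "s \<in> S" "- act w (simple_root r) = simple_root s"
  shows "s \<otimes> w = w \<otimes> r"
proof -
  have "act w (simple_root r) = - act \<one> (simple_root s)" using assms(4) by (metis act_one uminus_uminus_fun)
  then have "w \<otimes> r \<otimes> inv w = \<one> \<otimes> s \<otimes> inv \<one>" using conj_eq_iff[OF assms(1,2) one_closed assms(3)] by simp
  then have "w \<otimes> r \<otimes> inv w = s" using assms gen_closed by simp
  then show ?thesis using assms gen_closed inv_solve_right[of s "w \<otimes> r" w] by simp
qed

lemma shift_subset:
  assumes x: "x \<in> carrier W" "simple_root s \<in> N x" and y: "y \<in> carrier W" "simple_root s \<in> N y" and s: "s \<in> S"
  shows "N (s \<otimes> x) \<subseteq> N (s \<otimes> y) \<longleftrightarrow> N x \<subseteq> N y"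
proof -
  have inj: "inj (reflect s)" using s by (metis injI reflect_reflect)
  show ?thesis
    unfolding inv_roots_mult_gen_left'(1)[OF x(1) s x(2)] inv_roots_mult_gen_left'(1)[OF y(1) s y(2)] inj_image_subset_iff[OF inj]
    using x(2) y(2) by blast
qed

lemma shift_subset':
  assumes x: "x \<in> carrier W" "simple_root s \<notin> N x" and y: "y \<in> carrier W" "simple_root s \<notin> N y" and s: "s \<in> S"
  shows "N (s \<otimes> x) \<subseteq> N (s \<otimes> y) \<longleftrightarrow> N x \<subseteq> N y"
proof -
  have "simple_root s \<in> N (s \<otimes> x)" "simple_root s \<in> N (s \<otimes> y)"
    using inv_roots_mult_gen_left[OF x(1) s x(2)] inv_roots_mult_gen_left[OF y(1) s y(2)] by simp_all
  from shift_subset[OF _ this(1) _ this(2) s] x y s show ?thesis by (simp add: gen_closed)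
qed

end

context finite_coxeter_system
begin

lemma card_inv_roots_shift:
  assumes w: "w \<in> carrier W" and s: "s \<in> S" and sw: "simple_root s \<in> N w"
  shows "card (N (s \<otimes> w)) < card (N w)"
proof -
  have "card (N (s \<otimes> w)) \<le> card (N w - {simple_root s})"
    unfolding inv_roots_mult_gen_left'(1)[OF w s sw] by (rule card_image_le) simp
  also have "\<dots> < card (N w)" using sw by (intro psubset_card_mono) auto
  finally show ?thesis .
qed

text \<open>Take the largest element \<open>u\<close> below \<open>w\<close> in the parabolic subgroup of \<open>J\<close>. It cannot be extended by a letter of
\<open>J\<close>, so \<open>w\<inverse> u\<close> keeps the simple roots of \<open>J\<close> positive, and then an inversion of \<open>w\<close>
supported on \<open>J\<close> that \<open>u\<close> does not invert would stay positive under \<open>w\<inverse>\<close>.\<close>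

lemma ex_parabolic_part:
  assumes w: "w \<in> carrier W" and J: "J \<subseteq> S"
  obtains u where "u \<in> carrier W" "N u = {f \<in> N w. supp_in J f}"
proof -
  define A where "A = {u. (\<exists>ws \<in> lists J. wp ws = u) \<and> N u \<subseteq> N w}"
  have Ac: "A \<subseteq> carrier W" using lists_mono[OF J] wp_closed unfolding A_def by blast
  have "\<one> \<in> A" unfolding A_def by (auto intro!: bexI[of _ "[]"])
  moreover have finA: "finite A" using Ac finite_W finite_subset by blast
  ultimately obtain u where u: "u \<in> A" and mx: "\<And>v. v \<in> A \<Longrightarrow> card (N v) \<le> card (N u)"
    using ex_maximizer[of A \<one> "\<lambda>v. card (N v)"] by metis
  obtain ws where ws: "ws \<in> lists J" "wp ws = u" and sub: "N u \<subseteq> N w" using u by (auto simp: A_def)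
  have uc: "u \<in> carrier W" using u Ac by blast
  have pos: "nonneg (act (inv w \<otimes> u) (simple_root j))" if j: "j \<in> J" for j
  proof (cases "nonneg (act u (simple_root j))")
    case True
    have jS: "j \<in> S" using j J by blast
    note r = inv_roots_mult_gen_right[OF uc jS True]
    have "act u (simple_root j) \<notin> N w"
    proof
      assume "act u (simple_root j) \<in> N w"
      then have "N (u \<otimes> j) \<subseteq> N w" using r(1) sub by simp
      moreover have "wp (ws @ [j]) = u \<otimes> j" "ws @ [j] \<in> lists J" using ws j J jS
        by (auto simp: wp_append gen_closed lists_mono[THEN subsetD])
      ultimately have "u \<otimes> j \<in> A" unfolding A_def by blast
      then show False using mx[of "u \<otimes> j"] r by simp
    qed
    then show ?thesis using notin_inv_roots[OF w r(3)] w uc by (simp add: act_mult)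
  next
    case False
    have jS: "j \<in> S" using j J by blast
    have "nonneg (- act u (simple_root j))" using False root_cases rootI[OF uc jS] by blast
    then have "- act u (simple_root j) \<in> N w" using inv_roots_mult_gen_right'(2)[OF uc jS] sub by blast
    then have "nonneg (- act (inv w) (- act u (simple_root j)))" by (rule inv_rootsD)
    then show ?thesis using w uc by (simp only: act_uminus uminus_uminus_fun act_mult inv_closed)
  qed
  have "N u = {f \<in> N w. supp_in J f}"
  proof (intro subset_antisym subsetI)
    fix f assume "f \<in> N u"
    then show "f \<in> {f \<in> N w. supp_in J f}" using inv_roots_word_supp[OF ws(1) J, of f] ws(2) sub by blast
  next
    fix f assume f: "f \<in> {f \<in> N w. supp_in J f}"
    show "f \<in> N u"
    proof (rule ccontr)
      assume n: "f \<notin> N u"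
      have fp: "f \<in> posroots" using f inv_rootsD by blast
      have g: "nonneg (act (inv u) f)" using notin_inv_roots[OF uc fp] n by blast
      have L: "rev ws \<in> lists J" "rev ws \<in> lists S" "ws \<in> lists S" using ws J by auto
      have "act (inv u) f = word_act (rev ws) f" using L wp_rev[of ws] ws act_wp by metis
      then have "supp_in J (act (inv u) f)" using word_act_outside[OF L(1)] f by (simp add: supp_in_def)
      then have "nonneg (act (inv w \<otimes> u) (act (inv u) f))"
        using nonneg_act[OF _ g _ pos] finite_subset[OF J finite_generators] by blast
      then have "nonneg (act (inv w) f)" using w uc by (simp add: act_mult)
      then show False using notin_inv_roots[OF w fp] f by blast
    qed
  qed
  then show ?thesis using that uc by blast
qed

lemma ex_longest: "\<exists>w \<in> carrier W. N w = posroots"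
proof -
  obtain w where w: "w \<in> carrier W" and mx: "\<And>v. v \<in> carrier W \<Longrightarrow> card (N v) \<le> card (N w)"
    using ex_maximizer[OF finite_W one_closed, of "\<lambda>v. card (N v)"] by metis
  have neg: "nonneg (- act w (simple_root s))" if s: "s \<in> S" for s
  proof (rule ccontr)
    assume "\<not> ?thesis"
    then have "nonneg (act w (simple_root s))" using root_cases rootI[OF w s] by blast
    from inv_roots_mult_gen_right[OF w s this] have "card (N (w \<otimes> s)) = Suc (card (N w))" by simp
    then show False using mx[of "w \<otimes> s"] w s gen_closed by simp
  qed
  have "f \<in> N w" if f: "f \<in> posroots" for f
  proof (rule ccontr)
    assume "f \<notin> N w"
    then have g: "nonneg (act (inv w) f)" using notin_inv_roots[OF w f] by blast
    have "supp_in S (act (inv w) f)" using f w act_root root_supp_in by blast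
    from nonpos_act[OF finite_generators g this neg] have "nonneg (- f)" using w by simp
    then show False using f root_not_both by blast
  qed
  then show ?thesis using w inv_roots_subset by blast
qed

lemma ex_parabolic_longest:
  assumes "J \<subseteq> S"
  obtains u where "u \<in> carrier W" "N u = {f \<in> posroots. supp_in J f}"
  using ex_longest ex_parabolic_part[OF _ assms] by metis

definition is_join :: "'a \<Rightarrow> 'a \<Rightarrow> 'a \<Rightarrow> bool" where
  "is_join x y j \<longleftrightarrow> j \<in> carrier W \<and> N x \<subseteq> N j \<and> N y \<subseteq> N j \<and>
     (\<forall>u \<in> carrier W. N x \<subseteq> N u \<longrightarrow> N y \<subseteq> N u \<longrightarrow> N j \<subseteq> N u)"

text \<open>The join of two covers of \<open>z\<close> is \<open>z u\<close>, where \<open>u\<close> is the longest element of the dihedral group of \<open>s\<close> and \<open>t\<close>.\<close>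

lemma polygon_join:
  assumes z: "z \<in> carrier W" and s: "s \<in> S" and t: "t \<in> S"
    and zs: "nonneg (act z (simple_root s))" and zt: "nonneg (act z (simple_root t))"
  shows "\<exists>p. is_join (z \<otimes> s) (z \<otimes> t) p"
proof -
  obtain u where u: "u \<in> carrier W" and Nu: "N u = {f \<in> posroots. supp_in {s, t} f}"
    using ex_parabolic_longest[of "{s, t}"] s t by auto
  let ?p = "z \<otimes> u"
  have i: "act (inv ?p) f = act (inv u) (act (inv z) f)" for f
    using z u by (simp add: inv_mult_group act_mult)
  have Nz: "N z \<subseteq> N ?p"
  proof
    fix f assume f: "f \<in> N z"
    let ?h = "- act (inv z) f"
    have fp: "f \<in> posroots" using f inv_rootsD by blast
    have hp: "?h \<in> posroots" using posrootI[OF uminus_root[OF act_root[of "inv z"]] inv_rootsD(2)[OF f]] z fp by blast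
    have "?h \<notin> N u"
    proof
      assume "?h \<in> N u"
      then have "supp_in {s, t} ?h" using Nu by blast
      then have "nonneg (act z ?h)" by (rule nonneg_act[rotated 2]) (use hp zs zt in auto)
      then have "nonneg (- f)" using z by (simp add: act_uminus)
      then show False using fp root_not_both by blast
    qed
    then have "nonneg (act (inv u) ?h)" using notin_inv_roots[OF u hp] by blast
    then show "f \<in> N ?p" using fp by (simp add: inv_roots_def i act_uminus)
  qed
  have mem: "act z (simple_root r) \<in> N ?p" if r: "r \<in> {s, t}" for r
  proof -
    have rS: "r \<in> S" using r s t by blast
    have "simple_root r \<in> N u" using Nu r rS by simp
    then show ?thesis
      using inv_rootsD(2)[of "simple_root r" u] r zs zt posrootI[OF rootI[OF z rS]] z
      by (auto simp: inv_roots_def i)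
  qed
  have least: "N ?p \<subseteq> N v" if v: "v \<in> carrier W" "N (z \<otimes> s) \<subseteq> N v" "N (z \<otimes> t) \<subseteq> N v" for v
  proof
    fix f assume f: "f \<in> N ?p"
    have fp: "f \<in> posroots" using f inv_rootsD by blast
    show "f \<in> N v"
    proof (cases "f \<in> N z")
      case True then show ?thesis using inv_roots_mult_gen_right(1)[OF z s zs] v by blast
    next
      case False
      let ?g = "act (inv z) f"
      have gn: "nonneg ?g" using notin_inv_roots[OF z fp] False by blast
      have gp: "?g \<in> posroots" using posrootI[OF act_root[of "inv z"] gn] z fp by blast
      have "?g \<in> N u" using f gp by (simp add: inv_roots_def i)
      then have g: "supp_in {s, t} ?g" using Nu by blast
      have "nonneg (- act (inv v \<otimes> z) (simple_root r))" if r: "r \<in> {s, t}" for r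
      proof -
        have "act z (simple_root r) \<in> N v"
          using r v inv_roots_mult_gen_right(1)[OF z s zs] inv_roots_mult_gen_right(1)[OF z t zt] by blast
        from inv_rootsD(2)[OF this] show ?thesis using z v by (simp add: act_mult)
      qed
      then have "nonneg (- act (inv v \<otimes> z) ?g)" using nonpos_act[OF _ gn g] by blast
      then show ?thesis using fp z v by (simp add: inv_roots_def act_mult)
    qed
  qed
  have "is_join (z \<otimes> s) (z \<otimes> t) ?p"
    unfolding is_join_def inv_roots_mult_gen_right(1)[OF z s zs] inv_roots_mult_gen_right(1)[OF z t zt]
    using Nz mem[of s] mem[of t] z u least
    by (simp add: inv_roots_mult_gen_right(1)[OF z s zs] inv_roots_mult_gen_right(1)[OF z t zt])
  then show ?thesis by blast
qed

text \<open>Joins exist as soon as they exist for pairs of elements that cover a common one: climb from a common lower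
bound \<open>z\<close> by covers \<open>z s\<close> below \<open>x\<close> and \<open>z t\<close> below \<open>y\<close>, join these two to \<open>p\<close>, then \<open>x\<close> with \<open>p\<close> above \<open>z s\<close>,
and the result with \<open>y\<close> above \<open>z t\<close>.\<close>

lemma ex_join_above:
  assumes "z \<in> carrier W" "x \<in> carrier W" "y \<in> carrier W" "N z \<subseteq> N x" "N z \<subseteq> N y"
  shows "\<exists>j. is_join x y j"
  using assms
proof (induction "card posroots - card (N z)" arbitrary: z x y rule: less_induct)
  case less
  note z = less.prems(1) and x = less.prems(2) and y = less.prems(3) and zx = less.prems(4) and zy = less.prems(5)
  show ?case
  proof (cases "z = x \<or> z = y")
    case True
    then show ?thesis
    proof
      assume "z = x" then show ?thesis using y zy by (intro exI[of _ y]) (auto simp: is_join_def)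
    next
      assume "z = y" then show ?thesis using x zx by (intro exI[of _ x]) (auto simp: is_join_def)
    qed
  next
    case False
    obtain s where s: "s \<in> S" "act z (simple_root s) \<in> posroots" "act z (simple_root s) \<notin> N z"
      "N (z \<otimes> s) = insert (act z (simple_root s)) (N z)" "N (z \<otimes> s) \<subseteq> N x"
      using cover_above[OF z x zx] False by metis
    obtain t where t: "t \<in> S" "act z (simple_root t) \<in> posroots" "act z (simple_root t) \<notin> N z"
      "N (z \<otimes> t) = insert (act z (simple_root t)) (N z)" "N (z \<otimes> t) \<subseteq> N y"
      using cover_above[OF z y zy] False by metis
    have zs: "z \<otimes> s \<in> carrier W" and zt: "z \<otimes> t \<in> carrier W" using z s t gen_closed by auto
    have dec: "card posroots - card (N (z \<otimes> r)) < card posroots - card (N z)"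
      if "r \<in> {s, t}" for r
    proof -
      have "card (N (z \<otimes> r)) = Suc (card (N z))" using that s t by auto
      moreover have "card (N (z \<otimes> r)) \<le> card posroots" by (rule card_mono[OF finite_posroots inv_roots_subset])
      ultimately show ?thesis by simp
    qed
    obtain p where p: "is_join (z \<otimes> s) (z \<otimes> t) p"
      using polygon_join[OF z s(1) t(1)] s(2) t(2) by blast
    have pc: "p \<in> carrier W" "N (z \<otimes> s) \<subseteq> N p" "N (z \<otimes> t) \<subseteq> N p" using p by (auto simp: is_join_def)
    obtain q where q: "is_join x p q" using less.hyps[OF dec zs x pc(1) s(5) pc(2)] by blast
    have qc: "q \<in> carrier W" "N x \<subseteq> N q" "N p \<subseteq> N q" using q by (auto simp: is_join_def)
    obtain j where j: "is_join q y j" using less.hyps[OF dec zt qc(1) y _ t(5)] pc qc by blast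
    have "is_join x y j" unfolding is_join_def
    proof (intro conjI ballI impI)
      show "j \<in> carrier W" "N x \<subseteq> N j" "N y \<subseteq> N j" using j qc by (auto simp: is_join_def)
      fix u assume u: "u \<in> carrier W" "N x \<subseteq> N u" "N y \<subseteq> N u"
      have "N p \<subseteq> N u" using p u s(5) t(5) unfolding is_join_def by (meson subset_trans)
      then have "N q \<subseteq> N u" using q u unfolding is_join_def by blast
      then show "N j \<subseteq> N u" using j u unfolding is_join_def by blast
    qed
    then show ?thesis by blast
  qed
qed

definition wjoin :: "'a \<Rightarrow> 'a \<Rightarrow> 'a" where
  "wjoin x y = (SOME j. is_join x y j)"

lemma wjoin_is_join: "x \<in> carrier W \<Longrightarrow> y \<in> carrier W \<Longrightarrow> is_join x y (wjoin x y)"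
  unfolding wjoin_def by (rule someI_ex) (rule ex_join_above[of \<one>], auto)

lemma wjoin_closed [simp]: "x \<in> carrier W \<Longrightarrow> y \<in> carrier W \<Longrightarrow> wjoin x y \<in> carrier W"
  and wjoin_upper1: "x \<in> carrier W \<Longrightarrow> y \<in> carrier W \<Longrightarrow> N x \<subseteq> N (wjoin x y)"
  and wjoin_upper2: "x \<in> carrier W \<Longrightarrow> y \<in> carrier W \<Longrightarrow> N y \<subseteq> N (wjoin x y)"
  using wjoin_is_join[of x y] by (simp_all add: is_join_def)

lemma wjoin_least:
  "x \<in> carrier W \<Longrightarrow> y \<in> carrier W \<Longrightarrow> u \<in> carrier W \<Longrightarrow> N x \<subseteq> N u \<Longrightarrow> N y \<subseteq> N u \<Longrightarrow> N (wjoin x y) \<subseteq> N u"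
  using wjoin_is_join[of x y] by (simp add: is_join_def)

lemma ex_meet:
  assumes x: "x \<in> carrier W" and y: "y \<in> carrier W"
  shows "\<exists>g \<in> carrier W. N g \<subseteq> N x \<and> N g \<subseteq> N y \<and>
    (\<forall>u \<in> carrier W. N u \<subseteq> N x \<longrightarrow> N u \<subseteq> N y \<longrightarrow> N u \<subseteq> N g)"
proof -
  define A where "A = {u \<in> carrier W. N u \<subseteq> N x \<and> N u \<subseteq> N y}"
  have "finite A" "\<one> \<in> A" using finite_W by (auto simp: A_def)
  then obtain g where g: "g \<in> A" and mx: "\<And>v. v \<in> A \<Longrightarrow> card (N v) \<le> card (N g)"
    using ex_maximizer[of A \<one> "\<lambda>v. card (N v)"] by metis
  have gc: "g \<in> carrier W" using g by (simp add: A_def)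
  have "N u \<subseteq> N g" if u: "u \<in> A" for u
  proof -
    have uc: "u \<in> carrier W" using u by (simp add: A_def)
    have "wjoin u g \<in> A" using u g wjoin_least[OF uc gc x] wjoin_least[OF uc gc y] uc gc by (simp add: A_def)
    then have "N g = N (wjoin u g)" using mx wjoin_upper2[OF uc gc] by (simp add: card_seteq)
    then show ?thesis using wjoin_upper1[OF uc gc] by simp
  qed
  then show ?thesis using g by (intro bexI[of _ g]) (simp_all add: A_def)
qed

text \<open>Some cover going down from \<open>Y\<close> stays above \<open>v\<close>. The root it loses must be \<open>\<alpha>\<^sub>s\<close>, as otherwise the smaller
element would also be above \<open>s\<close>; and then it is \<open>s Y\<close>.\<close>

lemma join_gen_descent:
  assumes s: "s \<in> S" and v: "v \<in> carrier W" and n: "simple_root s \<notin> N v"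
  defines "Y \<equiv> wjoin s v"
  shows "N (s \<otimes> Y) = N Y - {simple_root s}" "simple_root s \<in> N Y" "N v \<subseteq> N (s \<otimes> Y)"
proof -
  have sc: "s \<in> carrier W" using s gen_closed by simp
  have Y: "Y \<in> carrier W" "N s \<subseteq> N Y" "N v \<subseteq> N Y" using sc v wjoin_upper1 wjoin_upper2 by (auto simp: Y_def)
  show sY: "simple_root s \<in> N Y" using Y(2) inv_roots_gen[OF s] by simp
  then have "v \<noteq> Y" using n by metis
  then obtain r where r: "r \<in> S" "- act Y (simple_root r) \<in> N Y" "- act Y (simple_root r) \<notin> N v"
    "N (Y \<otimes> r) = N Y - {- act Y (simple_root r)}" "N v \<subseteq> N (Y \<otimes> r)"
    using cover_below[OF v Y(1,3)] by metis
  have Yr: "Y \<otimes> r \<in> carrier W" using Y r gen_closed by simp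
  have e: "- act Y (simple_root r) = simple_root s"
  proof (rule ccontr)
    assume "- act Y (simple_root r) \<noteq> simple_root s"
    then have "N s \<subseteq> N (Y \<otimes> r)" using sY r(4) inv_roots_gen[OF s] by auto
    then have "N Y \<subseteq> N (Y \<otimes> r)" unfolding Y_def using wjoin_least[OF sc v] Yr r(5) Y_def by simp
    then show False using r(2,4) by blast
  qed
  have "s \<otimes> Y = Y \<otimes> r" by (rule descent_commute[OF Y(1) r(1) s e])
  then show "N (s \<otimes> Y) = N Y - {simple_root s}" "N v \<subseteq> N (s \<otimes> Y)" using r e by simp_all
qed

end

context coxeter_system
begin

section \<open>The Euler form of a word\<close>

definition cartan_row :: "'a \<Rightarrow> 'a list \<Rightarrow> ('a \<Rightarrow> real) \<Rightarrow> real" where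
  "cartan_row s bs g = (\<Sum>j\<leftarrow>bs. cartan s j * g j)"

text \<open>The bilinear form whose matrix is the Cartan matrix with everything below the diagonal deleted and the
diagonal halved, the order of the simple roots being that of the word.\<close>

primrec euler :: "'a list \<Rightarrow> ('a \<Rightarrow> real) \<Rightarrow> ('a \<Rightarrow> real) \<Rightarrow> real" where
  "euler [] f g = 0"
| "euler (s # bs) f g = f s * g s + f s * cartan_row s bs g + euler bs f g"

definition skew :: "'a list \<Rightarrow> ('a \<Rightarrow> real) \<Rightarrow> ('a \<Rightarrow> real) \<Rightarrow> real" where
  "skew as f g = euler as g f - euler as f g"

lemma cartan_row_comb: "cartan_row s bs (comb a f b g) = a * cartan_row s bs f + b * cartan_row s bs g"
  by (induction bs) (simp_all add: cartan_row_def comb_def algebra_simps)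

lemma cartan_row_cong: "(\<And>j. j \<in> set bs \<Longrightarrow> f j = g j) \<Longrightarrow> cartan_row s bs f = cartan_row s bs g"
  unfolding cartan_row_def by (intro arg_cong[of _ _ sum_list] map_cong) auto

lemma cartan_row_zero: "(\<And>j. j \<in> set bs \<Longrightarrow> g j = 0) \<Longrightarrow> cartan_row s bs g = 0"
  by (induction bs) (auto simp: cartan_row_def)

lemma euler_comb_left: "euler as (comb a f b g) h = a * euler as f h + b * euler as g h"
  by (induction as) (simp_all add: comb_def algebra_simps)

lemma euler_comb_right: "euler as h (comb a f b g) = a * euler as h f + b * euler as h g"
  by (induction as) (simp_all add: cartan_row_comb, simp add: comb_def algebra_simps)

lemma euler_cong:
  "(\<And>i. i \<in> set as \<Longrightarrow> f i = f' i) \<Longrightarrow> (\<And>i. i \<in> set as \<Longrightarrow> g i = g' i) \<Longrightarrow> euler as f g = euler as f' g'"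
proof (induction as)
  case (Cons s bs)
  have "cartan_row s bs g = cartan_row s bs g'" using Cons.prems by (intro cartan_row_cong) auto
  then show ?case using Cons by simp
qed simp

lemma euler_zero_left: "(\<And>i. i \<in> set as \<Longrightarrow> f i = 0) \<Longrightarrow> euler as f g = 0"
  by (induction as) auto

lemma euler_zero_right: "(\<And>i. i \<in> set as \<Longrightarrow> g i = 0) \<Longrightarrow> euler as f g = 0"
  by (induction as) (auto simp: cartan_row_zero)

lemma euler_snoc:
  "set bs \<subseteq> S \<Longrightarrow> s \<in> S \<Longrightarrow> euler (bs @ [s]) f g = euler bs f g + cartan_row s bs f * g s + f s * g s"
proof (induction bs)
  case (Cons b bs)
  have "cartan_row b (bs @ [s]) g = cartan_row b bs g + cartan b s * g s" by (simp add: cartan_row_def)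
  moreover have "cartan_row s (b # bs) f = cartan b s * f b + cartan_row s bs f"
    using Cons.prems by (simp add: cartan_row_def cartan_sym)
  ultimately show ?case using Cons by (simp add: algebra_simps)
qed (simp add: cartan_row_def)

lemma cartan_row_nonpos:
  assumes "set bs \<subseteq> S" "s \<in> S" "s \<notin> set bs" "nonneg f"
  shows "cartan_row s bs f \<le> 0"
  using assms
proof (induction bs)
  case (Cons b bs)
  then have "cartan s b \<le> 0" by (intro cartan_nonpos) auto
  then have "cartan s b * f b \<le> 0" using Cons.prems by (simp add: nonneg_def mult_nonpos_nonneg)
  then show ?case using Cons by (simp add: cartan_row_def)
qed (simp add: cartan_row_def)

lemma pairing_cartan_row:
  assumes "distinct (s # bs)" "set (s # bs) \<subseteq> S" "supp_in (set (s # bs)) f"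
  shows "pairing s f = 2 * f s + cartan_row s bs f"
proof -
  have "pairing s f = (\<Sum>j\<in>set (s # bs). cartan s j * f j)"
    unfolding pairing_def
    by (rule sum.mono_neutral_right) (use assms finite_generators in \<open>auto simp: supp_in_def\<close>)
  also have "\<dots> = 2 * f s + cartan_row s bs f"
    using assms by (simp add: cartan_row_def sum_list_distinct_conv_sum_set)
  finally show ?thesis .
qed

lemma cartan_row_upd: "s \<notin> set bs \<Longrightarrow> cartan_row t bs (f(s := x)) = cartan_row t bs f"
  by (rule cartan_row_cong) auto

lemma cartan_row_reflect: "s \<notin> set bs \<Longrightarrow> cartan_row t bs (reflect s f) = cartan_row t bs f"
  by (simp add: reflect_def cartan_row_upd)

text \<open>Off the coordinate \<open>s\<close> nothing changes, and the reflection turns the coordinate \<open>f s\<close> into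
\<open>- f s - cartan_row s bs f\<close>. With this substitution the terms contributed by \<open>s\<close> as the last letter become those
contributed by \<open>s\<close> as the first letter.\<close>

lemma euler_shift:
  assumes d: "distinct (s # bs)" and sub: "set (s # bs) \<subseteq> S"
    and f: "supp_in (set (s # bs)) f" and g: "supp_in (set (s # bs)) g"
  shows "euler (bs @ [s]) (reflect s f) (reflect s g) = euler (s # bs) f g"
proof -
  have e: "euler bs (reflect s f) (reflect s g) = euler bs f g"
    by (rule euler_cong) (use d in \<open>auto simp: reflect_def\<close>)
  have r: "cartan_row s bs (reflect s f) = cartan_row s bs f" using d by (simp add: cartan_row_reflect)
  have c: "reflect s f s = - f s - cartan_row s bs f" "reflect s g s = - g s - cartan_row s bs g"
    unfolding reflect_def pairing_cartan_row[OF d sub f] pairing_cartan_row[OF d sub g] by simp_all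
  show ?thesis using sub by (simp add: euler_snoc e r c algebra_simps)
qed

lemma euler_add_transpose:
  assumes "distinct as" "set as \<subseteq> S" "supp_in (set as) f" "supp_in (set as) g"
  shows "euler as f g + euler as g f = form f g"
  using assms
proof (induction as arbitrary: f g)
  case Nil
  then have "f = (\<lambda>i. 0)" by (auto simp: supp_in_def)
  then show ?case by (simp add: form_def)
next
  case (Cons s bs)
  define f0 g0 where "f0 = f(s := 0)" and "g0 = g(s := 0)"
  have f: "f = comb 1 f0 (f s) (simple_root s)" and g: "g = comb 1 g0 (g s) (simple_root s)"
    by (auto simp: f0_def g0_def comb_def simple_root_def)
  have s: "s \<in> S" "s \<notin> set bs" and d: "distinct (s # bs)" and sub: "set (s # bs) \<subseteq> S" using Cons.prems by auto
  have sp: "supp_in (set bs) f0" "supp_in (set bs) g0" using Cons.prems by (auto simp: supp_in_def f0_def g0_def)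
  have sp': "supp_in (set (s # bs)) f0" "supp_in (set (s # bs)) g0" using sp by (auto simp: supp_in_def)
  have ih: "euler bs f0 g0 + euler bs g0 f0 = form f0 g0" by (rule Cons.IH) (use Cons.prems sp in auto)
  have e: "euler bs f0 g0 = euler bs f g" "euler bs g0 f0 = euler bs g f"
    by (rule euler_cong; use s in \<open>auto simp: f0_def g0_def\<close>)+
  have p: "form (simple_root s) f0 = cartan_row s bs f" "form (simple_root s) g0 = cartan_row s bs g"
    using pairing_cartan_row[OF d sub sp'(1)] pairing_cartan_row[OF d sub sp'(2)] s
    by (simp_all add: form_simple_left f0_def g0_def cartan_row_upd)
  have "form f g = form f0 g0 + g s * form (simple_root s) f0 + f s * form (simple_root s) g0 + 2 * f s * g s"
    by (subst f, subst g) (use s form_sym[of f0 "simple_root s"] in \<open>simp add: form_comb_left form_comb_right form_simple_left algebra_simps\<close>)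
  then show ?case using ih e p by (simp add: algebra_simps)
qed

lemma skew_comb_left: "skew as (comb a f b g) h = a * skew as f h + b * skew as g h"
  by (simp add: skew_def euler_comb_left euler_comb_right algebra_simps)

lemma skew_self [simp]: "skew as f f = 0"
  by (simp add: skew_def)

lemma skew_shift:
  assumes "distinct (s # bs)" "set (s # bs) \<subseteq> S" "supp_in (set (s # bs)) f" "supp_in (set (s # bs)) g"
  shows "skew (bs @ [s]) (reflect s f) (reflect s g) = skew (s # bs) f g"
  using euler_shift assms by (simp add: skew_def)

lemma simple_zero:
  assumes "s \<notin> set bs"
  shows "cartan_row t bs (simple_root s) = 0" "euler bs f (simple_root s) = 0" "euler bs (simple_root s) f = 0"
  using assms by (auto intro!: cartan_row_zero euler_zero_right[of _ "simple_root s"] euler_zero_left[of _ "simple_root s"] simp: simple_root_apply)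

lemma euler_first_right: "s \<notin> set bs \<Longrightarrow> euler (s # bs) f (simple_root s) = f s"
  by (simp add: simple_zero) (simp add: simple_root_apply)

lemma euler_first_left: "s \<notin> set bs \<Longrightarrow> euler (s # bs) (simple_root s) f = f s + cartan_row s bs f"
  by (simp add: simple_zero) (simp add: simple_root_apply)

lemma skew_first:
  assumes "s \<notin> set bs"
  shows "skew (s # bs) f (simple_root s) = cartan_row s bs f" "skew (s # bs) (simple_root s) f = - cartan_row s bs f"
  using euler_first_right[OF assms, of f] euler_first_left[OF assms, of f] by (simp_all add: skew_def del: euler.simps)

lemma skew_last:
  assumes "s \<notin> set bs" "set (s # bs) \<subseteq> S"
  shows "skew (bs @ [s]) f (simple_root s) = - cartan_row s bs f" "skew (bs @ [s]) (simple_root s) f = cartan_row s bs f"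
proof -
  have "euler (bs @ [s]) f (simple_root s) = cartan_row s bs f + f s"
    using assms by (simp add: euler_snoc simple_zero) (simp add: simple_root_apply)
  moreover have "euler (bs @ [s]) (simple_root s) f = f s"
    using assms by (simp add: euler_snoc simple_zero) (simp add: simple_root_apply)
  ultimately show "skew (bs @ [s]) f (simple_root s) = - cartan_row s bs f" "skew (bs @ [s]) (simple_root s) f = cartan_row s bs f"
    by (simp_all add: skew_def)
qed

lemma skew_drop_first: "f s = 0 \<Longrightarrow> g s = 0 \<Longrightarrow> skew (s # bs) f g = skew bs f g"
  by (simp add: skew_def)

lemma skew_drop_last: "set (s # bs) \<subseteq> S \<Longrightarrow> f s = 0 \<Longrightarrow> g s = 0 \<Longrightarrow> skew (bs @ [s]) f g = skew bs f g"
  by (simp add: skew_def euler_snoc)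

section \<open>Aligned elements\<close>

text \<open>The condition on supports places \<open>v\<close> in the parabolic subgroup of the letters of the word, so that the
notion makes sense after letters have been deleted.\<close>

definition aligned :: "'a list \<Rightarrow> 'a \<Rightarrow> bool" where
  "aligned as v \<longleftrightarrow> v \<in> carrier W \<and> (\<forall>f \<in> N v. supp_in (set as) f) \<and>
     (\<forall>f g a b. f \<in> posroots \<longrightarrow> g \<in> posroots \<longrightarrow> 0 < a \<longrightarrow> 0 < b \<longrightarrow> comb a f b g \<in> N v \<longrightarrow>
        0 < skew as f g \<longrightarrow> f \<in> N v)"

lemma alignedI:
  assumes "v \<in> carrier W" "\<And>f. f \<in> N v \<Longrightarrow> supp_in (set as) f"
    "\<And>f g a b. \<lbrakk>f \<in> posroots; g \<in> posroots; 0 < a; 0 < b; comb a f b g \<in> N v; supp_in (set as) f; supp_in (set as) g;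
        0 < skew as f g\<rbrakk> \<Longrightarrow> f \<in> N v"
  shows "aligned as v"
  unfolding aligned_def
proof (intro conjI ballI allI impI)
  fix f g :: "'a \<Rightarrow> real" and a b :: real
  assume a: "f \<in> posroots" "g \<in> posroots" "0 < a" "0 < b" "comb a f b g \<in> N v" "0 < skew as f g"
  have "supp_in (set as) f" "supp_in (set as) g"
    using supp_in_summands[OF _ _ a(3,4) assms(2)[OF a(5)]] posrootD[OF a(1)] posrootD[OF a(2)] by simp_all
  then show "f \<in> N v" using assms(3) a by blast
qed (use assms in auto)

lemma aligned_closed: "aligned as v \<Longrightarrow> v \<in> carrier W"
  and aligned_supp: "aligned as v \<Longrightarrow> f \<in> N v \<Longrightarrow> supp_in (set as) f"
  and alignedD: "\<lbrakk>aligned as v; f \<in> posroots; g \<in> posroots; 0 < a; 0 < b; comb a f b g \<in> N v; 0 < skew as f g\<rbrakk> \<Longrightarrow> f \<in> N v"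
  by (simp_all add: aligned_def)

lemma aligned_one: "aligned as \<one>"
  by (rule alignedI) simp_all

lemma aligned_Nil:
  assumes "aligned [] v"
  shows "v = \<one>"
proof -
  have "f \<notin> N v" for f
  proof
    assume f: "f \<in> N v"
    then have "f = (\<lambda>i. 0)" using aligned_supp[OF assms f] by (auto simp: supp_in_def)
    then have "form f f = 0" by (simp add: form_def)
    then show False using root_norm[of f] f inv_rootsD(1)[OF f] posrootD by auto
  qed
  then have "N v = N \<one>" by auto
  then show ?thesis using inv_roots_inj aligned_closed[OF assms] by blast
qed

text \<open>The roots \<open>a\<^sub>1 \<dots> a\<^sub>k \<alpha>\<close> with \<open>\<alpha>\<close> belonging to the next letter of a reduced word are inversions of its product.
The third claim is the same fact for the reversed word.\<close>

lemma reduced_prefix_root: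
  assumes ws: "us @ a # ys \<in> lists S" and red: "len (wp (us @ a # ys)) = length (us @ a # ys)"
  shows "word_act us (simple_root a) \<in> posroots" "word_act us (simple_root a) \<in> N (wp (us @ a # ys))"
    "act (inv (wp ys)) (simple_root a) \<in> posroots"
proof -
  have l: "us \<in> lists S" "a \<in> S" "ys \<in> lists S" using ws by auto
  let ?u = "wp us" and ?y = "wp ys"
  have e: "wp (us @ a # ys) = ?u \<otimes> a \<otimes> ?y" using l by (simp add: wp_append m_assoc gen_closed)
  have lu: "len ?u < len (?u \<otimes> a)"
  proof (rule ccontr)
    assume "\<not> ?thesis"
    then have "len (?u \<otimes> a) \<le> length us" using len_wp_le[OF l(1)] by simp
    moreover have "len (?u \<otimes> a \<otimes> ?y) \<le> len (?u \<otimes> a) + length ys"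
      by (rule len_mult_le) (use l gen_closed in auto)
    ultimately show False using red e by simp
  qed
  then have "nonneg (act ?u (simple_root a))" using act_simple_sign(1) l by simp
  then have up: "act ?u (simple_root a) \<in> posroots" using posrootI rootI l by simp
  have u: "act ?u (simple_root a) = word_act us (simple_root a)" using act_wp l by simp
  show "word_act us (simple_root a) \<in> posroots" using up u by simp
  have ly: "len ?y < len (a \<otimes> ?y)"
  proof (rule ccontr)
    assume "\<not> ?thesis"
    then have c: "len (a \<otimes> ?y) \<le> length ys" using len_wp_le[OF l(3)] by simp
    have ac: "a \<otimes> ?y \<in> carrier W" using l gen_closed by simp
    obtain zs where zs: "zs \<in> lists S" "wp zs = a \<otimes> ?y" "length zs = len (a \<otimes> ?y)" using ex_reduced[OF ac] .
    have "wp (us @ a # ys) = ?u \<otimes> wp zs" using zs l by (simp add: wp_append)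
    then have "len (wp (us @ a # ys)) \<le> len ?u + length zs" using len_mult_le[of ?u zs] zs l by simp
    then show False using red c zs len_wp_le[OF l(1)] by simp
  qed
  have "simple_root a \<notin> N ?y" using simple_in_inv_roots[of ?y a] l ly by simp
  then have ny: "nonneg (act (inv ?y) (simple_root a))" using notin_inv_roots[of ?y] l by simp
  then show "act (inv ?y) (simple_root a) \<in> posroots" using posrootI rootI l by simp
  have "act (inv (wp (us @ a # ys))) (act ?u (simple_root a)) = - act (inv ?y) (simple_root a)"
    unfolding e using l by (simp add: inv_mult_group act_mult gen_closed reflect_simple act_uminus)
  then have "nonneg (- act (inv (wp (us @ a # ys))) (act ?u (simple_root a)))" using ny by simp
  then show "word_act us (simple_root a) \<in> N (wp (us @ a # ys))" using up u by (simp add: inv_roots_def)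
qed

lemma reduced_letters:
  assumes supp: "\<And>f. f \<in> N (wp ws) \<Longrightarrow> supp_in J f" and ws: "ws \<in> lists S" and red: "len (wp ws) = length ws"
  shows "ws \<in> lists J"
proof (rule ccontr)
  assume "ws \<notin> lists J"
  then have "\<exists>x\<in>set ws. x \<notin> J" by auto
  then obtain us a ys where e: "ws = us @ a # ys" "a \<notin> J" "\<forall>x\<in>set us. \<not> x \<notin> J"
    using split_list_first_prop[of ws "\<lambda>x. x \<notin> J"] by blast
  have "word_act us (simple_root a) \<in> N (wp ws)" using reduced_prefix_root(2) ws red e by simp
  then have "word_act us (simple_root a) a = 0" using supp e(2) supp_inD by metis
  moreover have "word_act us (simple_root a) a = simple_root a a"
    by (rule word_act_outside[of _ J]) (use e in auto)
  ultimately show False by (simp add: simple_root_def)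
qed

text \<open>Telescoping: each letter subtracts a multiple of the root that belongs to it.\<close>

lemma word_act_expand:
  assumes lin: "\<And>a f b g. F (comb a f b g) = a * F f + b * (F g :: real)" and ws: "ws \<in> lists S" and s: "s \<in> S"
  shows "F (word_act ws (simple_root s)) =
    F (simple_root s) - (\<Sum>i<length ws. cartan (ws ! i) s * F (word_act (take i ws) (simple_root (ws ! i))))"
  using ws
proof (induction ws rule: rev_induct)
  case (snoc r ws)
  have r: "r \<in> S" "ws \<in> lists S" using snoc.prems by auto
  have "word_act (ws @ [r]) (simple_root s) =
      comb 1 (word_act ws (simple_root s)) (- cartan r s) (word_act ws (simple_root r))"
    using s by (simp add: word_act_append reflect_eq_comb word_act_comb)
  then have "F (word_act (ws @ [r]) (simple_root s)) = F (word_act ws (simple_root s)) - cartan r s * F (word_act ws (simple_root r))"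
    by (simp add: lin)
  moreover have "(\<Sum>i<length ws. cartan ((ws @ [r]) ! i) s * F (word_act (take i (ws @ [r])) (simple_root ((ws @ [r]) ! i))))
      = (\<Sum>i<length ws. cartan (ws ! i) s * F (word_act (take i ws) (simple_root (ws ! i))))"
    by (rule sum.cong) (auto simp: nth_append)
  ultimately show ?case using snoc.IH[OF r(2)] by simp
qed simp

text \<open>Suppose that \<open>s\<close> is used. Among the elements \<open>u\<close> of the parabolic subgroup without \<open>s\<close> for which \<open>\<beta> = u \<alpha>\<^sub>s\<close> is
inverted take a shortest one, with reduced word \<open>r\<^sub>1 \<dots> r\<^sub>k\<close> and inversions \<open>b\<^sub>1, \<dots>, b\<^sub>k\<close>. Then
\<open>\<beta> = \<alpha>\<^sub>s + \<Sum> n\<^sub>i b\<^sub>i\<close>, where \<open>n\<^sub>i \<ge> 0\<close> is the negative of a Cartan entry. As \<open>s\<close> comes first, \<open>E(\<beta>, \<alpha>\<^sub>s) = 1\<close>, and this is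
also \<open>E(\<beta>, \<beta>)\<close>; hence \<open>\<Sum> n\<^sub>i E(\<beta>, b\<^sub>i) = 0\<close> and \<open>\<Sum> n\<^sub>i \<omega>(\<beta>, b\<^sub>i) = \<Sum> n\<^sub>i c\<^sub>i\<close> with the inner products
\<open>c\<^sub>i\<close> of \<open>b\<^sub>i\<close> and \<open>\<beta>\<close>. These are nonnegative because \<open>s\<close> is not among the letters, nonzero by minimality, and \<open>n\<^sub>k = c\<^sub>k\<close>; so
\<open>\<omega>(\<beta>, b\<^sub>i) > 0\<close> for some \<open>i\<close>. The reflection of \<open>\<beta>\<close> in \<open>b\<^sub>i\<close> is
\<open>h\<^sub>i = \<beta> - c\<^sub>i b\<^sub>i\<close>, so \<open>\<beta> = h\<^sub>i + c\<^sub>i b\<^sub>i\<close> and alignment puts \<open>h\<^sub>i\<close> into \<open>N v\<close>. But \<open>h\<^sub>i\<close> is the image of \<open>\<alpha>\<^sub>s\<close>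
under \<open>u\<close> with one letter deleted, which contradicts the choice of \<open>u\<close>. If \<open>k = 0\<close>, then \<open>\<alpha>\<^sub>s\<close> itself would be inverted.\<close>

lemma aligned_avoids_first:
  assumes d: "distinct (s # bs)" and sub: "set (s # bs) \<subseteq> S" and al: "aligned (s # bs) v"
    and n: "simple_root s \<notin> N v" and f: "f \<in> N v"
  shows "supp_in (set bs) f"
proof (rule ccontr)
  assume nf: "\<not> supp_in (set bs) f"
  let ?B = "set bs"
  have sS: "s \<in> S" "s \<notin> ?B" "?B \<subseteq> S" using d sub by auto
  have v: "v \<in> carrier W" using al aligned_closed by blast
  \<comment> \<open>The prefix of a reduced word for \<open>v\<close> that precedes the first \<open>s\<close> shows that such \<open>u\<close> exist.\<close>
  define P where "P = (\<lambda>u. (\<exists>ws \<in> lists ?B. wp ws = u) \<and> act u (simple_root s) \<in> N v)"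
  have "\<exists>u. P u"
  proof -
    obtain vs where vs: "vs \<in> lists S" "wp vs = v" "length vs = len v" using ex_reduced[OF v] .
    have vs2: "vs \<in> lists (set (s # bs))"
      by (rule reduced_letters) (use vs aligned_supp[OF al] in auto)
    have "vs \<notin> lists ?B" using inv_roots_word_supp[OF _ sS(3), of vs f] vs f nf by blast
    then have "s \<in> set vs" using vs2 by auto
    then obtain us ys where us: "vs = us @ s # ys" "s \<notin> set us" using split_list_first by metis
    have "word_act us (simple_root s) \<in> N v" using reduced_prefix_root(2)[of us s ys] vs us by simp
    moreover have "us \<in> lists ?B" using vs2 us by auto
    moreover have "act (wp us) = word_act us" using act_wp vs us by simp
    ultimately show ?thesis unfolding P_def by (intro exI[of _ "wp us"]) auto
  qed
  then obtain u where Pu: "P u" and least: "\<And>u'. P u' \<Longrightarrow> len u \<le> len u'"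
    using ex_has_least_nat[of P _ len] by metis
  obtain us where us: "us \<in> lists ?B" "wp us = u" using Pu by (auto simp: P_def)
  have uc: "u \<in> carrier W" using us lists_mono[OF sS(3)] wp_closed by blast
  obtain ws where ws: "ws \<in> lists S" "wp ws = u" "length ws = len u" using ex_reduced[OF uc] .
  have wsB: "ws \<in> lists ?B"
    by (rule reduced_letters) (use ws inv_roots_word_supp[OF us(1) sS(3)] us(2) in auto)
  define k where "k = length ws"
  define be where "be = word_act ws (simple_root s)"
  have beN: "be \<in> N v" using Pu ws(2) act_wp[OF ws(1)] by (auto simp: P_def be_def)
  \<comment> \<open>The root \<open>x i\<close> is what the letters after position \<open>i\<close> make of \<open>\<alpha>\<^sub>s\<close>; \<open>h i\<close> is the result of deleting
  position \<open>i\<close>, and \<open>be\<close> exceeds it by \<open>c i\<close> times \<open>b i\<close>.\<close>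
  define b where "b = (\<lambda>i. word_act (take i ws) (simple_root (ws ! i)))"
  define x where "x = (\<lambda>i. word_act (drop (Suc i) ws) (simple_root s))"
  define h where "h = (\<lambda>i. word_act (take i ws @ drop (Suc i) ws) (simple_root s))"
  define c where "c = (\<lambda>i. - pairing (ws ! i) (x i))"
  have split: "ws = take i ws @ ws ! i # drop (Suc i) ws" if "i < k" for i
    using that by (simp add: k_def id_take_nth_drop)
  have wi: "ws ! i \<in> ?B" if "i < k" for i using that wsB by (auto simp: k_def)
  have LB: "take i ws \<in> lists ?B" "drop i ws \<in> lists ?B" "take i ws @ drop (Suc i) ws \<in> lists ?B" for i
    using wsB by (auto dest: in_set_takeD in_set_dropD)
  have BS: "ws' \<in> lists S" if "ws' \<in> lists ?B" for ws' using that sS(3) by auto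
  have bp: "b i \<in> posroots" if "i < k" for i
    unfolding b_def using reduced_prefix_root(1)[of "take i ws" "ws ! i" "drop (Suc i) ws"] split[OF that] ws by auto
  have bs: "supp_in ?B (b i)" if i: "i < k" for i
    unfolding supp_in_def b_def using word_act_outside[OF LB(1)] wi[OF i] by (auto simp: simple_root_def)
  have be_eq: "be = word_act (take i ws) (reflect (ws ! i) (x i))" if "i < k" for i
    unfolding be_def x_def by (subst split[OF that]) (simp only: word_act_append word_act_Cons)
  have decomp: "be = comb 1 (h i) (c i) (b i)" if "i < k" for i
    unfolding be_eq[OF that] by (simp add: reflect_eq_comb word_act_comb word_act_append h_def x_def c_def b_def)
  have hP: "act (wp (take i ws @ drop (Suc i) ws)) (simple_root s) = h i" for i
    unfolding h_def using act_wp[OF BS[OF LB(3)]] by simp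
  have hs: "h i s = 1" for i
    unfolding h_def using word_act_outside[OF LB(3) sS(2)] by (simp add: simple_root_def)
  have hp: "h i \<in> posroots" for i
    using posroot_of_pos_coeff[of "h i" s] hs hP[of i] rootI[OF wp_closed[OF BS[OF LB(3)[of i]]] sS(1)] by simp
  have hN: "h i \<notin> N v" if i: "i < k" for i
  proof
    assume "h i \<in> N v"
    then have "P (wp (take i ws @ drop (Suc i) ws))" unfolding P_def using LB(3)[of i] hP[of i] by metis
    then have "len u \<le> length (take i ws @ drop (Suc i) ws)"
      using least len_wp_le[OF BS[OF LB(3)]] le_trans by blast
    then show False using i ws(3) by (simp add: k_def)
  qed
  \<comment> \<open>Up to sign, \<open>c i\<close> is the pairing of \<open>\<alpha>\<^sub>s\<close> with a positive root without \<open>s\<close>.\<close>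
  have c0: "0 \<le> c i" if i: "i < k" for i
  proof -
    let ?y = "wp (drop (Suc i) ws)"
    let ?g = "act (inv ?y) (simple_root (ws ! i))"
    have y: "?y \<in> carrier W" using BS[OF LB(2)] by simp
    have wS: "ws ! i \<in> S" using wi[OF i] sS by blast
    have gp: "?g \<in> posroots"
      using reduced_prefix_root(3)[of "take i ws" "ws ! i" "drop (Suc i) ws"] split[OF i] ws by auto
    have rl: "rev (drop (Suc i) ws) \<in> lists ?B" using LB(2)[of "Suc i"] by (simp only: in_lists_conv_set set_rev)
    have g: "?g = word_act (rev (drop (Suc i) ws)) (simple_root (ws ! i))"
      using wp_rev[OF BS[OF LB(2)]] act_wp[OF BS[OF rl]] by simp
    have gs: "supp_in ?B ?g"
      unfolding g supp_in_def using word_act_outside[OF rl] wi[OF i] by (auto simp: simple_root_def)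
    have "pairing (ws ! i) (x i) = form (simple_root (ws ! i)) (act ?y (simple_root s))"
      using wS act_wp[OF BS[OF LB(2)]] by (simp add: form_simple_left x_def)
    also have "\<dots> = form ?g (simple_root s)"
      using form_act[of "inv ?y" "simple_root (ws ! i)" "act ?y (simple_root s)"] y by simp
    also have "\<dots> = pairing s ?g" using form_sym sS form_simple_left by metis
    also have "\<dots> = cartan_row s bs ?g"
      using pairing_cartan_row[OF d sub, of ?g] gs sS(2) supp_inD[OF gs sS(2)] by (simp add: supp_in_def)
    also have "\<dots> \<le> 0" by (rule cartan_row_nonpos) (use sS gp in auto)
    finally show ?thesis by (simp add: c_def)
  qed
  have cpos: "0 < c i" if i: "i < k" for i
  proof -
    have "c i \<noteq> 0"
    proof
      assume "c i = 0"
      then have "be = h i" using decomp[OF i] by (simp add: comb_def)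
      then show False using hN[OF i] beN by simp
    qed
    then show ?thesis using c0[OF i] by simp
  qed
  have formb: "form (b i) be = c i" if i: "i < k" for i
  proof -
    have wS: "ws ! i \<in> S" using wi[OF i] sS by blast
    have a: "word_act (take i ws) = act (wp (take i ws))" using act_wp[OF BS[OF LB(1)]] by simp
    have "form (b i) be = form (simple_root (ws ! i)) (reflect (ws ! i) (x i))"
      unfolding be_eq[OF i] b_def a by (rule form_act) (use BS[OF LB(1)] in simp)
    also have "\<dots> = c i" using wS by (simp add: form_simple_left pairing_reflect c_def)
    finally show ?thesis .
  qed
  let ?E = "euler (s # bs)"
  have bes: "be s = 1" unfolding be_def using word_act_outside[OF wsB sS(2)] by (simp add: simple_root_def)
  have besupp: "supp_in (set (s # bs)) be" using aligned_supp[OF al beN] .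
  have bssupp: "supp_in (set (s # bs)) (b i)" if "i < k" for i using bs[OF that] by (auto simp: supp_in_def)
  have Ebb: "?E be be = 1"
    using euler_add_transpose[OF d sub besupp besupp] root_norm[of be] inv_rootsD(1)[OF beN] posrootD[of be] by simp
  have lin: "?E be (comb a f b' g) = a * ?E be f + b' * ?E be g" for a f b' g by (rule euler_comb_right)
  have "?E be be = ?E be (simple_root s) - (\<Sum>i<k. cartan (ws ! i) s * ?E be (b i))"
    using word_act_expand[of "?E be", OF lin ws(1) sS(1)] by (simp only: be_def[symmetric] b_def k_def)
  moreover have "?E be (simple_root s) = 1" unfolding euler_first_right[OF sS(2)] by (rule bes)
  ultimately have sum0: "(\<Sum>i<k. cartan (ws ! i) s * ?E be (b i)) = 0" using Ebb by simp
  have sk: "skew (s # bs) be (b i) = c i - 2 * ?E be (b i)" if i: "i < k" for i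
    using euler_add_transpose[OF d sub bssupp[OF i] besupp] formb[OF i] by (simp add: skew_def del: euler.simps)
  have "(\<Sum>i<k. - cartan (ws ! i) s * skew (s # bs) be (b i)) =
      (\<Sum>i<k. - cartan (ws ! i) s * c i + 2 * (cartan (ws ! i) s * ?E be (b i)))"
    by (rule sum.cong[OF refl]) (simp only: lessThan_iff sk, simp add: right_diff_distrib del: euler.simps)
  also have "\<dots> = (\<Sum>i<k. - cartan (ws ! i) s * c i)"
    using sum0 by (simp only: sum.distrib sum_distrib_left[symmetric])
  finally have sums: "(\<Sum>i<k. - cartan (ws ! i) s * skew (s # bs) be (b i)) = (\<Sum>i<k. - cartan (ws ! i) s * c i)" .
  have cn: "0 \<le> - cartan (ws ! i) s" if i: "i < k" for i
    using cartan_nonpos[of "ws ! i" s] wi[OF i] sS by auto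
  have "k \<noteq> 0"
  proof
    assume "k = 0"
    then have "be = simple_root s" by (simp add: be_def k_def)
    then show False using beN n by simp
  qed
  then have last: "k - 1 < k" by simp
  have "x (k - 1) = simple_root s" using \<open>k \<noteq> 0\<close> by (simp add: x_def k_def)
  then have "0 < - cartan (ws ! (k - 1)) s" using cpos[OF last] sS by (simp add: c_def)
  then have "0 < (\<Sum>i<k. - cartan (ws ! i) s * c i)"
  proof (intro sum_pos2[of _ "k - 1"])
    show "0 < - cartan (ws ! (k - 1)) s * c (k - 1)"
      using \<open>0 < - cartan (ws ! (k - 1)) s\<close> cpos[OF last] by (rule mult_pos_pos)
    show "0 \<le> - cartan (ws ! i) s * c i" if "i \<in> {..<k}" for i
      using cn[of i] c0[of i] that by (intro mult_nonneg_nonneg) auto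
  qed (use last in auto)
  then have "\<exists>i<k. 0 < - cartan (ws ! i) s * skew (s # bs) be (b i)"
    using sums sum_nonpos[of "{..<k}" "\<lambda>i. - cartan (ws ! i) s * skew (s # bs) be (b i)"] by (force simp: not_less)
  then obtain i where i: "i < k" "0 < - cartan (ws ! i) s * skew (s # bs) be (b i)" by blast
  then have "0 < skew (s # bs) be (b i)" using cn[OF i(1)] by (metis less_le_not_le mult_nonneg_nonpos not_less)
  then have "0 < skew (s # bs) (h i) (b i)" using decomp[OF i(1)] skew_comb_left[of "s # bs" 1 "h i" "c i" "b i" "b i"] by simp
  then have "h i \<in> N v" using alignedD[OF al hp bp[OF i(1)] _ cpos[OF i(1)], of 1] decomp[OF i(1)] beN by simp
  then show False using hN[OF i(1)] by simp
qed

lemma aligned_drop_first: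
  assumes d: "distinct (s # bs)" and sub: "set (s # bs) \<subseteq> S" and n: "simple_root s \<notin> N v"
  shows "aligned (s # bs) v \<longleftrightarrow> aligned bs v"
proof
  assume al: "aligned (s # bs) v"
  show "aligned bs v"
  proof (rule alignedI)
    fix f g :: "'a \<Rightarrow> real" and a b :: real
    assume a: "f \<in> posroots" "g \<in> posroots" "0 < a" "0 < b" "comb a f b g \<in> N v"
      "supp_in (set bs) f" "supp_in (set bs) g" "0 < skew bs f g"
    have "f s = 0" "g s = 0" using supp_inD a d by auto
    then show "f \<in> N v" using alignedD[OF al a(1-5)] a(8) skew_drop_first by simp
  qed (use al aligned_closed aligned_avoids_first[OF d sub al n] in auto)
next
  assume al: "aligned bs v"
  show "aligned (s # bs) v"
  proof (rule alignedI)
    fix f g :: "'a \<Rightarrow> real" and a b :: real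
    assume a: "f \<in> posroots" "g \<in> posroots" "0 < a" "0 < b" "comb a f b g \<in> N v" "0 < skew (s # bs) f g"
    have "supp_in (set bs) f" "supp_in (set bs) g"
      using supp_in_summands[OF _ _ a(3,4) aligned_supp[OF al a(5)]] posrootD[OF a(1)] posrootD[OF a(2)] by simp_all
    then have "f s = 0" "g s = 0" using supp_inD d by auto
    then show "f \<in> N v" using alignedD[OF al a(1-5)] a(6) skew_drop_first by simp
  qed (use aligned_closed[OF al] aligned_supp[OF al] in \<open>auto simp: supp_in_def\<close>)
qed

lemma aligned_snoc:
  assumes d: "distinct (s # bs)" and sub: "set (s # bs) \<subseteq> S" and al: "aligned bs v"
  shows "aligned (bs @ [s]) v"
proof (rule alignedI)
  fix f g :: "'a \<Rightarrow> real" and a b :: real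
  assume a: "f \<in> posroots" "g \<in> posroots" "0 < a" "0 < b" "comb a f b g \<in> N v" "0 < skew (bs @ [s]) f g"
  have "supp_in (set bs) f" "supp_in (set bs) g"
    using supp_in_summands[OF _ _ a(3,4) aligned_supp[OF al a(5)]] posrootD[OF a(1)] posrootD[OF a(2)] by simp_all
  then have "f s = 0" "g s = 0" using supp_inD d by auto
  then show "f \<in> N v" using alignedD[OF al a(1-5)] a(6) skew_drop_last[OF sub] by simp
qed (use aligned_closed[OF al] aligned_supp[OF al] in \<open>auto simp: supp_in_def\<close>)

lemma supp_in_reflect: "s \<in> J \<Longrightarrow> supp_in J f \<Longrightarrow> supp_in J (reflect s f)"
  by (auto simp: supp_in_def reflect_def)

text \<open>Reflection in \<open>s\<close> carries \<open>N v\<close> without \<open>\<alpha>\<^sub>s\<close> to \<open>N (s v)\<close> and preserves \<open>\<omega>\<close>. What remains to be considered are the pairs that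
contain \<open>\<alpha>\<^sub>s\<close>: \<open>\<alpha>\<^sub>s\<close> cannot be the left member of a pair with \<open>\<omega> > 0\<close> for the word that ends in \<open>s\<close>, nor the right one
for the word that begins with \<open>s\<close>; in the other two cases it helps that \<open>\<alpha>\<^sub>s\<close> is in \<open>N v\<close>.\<close>

lemma aligned_shift:
  assumes d: "distinct (s # bs)" and sub: "set (s # bs) \<subseteq> S" and sv: "simple_root s \<in> N v" and v: "v \<in> carrier W"
  shows "aligned (s # bs) v \<longleftrightarrow> aligned (bs @ [s]) (s \<otimes> v)"
proof -
  have s: "s \<in> S" "s \<notin> set bs" "set bs \<subseteq> S" using d sub by auto
  have sc: "s \<otimes> v \<in> carrier W" using s v gen_closed by simp
  note Ns = inv_roots_mult_gen_left'[OF v s(1) sv]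
  have mem: "f \<in> N (s \<otimes> v) \<longleftrightarrow> reflect s f \<in> N v" if "f \<in> posroots" "f \<noteq> simple_root s" for f
  proof
    assume "f \<in> N (s \<otimes> v)" then show "reflect s f \<in> N v" using Ns(1) s by auto
  next
    assume "reflect s f \<in> N v"
    then have "reflect s f \<in> N v - {simple_root s}" using reflect_ne_simple[OF that(1) s(1)] by simp
    then have "reflect s (reflect s f) \<in> N (s \<otimes> v)" unfolding Ns(1) by (rule imageI)
    then show "f \<in> N (s \<otimes> v)" using s by simp
  qed
  have mem': "f \<in> N v \<longleftrightarrow> reflect s f \<in> N (s \<otimes> v)" if "f \<in> posroots" "f \<noteq> simple_root s" for f
    using mem[of "reflect s f"] reflect_posroot[OF that(1) s(1) that(2)] reflect_ne_simple[OF that(1) s(1)] s by simp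
  have seteq: "set (bs @ [s]) = set (s # bs)" by auto
  show ?thesis
  proof
    assume al: "aligned (s # bs) v"
    show "aligned (bs @ [s]) (s \<otimes> v)"
    proof (rule alignedI[OF sc])
      fix f assume "f \<in> N (s \<otimes> v)"
      then obtain f' where "f' \<in> N v" "f = reflect s f'" using Ns(1) by auto
      then show "supp_in (set (bs @ [s])) f" unfolding seteq using aligned_supp[OF al] supp_in_reflect[of s] by simp
    next
      fix f g :: "'a \<Rightarrow> real" and a b :: real
      assume a: "f \<in> posroots" "g \<in> posroots" "0 < a" "0 < b" "comb a f b g \<in> N (s \<otimes> v)"
        "supp_in (set (bs @ [s])) f" "supp_in (set (bs @ [s])) g" "0 < skew (bs @ [s]) f g"
      let ?f = "reflect s f" and ?g = "reflect s g"
      have fne: "f \<noteq> simple_root s"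
        using a(8) skew_last(2)[OF s(2) sub, of g] cartan_row_nonpos[OF s(3,1,2), of g] posrootD[OF a(2)] by auto
      have fp: "?f \<in> posroots" using reflect_posroot[OF a(1) s(1) fne] .
      have cp: "comb a f b g \<in> posroots" using inv_rootsD(1)[OF a(5)] .
      have cne: "comb a f b g \<noteq> simple_root s" using a(5) Ns(2) by metis
      have cN: "comb a ?f b ?g \<in> N v" using mem[OF cp cne] a(5) by (simp add: reflect_comb)
      have "?f \<in> N v"
      proof (cases "g = simple_root s")
        case True
        have e: "?f = comb (1 / a) (comb a ?f b ?g) (b / a) (simple_root s)"
          unfolding True reflect_simple[OF s(1)] using a(3) by (auto simp: comb_def fun_eq_iff field_simps)
        show ?thesis by (subst e, rule inv_roots_closed[OF cN sv]) (use a(3,4) e fp in auto)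
      next
        case False
        have sk: "skew (bs @ [s]) f g = skew (s # bs) ?f ?g"
          using skew_shift[OF d sub, of ?f ?g] supp_in_reflect[of s "set (s # bs)"] a(6,7) s unfolding seteq by simp
        show ?thesis
          by (rule alignedD[OF al fp reflect_posroot[OF a(2) s(1) False] a(3,4) cN]) (use a(8) sk in simp)
      qed
      then show "f \<in> N (s \<otimes> v)" using mem[OF a(1) fne] by simp
    qed
  next
    assume al: "aligned (bs @ [s]) (s \<otimes> v)"
    show "aligned (s # bs) v"
    proof (rule alignedI[OF v])
      fix f assume f: "f \<in> N v"
      show "supp_in (set (s # bs)) f"
      proof (cases "f = simple_root s")
        case False
        then have "reflect s f \<in> N (s \<otimes> v)" using mem' f inv_rootsD(1) by blast
        then have "supp_in (set (s # bs)) (reflect s f)" using aligned_supp[OF al] seteq by metis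
        then have "supp_in (set (s # bs)) (reflect s (reflect s f))" by (rule supp_in_reflect[rotated]) simp
        then show ?thesis unfolding reflect_reflect[OF s(1)] .
      qed simp
    next
      fix f g :: "'a \<Rightarrow> real" and a b :: real
      assume a: "f \<in> posroots" "g \<in> posroots" "0 < a" "0 < b" "comb a f b g \<in> N v"
        "supp_in (set (s # bs)) f" "supp_in (set (s # bs)) g" "0 < skew (s # bs) f g"
      let ?f = "reflect s f" and ?g = "reflect s g"
      show "f \<in> N v"
      proof (cases "f = simple_root s")
        case True then show ?thesis using sv by simp
      next
        case False
        have gne: "g \<noteq> simple_root s"
          using a(8) skew_first(1)[OF s(2), of f] cartan_row_nonpos[OF s(3,1,2), of f] posrootD[OF a(1)] by auto
        have cne: "comb a f b g \<noteq> simple_root s"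
        proof
          assume e: "comb a f b g = simple_root s"
          have "supp_in {s} f"
            using supp_in_summands(1)[of f g a b "{s}"] e a posrootD by simp
          then show False using False posroot_single[OF a(1) s(1)] by (auto simp: supp_in_def)
        qed
        have cN: "comb a ?f b ?g \<in> N (s \<otimes> v)"
          using mem'[OF inv_rootsD(1)[OF a(5)] cne] a(5) by (simp add: reflect_comb)
        have "0 < skew (bs @ [s]) ?f ?g" using skew_shift[OF d sub a(6,7)] a(8) by simp
        then have "?f \<in> N (s \<otimes> v)"
          using alignedD[OF al reflect_posroot[OF a(1) s(1) False] reflect_posroot[OF a(2) s(1) gne] a(3,4) cN] by simp
        then show ?thesis using mem'[OF a(1) False] by simp
      qed
    qed
  qed
qed

text \<open>It has to be shown that \<open>s\<close> maps \<open>N v\<close> without \<open>\<alpha>\<^sub>s\<close> into itself. If \<open>s f = f + a \<alpha>\<^sub>s\<close> with \<open>a \<ge> 0\<close>, then \<open>s f\<close> is in \<open>N v\<close>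
because \<open>f\<close> and \<open>\<alpha>\<^sub>s\<close> are. Otherwise \<open>f\<close> is a positive combination of \<open>s f\<close> and \<open>\<alpha>\<^sub>s\<close>, and \<open>\<omega>(s f, \<alpha>\<^sub>s) > 0\<close> because \<open>s\<close> is
the last letter; so alignment applies.\<close>

lemma aligned_last_descent:
  assumes d: "distinct (s # bs)" and sub: "set (s # bs) \<subseteq> S" and al: "aligned (bs @ [s]) v" and sv: "simple_root s \<in> N v"
  shows "N (s \<otimes> v) = N v - {simple_root s}" "aligned (bs @ [s]) (s \<otimes> v)"
proof -
  have s: "s \<in> S" "s \<notin> set bs" "set bs \<subseteq> S" using d sub by auto
  have v: "v \<in> carrier W" using al aligned_closed by blast
  have seteq: "set (bs @ [s]) = set (s # bs)" by auto
  note Ns = inv_roots_mult_gen_left'[OF v s(1) sv]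
  have stable: "reflect s f \<in> N v - {simple_root s}" if f: "f \<in> N v - {simple_root s}" for f
  proof -
    have fp: "f \<in> posroots" and fne: "f \<noteq> simple_root s" using f inv_rootsD(1) by auto
    let ?h = "reflect s f"
    have hp: "?h \<in> posroots" using reflect_posroot[OF fp s(1) fne] .
    have "?h \<in> N v"
    proof (cases "pairing s f \<le> 0")
      case True
      then show ?thesis using inv_roots_closed[of f v "simple_root s" 1 "- pairing s f"] f sv hp
        by (simp add: reflect_eq_comb)
    next
      case False
      have fs: "supp_in (set (s # bs)) f" using aligned_supp[OF al, of f] f seteq by auto
      have pr: "pairing s f = 2 * f s + cartan_row s bs f" using pairing_cartan_row[OF d sub fs] .
      have "cartan_row s bs f \<noteq> 0"
      proof
        assume r: "cartan_row s bs f = 0"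
        then have "?h s = - f s" using pr by (simp add: reflect_def)
        moreover have "0 \<le> ?h s" "0 \<le> f s" using posroot_coeff_nonneg hp fp by auto
        ultimately have "f s = 0" by simp
        then show False using False pr r by simp
      qed
      then have "cartan_row s bs f < 0" using cartan_row_nonpos[OF s(3,1,2), of f] posrootD[OF fp] by simp
      then have sk: "0 < skew (bs @ [s]) ?h (simple_root s)"
        using skew_last(1)[OF s(2) sub] cartan_row_reflect[OF s(2)] by simp
      have "f = comb 1 ?h (pairing s f) (simple_root s)"
        by (auto simp: reflect_eq_comb comb_def)
      then show ?thesis using alignedD[OF al hp simple_posroot[OF s(1)] _ _ _ sk, of 1 "pairing s f"] f False by simp
    qed
    then show ?thesis using reflect_ne_simple[OF fp s(1)] by simp
  qed
  show e: "N (s \<otimes> v) = N v - {simple_root s}"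
    unfolding Ns(1)
  proof (intro subset_antisym subsetI)
    fix f assume "f \<in> reflect s ` (N v - {simple_root s})" then show "f \<in> N v - {simple_root s}" using stable by auto
  next
    fix f assume "f \<in> N v - {simple_root s}"
    then have "reflect s (reflect s f) \<in> reflect s ` (N v - {simple_root s})" using stable by (intro imageI)
    then show "f \<in> reflect s ` (N v - {simple_root s})" using s by simp
  qed
  show "aligned (bs @ [s]) (s \<otimes> v)"
  proof (rule alignedI)
    show "s \<otimes> v \<in> carrier W" using s v gen_closed by simp
  next
    fix f assume "f \<in> N (s \<otimes> v)"
    then show "supp_in (set (bs @ [s])) f" using e aligned_supp[OF al] by blast
  next
    fix f g :: "'a \<Rightarrow> real" and a b :: real
    assume a: "f \<in> posroots" "g \<in> posroots" "0 < a" "0 < b" "comb a f b g \<in> N (s \<otimes> v)" "0 < skew (bs @ [s]) f g"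
    have "f \<noteq> simple_root s"
      using a(6) skew_last(2)[OF s(2) sub, of g] cartan_row_nonpos[OF s(3,1,2), of g] posrootD[OF a(2)] by auto
    then show "f \<in> N (s \<otimes> v)" using alignedD[OF al a(1-4) _ a(6)] a(5) e by simp
  qed
qed

lemma aligned_parabolic_longest:
  assumes "w \<in> carrier W" "N w = {f \<in> posroots. supp_in J f}" "J \<subseteq> set as"
  shows "aligned as w"
proof (rule alignedI[OF assms(1)])
  fix f assume "f \<in> N w" then show "supp_in (set as) f" using assms by (auto simp: supp_in_def)
next
  fix f g :: "'a \<Rightarrow> real" and a b :: real
  assume a: "f \<in> posroots" "g \<in> posroots" "0 < a" "0 < b" "comb a f b g \<in> N w"
  have "supp_in J (comb a f b g)" using a(5) assms(2) by simp
  then have "supp_in J f" using supp_in_summands(1)[of f g a b J] a(3,4) posrootD[OF a(1)] posrootD[OF a(2)] by simp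
  then show "f \<in> N w" using assms(2) a(1) by simp
qed

lemma aligned_gen: "s \<in> S \<Longrightarrow> s \<in> set as \<Longrightarrow> aligned as s"
proof (rule aligned_parabolic_longest[of s "{s}"])
  assume s: "s \<in> S"
  show "N s = {f \<in> posroots. supp_in {s} f}"
    unfolding inv_roots_gen[OF s]
  proof (intro subset_antisym subsetI)
    fix f assume "f \<in> {f \<in> posroots. supp_in {s} f}"
    then show "f \<in> {simple_root s}" using posroot_single[OF _ s] by (auto simp: supp_in_def)
  qed (use s in auto)
qed (auto simp: gen_closed)

lemma aligned_parabolic_part:
  assumes d: "distinct (s # bs)" and al: "aligned (s # bs) v" and u: "u \<in> carrier W" "N u = {f \<in> N v. supp_in (set bs) f}"
  shows "aligned bs u"
proof (rule alignedI[OF u(1)])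
  fix f g :: "'a \<Rightarrow> real" and a b :: real
  assume a: "f \<in> posroots" "g \<in> posroots" "0 < a" "0 < b" "comb a f b g \<in> N u" "supp_in (set bs) f" "supp_in (set bs) g"
    "0 < skew bs f g"
  have "f s = 0" "g s = 0" using supp_inD a d by auto
  then have "f \<in> N v" using alignedD[OF al a(1-4)] a(5,8) u(2) skew_drop_first by simp
  then show "f \<in> N u" using u(2) a(6) by simp
qed (use u in auto)

end

context coxeter_system
begin

section \<open>The greatest aligned element below an element\<close>

definition distinct_gens :: "'a list \<Rightarrow> bool" where
  "distinct_gens as \<longleftrightarrow> distinct as \<and> set as \<subseteq> S"

lemma distinct_gensD: "distinct_gens as \<Longrightarrow> distinct as" "distinct_gens as \<Longrightarrow> set as \<subseteq> S"
  and distinct_gens_rotate: "distinct_gens (s # bs) \<Longrightarrow> distinct_gens (bs @ [s])"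
  and distinct_gens_tl: "distinct_gens (s # bs) \<Longrightarrow> distinct_gens bs"
  and distinct_gens_hd: "distinct_gens (s # bs) \<Longrightarrow> s \<in> S" "distinct_gens (s # bs) \<Longrightarrow> s \<notin> set bs"
  by (auto simp: distinct_gens_def)

definition greatest_aligned :: "'a list \<Rightarrow> 'a \<Rightarrow> 'a \<Rightarrow> bool" where
  "greatest_aligned as w v \<longleftrightarrow> aligned as v \<and> N v \<subseteq> N w \<and> (\<forall>u. aligned as u \<longrightarrow> N u \<subseteq> N w \<longrightarrow> N u \<subseteq> N v)"

lemma greatest_alignedD:
  assumes "greatest_aligned as w v"
  shows "aligned as v" "v \<in> carrier W" "N v \<subseteq> N w" "\<And>u. aligned as u \<Longrightarrow> N u \<subseteq> N w \<Longrightarrow> N u \<subseteq> N v"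
  using assms aligned_closed[of as v] by (auto simp: greatest_aligned_def)

text \<open>Removing the last letter \<open>s\<close> from \<open>v''\<close> loses nothing but \<open>\<alpha>\<^sub>s\<close> and gives an aligned element below \<open>s Y\<close>, hence below \<open>v'\<close>.\<close>

lemma cover_by_last:
  assumes d: "distinct (s # bs)" and sub: "set (s # bs) \<subseteq> S" and Y: "Y \<in> carrier W" "simple_root s \<in> N Y"
    and sY: "N (s \<otimes> Y) = N Y - {simple_root s}"
    and gr: "greatest_aligned (bs @ [s]) (s \<otimes> Y) v'"
    and v'': "aligned (bs @ [s]) v''" "simple_root s \<in> N v''" "N v'' \<subseteq> N Y" "N v' \<subseteq> N v''"
  shows "v'' = s \<otimes> v'" "N v' = N v'' - {simple_root s}"
proof -
  have s: "s \<in> S" using sub by simp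
  note last = aligned_last_descent[OF d sub v''(1,2)]
  have "N (s \<otimes> v'') \<subseteq> N (s \<otimes> Y)" unfolding last(1) sY using v''(3) by blast
  then have 1: "N (s \<otimes> v'') \<subseteq> N v'" using greatest_alignedD(4)[OF gr last(2)] by simp
  have "simple_root s \<notin> N v'" using greatest_alignedD(3)[OF gr] sY by blast
  then have 2: "N v' \<subseteq> N (s \<otimes> v'')" unfolding last(1) using v''(4) by blast
  then show e: "N v' = N v'' - {simple_root s}" using 1 last(1) by blast
  have c: "v'' \<in> carrier W" using aligned_closed[OF v''(1)] .
  have "v' = s \<otimes> v''"
    by (rule inv_roots_inj) (use greatest_alignedD(2)[OF gr] c s gen_closed e last(1) in auto)
  then show "v'' = s \<otimes> v'" using c s by simp
qed

end

context finite_coxeter_system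
begin

text \<open>The candidate is obtained from the recursion on the first letter \<open>s\<close>. In the case \<open>s \<le> w\<close> the candidate is the greatest
among the aligned elements above \<open>s\<close>; the work consists in comparing it with an aligned element that is not above \<open>s\<close>.\<close>

lemma ex_greatest_aligned:
  assumes "distinct as" "set as \<subseteq> S" "w \<in> carrier W"
  shows "\<exists>v. greatest_aligned as w v"
  using assms
proof (induction "length as + card (N w)" arbitrary: as w rule: less_induct)
  case less
  note d = less.prems(1) and sub = less.prems(2) and w = less.prems(3)
  show ?case
  proof (cases as)
    case Nil
    then show ?thesis using aligned_one aligned_Nil by (intro exI[of _ \<one>]) (auto simp: greatest_aligned_def)
  next
    case (Cons s bs)
    have db: "distinct (s # bs)" and sb: "set (s # bs) \<subseteq> S" using d sub Cons by auto
    have s: "s \<in> S" "s \<in> carrier W" "s \<notin> set bs" using db sb gen_closed by auto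
    have d': "distinct (bs @ [s])" "set (bs @ [s]) \<subseteq> S" using db sb by auto
    show ?thesis
    proof (cases "simple_root s \<in> N w")
      case False
      obtain v where v: "greatest_aligned bs w v"
        using less.hyps[of bs w] Cons db sb w by auto
      have "aligned (s # bs) u \<longleftrightarrow> aligned bs u" if "N u \<subseteq> N w" for u
        using aligned_drop_first[OF db sb] that False by blast
      then have "greatest_aligned as w v" using v unfolding greatest_aligned_def Cons by blast
      then show ?thesis by blast
    next
      case True
      have sw: "s \<otimes> w \<in> carrier W" using s w by simp
      obtain v1 where v1: "greatest_aligned (bs @ [s]) (s \<otimes> w) v1"
        using less.hyps[of "bs @ [s]" "s \<otimes> w"] Cons d' sw card_inv_roots_shift[OF w s(1) True] by auto
      note g1 = greatest_alignedD[OF v1]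
      let ?v0 = "s \<otimes> v1"
      have n1: "simple_root s \<notin> N v1" using g1(3) inv_roots_mult_gen_left'(2)[OF w s(1) True] by blast
      have v0c: "?v0 \<in> carrier W" using s g1(2) by simp
      have s0: "simple_root s \<in> N ?v0" using inv_roots_mult_gen_left[OF g1(2) s(1) n1] by simp
      have ss: "s \<otimes> ?v0 = v1" using s g1(2) by simp
      have al0: "aligned (s # bs) ?v0" using aligned_shift[OF db sb s0 v0c] g1(1) ss by simp
      have le0: "N ?v0 \<subseteq> N w" using shift_subset[OF v0c s0 w True s(1)] g1(3) ss by simp
      have up: "N u \<subseteq> N ?v0" if u: "aligned (s # bs) u" "N u \<subseteq> N w" for u
      proof (cases "simple_root s \<in> N u")
        case True
        have uc: "u \<in> carrier W" using aligned_closed[OF u(1)] .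
        have "aligned (bs @ [s]) (s \<otimes> u)" using aligned_shift[OF db sb True uc] u(1) by simp
        moreover have "N (s \<otimes> u) \<subseteq> N (s \<otimes> w)" using shift_subset[OF uc True w \<open>simple_root s \<in> N w\<close> s(1)] u(2) by simp
        ultimately have "N (s \<otimes> u) \<subseteq> N (s \<otimes> ?v0)" using g1(4) ss by simp
        then show ?thesis using shift_subset[OF uc True v0c s0 s(1)] by simp
      next
        case nu: False
        have uc: "u \<in> carrier W" using aligned_closed[OF u(1)] .
        \<comment> \<open>With \<open>v'\<close>, the greatest aligned element below \<open>s Y\<close> for the rotated word, the comparison runs
        \<open>u \<le> v' \<le> s v' \<le> ?v0\<close>; only the second step requires an argument.\<close>
        define Y where "Y = wjoin s u"
        have Yc: "Y \<in> carrier W" using s uc by (simp add: Y_def)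
        note jY = join_gen_descent[OF s(1) uc nu, folded Y_def]
        have Yw: "N Y \<subseteq> N w" unfolding Y_def
          by (rule wjoin_least[OF s(2) uc w _ u(2)]) (use True inv_roots_gen[OF s(1)] in simp)
        let ?x = "s \<otimes> Y"
        have xc: "?x \<in> carrier W" using s Yc by simp
        have cY: "card (N Y) \<le> card (N w)" using Yw by (intro card_mono) auto
        obtain v' where v': "greatest_aligned (bs @ [s]) ?x v'"
          using less.hyps[of "bs @ [s]" ?x] Cons d' xc card_inv_roots_shift[OF Yc s(1) jY(2)] cY by auto
        note g' = greatest_alignedD[OF v']
        have ub: "aligned bs u" using aligned_drop_first[OF db sb nu] u(1) by simp
        have uv': "N u \<subseteq> N v'" using g'(4)[OF aligned_snoc[OF db sb ub] jY(3)] .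
        have v'Y: "N v' \<subseteq> N Y" using g'(3) jY(1) by blast
        have nv': "simple_root s \<notin> N v'" using g'(3) jY(1) by blast
        \<comment> \<open>The greatest aligned element below \<open>Y\<close> for the rotated word has these properties. As \<open>Y\<close> may be \<open>w\<close>, the induction
        hypothesis does not provide it directly, but it does after one more step with the next letter \<open>r\<close>.\<close>
        have "\<exists>v''. aligned (bs @ [s]) v'' \<and> simple_root s \<in> N v'' \<and> N v'' \<subseteq> N Y \<and> N v' \<subseteq> N v''"
        proof (cases bs)
          case Nil
          then have "aligned [s] v'" using g'(1) by simp
          then have "aligned [] v'" using aligned_drop_first[of s "[]" v'] nv' s by simp
          then have "v' = \<one>" by (rule aligned_Nil)
          then show ?thesis using Nil aligned_gen[of s "[s]"] s inv_roots_gen[OF s(1)] jY(2)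
            by (intro exI[of _ s]) auto
        next
          case (Cons r ds)
          have dr: "distinct (r # ds @ [s])" and sr: "set (r # ds @ [s]) \<subseteq> S" using db sb Cons by auto
          have r: "r \<in> S" "r \<in> carrier W" "r \<noteq> s" using db sb Cons gen_closed by auto
          have e: "bs @ [s] = r # ds @ [s]" using Cons by simp
          have sY: "N s \<subseteq> N Y" using inv_roots_gen[OF s(1)] jY(2) by simp
          show ?thesis
          proof (cases "simple_root r \<in> N Y")
            case False
            obtain v'' where v'': "greatest_aligned (ds @ [s]) Y v''"
              using less.hyps[of "ds @ [s]" Y] \<open>as = s # bs\<close> Cons dr sr Yc cY by auto
            note g'' = greatest_alignedD[OF v'']
            have "aligned (bs @ [s]) v''"
              unfolding e using aligned_drop_first[OF dr sr, of v''] g''(1,3) False by blast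
            moreover have "N s \<subseteq> N v''" by (rule g''(4)[OF aligned_gen sY]) (use s in auto)
            then have "simple_root s \<in> N v''" using inv_roots_gen[OF s(1)] by simp
            moreover have "aligned (ds @ [s]) v'"
              using aligned_drop_first[OF dr sr, of v'] g'(1) v'Y False unfolding e by blast
            then have "N v' \<subseteq> N v''" using g''(4) v'Y by simp
            ultimately show ?thesis using g''(3) by blast
          next
            case rY: True
            have rYc: "r \<otimes> Y \<in> carrier W" using r Yc by simp
            have dr': "distinct ((ds @ [s]) @ [r])" "set ((ds @ [s]) @ [r]) \<subseteq> S" using dr sr by auto
            obtain v2 where v2: "greatest_aligned ((ds @ [s]) @ [r]) (r \<otimes> Y) v2"
              using less.hyps[OF _ dr' rYc] \<open>as = s # bs\<close> Cons card_inv_roots_shift[OF Yc r(1) rY] cY by auto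
            note g2 = greatest_alignedD[OF v2]
            let ?v = "r \<otimes> v2"
            have n2: "simple_root r \<notin> N v2" using g2(3) inv_roots_mult_gen_left'(2)[OF Yc r(1) rY] by blast
            have vc: "?v \<in> carrier W" using r g2(2) by simp
            have rv: "simple_root r \<in> N ?v" using inv_roots_mult_gen_left[OF g2(2) r(1) n2] by simp
            have rr: "r \<otimes> ?v = v2" using r g2(2) by simp
            have al: "aligned (bs @ [s]) ?v" unfolding e using aligned_shift[OF dr sr rv vc] g2(1) rr by simp
            have vY: "N ?v \<subseteq> N Y" using shift_subset[OF vc rv Yc rY r(1)] g2(3) rr by simp
            have below: "N x \<subseteq> N ?v" if x: "aligned (bs @ [s]) x" "N x \<subseteq> N Y" "simple_root r \<in> N x" for x
            proof -
              have xc: "x \<in> carrier W" using aligned_closed[OF x(1)] .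
              have "aligned ((ds @ [s]) @ [r]) (r \<otimes> x)" using aligned_shift[OF dr sr x(3) xc] x(1) unfolding e by simp
              moreover have "N (r \<otimes> x) \<subseteq> N (r \<otimes> Y)" using shift_subset[OF xc x(3) Yc rY r(1)] x(2) by simp
              ultimately have "N (r \<otimes> x) \<subseteq> N (r \<otimes> ?v)" using g2(4) rr by simp
              then show ?thesis using shift_subset[OF xc x(3) vc rv r(1)] by simp
            qed
            have rx: "N r \<subseteq> N ?x" using rY jY(1) inv_roots_gen[OF r(1)] r(3) by (auto simp: simple_root_def fun_eq_iff)
            have "N r \<subseteq> N v'" by (rule g'(4)[OF aligned_gen rx]) (use r Cons in auto)
            then have "simple_root r \<in> N v'" using inv_roots_gen[OF r(1)] by simp
            then have v'v: "N v' \<subseteq> N ?v" using below g'(1) v'Y by blast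
            \<comment> \<open>That \<open>s\<close> is below \<open>?v\<close> is seen from the longest element \<open>z\<close> of the dihedral group of \<open>r\<close> and \<open>s\<close>: it is aligned, below
            \<open>Y\<close>, and above \<open>r\<close>, so that the recursion applies to it, whereas it does not apply to \<open>s\<close> itself.\<close>
            obtain z where z: "z \<in> carrier W" "N z = {f \<in> posroots. supp_in {r, s} f}"
              using ex_parabolic_longest[of "{r, s}"] r s by auto
            have zal: "aligned (bs @ [s]) z" by (rule aligned_parabolic_longest[OF z]) (use Cons in auto)
            have zr: "simple_root r \<in> N z" "simple_root s \<in> N z" using z(2) r s by auto
            have "N z \<subseteq> N Y"
            proof
              fix f assume f: "f \<in> N z"
              have f': "f \<in> posroots" "supp_in {r, s} f" using f z(2) by auto
              have "nonneg (- act (inv Y) f)"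
                by (rule nonpos_act[OF _ _ f'(2)]) (use f' posrootD inv_rootsD(2)[OF rY] inv_rootsD(2)[OF jY(2)] in auto)
              then show "f \<in> N Y" using f' by (simp add: inv_roots_def)
            qed
            then have "simple_root s \<in> N ?v" using below[OF zal _ zr(1)] zr(2) by blast
            then show ?thesis using al vY v'v by blast
          qed
        qed
        then obtain v'' where v'': "aligned (bs @ [s]) v''" "simple_root s \<in> N v''" "N v'' \<subseteq> N Y" "N v' \<subseteq> N v''" by blast
        note cl = cover_by_last[OF db sb Yc jY(2,1) v' v'']
        have "N v' \<subseteq> N v1"
          by (rule g1(4)[OF g'(1)]) (use g'(3) shift_subset[OF Yc jY(2) w True s(1)] Yw in blast)
        then have "N (s \<otimes> v') \<subseteq> N ?v0" using shift_subset'[OF g'(2) nv' g1(2) n1 s(1)] by simp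
        then show ?thesis using uv' v''(4) cl(1) by blast
      qed
      have "greatest_aligned as w ?v0" unfolding greatest_aligned_def Cons using al0 le0 up by blast
      then show ?thesis by blast
    qed
  qed
qed

definition proj :: "'a list \<Rightarrow> 'a \<Rightarrow> 'a" where
  "proj as w = (SOME v. greatest_aligned as w v)"

lemma proj_greatest: "distinct_gens as \<Longrightarrow> w \<in> carrier W \<Longrightarrow> greatest_aligned as w (proj as w)"
  unfolding proj_def by (rule someI_ex) (simp add: ex_greatest_aligned distinct_gens_def)

lemma proj_aligned: "distinct_gens as \<Longrightarrow> w \<in> carrier W \<Longrightarrow> aligned as (proj as w)"
  by (rule greatest_alignedD(1)[OF proj_greatest])

lemma proj_closed [simp]: "distinct_gens as \<Longrightarrow> w \<in> carrier W \<Longrightarrow> proj as w \<in> carrier W"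
  by (rule greatest_alignedD(2)[OF proj_greatest])

lemma proj_le: "distinct_gens as \<Longrightarrow> w \<in> carrier W \<Longrightarrow> N (proj as w) \<subseteq> N w"
  by (rule greatest_alignedD(3)[OF proj_greatest])

lemma proj_max: "distinct_gens as \<Longrightarrow> w \<in> carrier W \<Longrightarrow> aligned as u \<Longrightarrow> N u \<subseteq> N w \<Longrightarrow> N u \<subseteq> N (proj as w)"
  by (rule greatest_alignedD(4)[OF proj_greatest])

lemma proj_eqI:
  assumes "distinct_gens as" "w \<in> carrier W" "greatest_aligned as w v"
  shows "proj as w = v"
proof (rule inv_roots_inj)
  note v = greatest_alignedD[OF assms(3)]
  show "v \<in> carrier W" by (rule v(2))
  show "N (proj as w) = N v"
  proof
    show "N (proj as w) \<subseteq> N v" by (rule v(4)[OF proj_aligned[OF assms(1,2)] proj_le[OF assms(1,2)]])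
    show "N v \<subseteq> N (proj as w)" by (rule proj_max[OF assms(1,2) v(1,3)])
  qed
qed (use assms in simp)

lemma proj_of_aligned: "distinct_gens as \<Longrightarrow> aligned as v \<Longrightarrow> proj as v = v"
  by (rule proj_eqI) (auto simp: greatest_aligned_def aligned_closed)

lemma proj_mono:
  assumes "distinct_gens as" "v \<in> carrier W" "w \<in> carrier W" "N v \<subseteq> N w"
  shows "N (proj as v) \<subseteq> N (proj as w)"
  using proj_max[OF assms(1,3) proj_aligned[OF assms(1,2)]] proj_le[OF assms(1,2)] assms(4) by blast

lemma proj_drop:
  assumes g: "distinct_gens (s # bs)" and w: "w \<in> carrier W" and n: "simple_root s \<notin> N w"
  shows "proj (s # bs) w = proj bs w"
proof (rule proj_eqI[OF g w])
  have al: "aligned (s # bs) u \<longleftrightarrow> aligned bs u" if "N u \<subseteq> N w" for u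
    using aligned_drop_first[OF distinct_gensD[OF g]] that n by blast
  show "greatest_aligned (s # bs) w (proj bs w)"
    using proj_greatest[OF distinct_gens_tl[OF g] w] al unfolding greatest_aligned_def by blast
qed

lemma gen_le_proj:
  assumes "distinct_gens as" "w \<in> carrier W" "s \<in> set as" "simple_root s \<in> N w"
  shows "simple_root s \<in> N (proj as w)"
proof -
  have s: "s \<in> S" using assms distinct_gensD by blast
  have "N s \<subseteq> N (proj as w)"
    by (rule proj_max[OF assms(1,2) aligned_gen[OF s assms(3)]]) (use inv_roots_gen[OF s] assms(4) in simp)
  then show ?thesis using inv_roots_gen[OF s] by simp
qed

lemma proj_shift:
  assumes g: "distinct_gens (s # bs)" and w: "w \<in> carrier W" and sw: "simple_root s \<in> N w"
  shows "s \<otimes> proj (s # bs) w = proj (bs @ [s]) (s \<otimes> w)"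
proof -
  note s = distinct_gens_hd(1)[OF g]
  have swc: "s \<otimes> w \<in> carrier W" using s w gen_closed by simp
  let ?v = "proj (s # bs) w" and ?v1 = "proj (bs @ [s]) (s \<otimes> w)"
  note v = proj_aligned[OF g w] proj_closed[OF g w] proj_le[OF g w]
  note g' = distinct_gens_rotate[OF g]
  note v1 = proj_aligned[OF g' swc] proj_closed[OF g' swc] proj_le[OF g' swc]
  have sv: "simple_root s \<in> N ?v" by (rule gen_le_proj[OF g w _ sw]) simp
  have n1: "simple_root s \<notin> N ?v1" using v1(3) inv_roots_mult_gen_left'(2)[OF w s sw] by blast
  have v0c: "s \<otimes> ?v1 \<in> carrier W" using s v1(2) gen_closed by simp
  have s0: "simple_root s \<in> N (s \<otimes> ?v1)" using inv_roots_mult_gen_left[OF v1(2) s n1] by simp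
  have ss: "s \<otimes> (s \<otimes> ?v1) = ?v1" using s v1(2) by simp
  have "aligned (bs @ [s]) (s \<otimes> ?v)" using aligned_shift[OF distinct_gensD[OF g] sv v(2)] v(1) by simp
  moreover have "N (s \<otimes> ?v) \<subseteq> N (s \<otimes> w)" using shift_subset[OF v(2) sv w sw s] v(3) by simp
  ultimately have 1: "N (s \<otimes> ?v) \<subseteq> N ?v1" by (rule proj_max[OF g' swc])
  have "aligned (s # bs) (s \<otimes> ?v1)" using aligned_shift[OF distinct_gensD[OF g] s0 v0c] v1(1) ss by simp
  moreover have "N (s \<otimes> ?v1) \<subseteq> N w" using shift_subset[OF v0c s0 w sw s] v1(3) ss by simp
  ultimately have "N (s \<otimes> ?v1) \<subseteq> N ?v" by (rule proj_max[OF g w])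
  then have 2: "N ?v1 \<subseteq> N (s \<otimes> ?v)" using shift_subset[OF v0c s0 v(2) sv s] ss by simp
  show ?thesis by (rule inv_roots_inj) (use 1 2 s v v1 gen_closed in auto)
qed

text \<open>For \<open>Y\<close> that covers \<open>s Y\<close> it does not matter whether \<open>s\<close> is the first or the last letter: the projections of \<open>Y\<close> for both words
exceed the projection of \<open>s Y\<close> for the rotated word by \<open>\<alpha>\<^sub>s\<close>.\<close>

lemma proj_at_cover:
  assumes g: "distinct_gens (s # bs)" and Y: "Y \<in> carrier W" "simple_root s \<in> N Y" and sY: "N (s \<otimes> Y) = N Y - {simple_root s}"
  shows "proj (bs @ [s]) Y = proj (s # bs) Y" "N (s \<otimes> proj (s # bs) Y) = N (proj (s # bs) Y) - {simple_root s}"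
proof -
  note s = distinct_gens_hd(1)[OF g]
  have sYc: "s \<otimes> Y \<in> carrier W" using s Y gen_closed by simp
  note g' = distinct_gens_rotate[OF g]
  have sv: "simple_root s \<in> N (proj (bs @ [s]) Y)" by (rule gen_le_proj[OF g' Y(1) _ Y(2)]) simp
  have le: "N (proj (bs @ [s]) (s \<otimes> Y)) \<subseteq> N (proj (bs @ [s]) Y)"
    by (rule proj_mono[OF g' sYc Y(1)]) (use sY in blast)
  note c = cover_by_last[OF distinct_gensD[OF g] Y sY proj_greatest[OF g' sYc] proj_aligned[OF g' Y(1)] sv proj_le[OF g' Y(1)] le]
  have sh: "s \<otimes> proj (s # bs) Y = proj (bs @ [s]) (s \<otimes> Y)" by (rule proj_shift[OF g Y])
  then have "proj (s # bs) Y = s \<otimes> proj (bs @ [s]) (s \<otimes> Y)" using s Y g by (metis gen_cancel_left proj_closed)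
  then show e: "proj (bs @ [s]) Y = proj (s # bs) Y" using c(1) by simp
  show "N (s \<otimes> proj (s # bs) Y) = N (proj (s # bs) Y) - {simple_root s}"
    unfolding sh c(2) using e by simp
qed

section \<open>Walls of aligned elements\<close>

text \<open>For aligned \<open>v\<close> these are the normals of the facets of the cone formed by the chambers with projection \<open>v\<close>. They are read
off from the sorting word of \<open>v\<close>: a letter contributes its simple root, moved by the letters used so far, when it is
skipped for the first time.\<close>

inductive wall :: "'a list \<Rightarrow> 'a \<Rightarrow> ('a \<Rightarrow> real) \<Rightarrow> bool" where
  skip: "simple_root s \<notin> N v \<Longrightarrow> wall (s # bs) v (simple_root s)"
| rest: "simple_root s \<notin> N v \<Longrightarrow> wall bs v f \<Longrightarrow> wall (s # bs) v f"
| used: "simple_root s \<in> N v \<Longrightarrow> wall (bs @ [s]) (s \<otimes> v) f \<Longrightarrow> wall (s # bs) v (reflect s f)"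

lemma wall_supp: "wall as v f \<Longrightarrow> supp_in (set as) f"
proof (induction rule: wall.induct)
  case (rest s v bs f) then show ?case by (auto simp: supp_in_def)
next
  case (used s v bs f) then show ?case by (intro supp_in_reflect) auto
qed auto

text \<open>The Euler form is invariant under rotation, and when \<open>s\<close> is skipped, the walls found later lack \<open>s\<close>, so that
\<open>E(g, \<alpha>\<^sub>s) = g s = 0\<close>.\<close>

lemma wall_orthogonal:
  assumes "wall as v f" "wall as v g" "distinct_gens as"
  shows "f = g \<or> euler as f g = 0 \<or> euler as g f = 0"
  using assms
proof (induction arbitrary: g rule: wall.induct)
  case (skip s v bs)
  from skip(2) skip show ?case
  proof cases
    case rest
    then have "g s = 0" using wall_supp distinct_gens_hd(2)[OF skip(3)] supp_inD by metis
    then show ?thesis using euler_first_right[OF distinct_gens_hd(2)[OF skip(3)], of g] by simp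
  qed auto
next
  case (rest s v bs f)
  have f: "f s = 0" using wall_supp[OF rest(2)] distinct_gens_hd(2)[OF rest(5)] supp_inD by metis
  from rest(4) rest(1) show ?case
  proof cases
    case skip
    then show ?thesis using f euler_first_right[OF distinct_gens_hd(2)[OF rest(5)], of f] by simp
  next
    case g: rest
    then have "g s = 0" using wall_supp distinct_gens_hd(2)[OF rest(5)] supp_inD by metis
    then show ?thesis using rest.IH[OF g(2) distinct_gens_tl[OF rest(5)]] f by simp
  qed auto
next
  case (used s v bs f)
  from used(4) used(1) show ?case
  proof cases
    case g: (used g')
    have e: "set (bs @ [s]) = set (s # bs)" by auto
    have ss: "s \<in> S" using distinct_gens_hd(1)[OF used(5)] .
    have "euler (bs @ [s]) a b = euler (s # bs) (reflect s a) (reflect s b)"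
      if "supp_in (set (bs @ [s])) a" "supp_in (set (bs @ [s])) b" for a b
      using euler_shift[OF distinct_gensD[OF used(5)], of "reflect s a" "reflect s b"] supp_in_reflect[of s "set (s # bs)"] that ss
      unfolding e by simp
    then show ?thesis using used.IH[OF g(3) distinct_gens_rotate[OF used(5)]] wall_supp[OF used(2)] wall_supp[OF g(3)] g(1) by metis
  qed auto
qed

lemma cover_flip:
  assumes x: "x \<in> carrier W" and v: "v \<in> carrier W" and s: "s \<in> S"
    and c: "N v = insert (simple_root s) (N x)" "simple_root s \<notin> N x"
  shows "x = s \<otimes> v"
proof -
  have "N x \<subseteq> N v" "x \<noteq> v" using c by auto
  then obtain r where r: "r \<in> S" "- act v (simple_root r) \<in> N v" "- act v (simple_root r) \<notin> N x"
    "N (v \<otimes> r) = N v - {- act v (simple_root r)}"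
    using cover_below[OF x v] by metis
  have e: "- act v (simple_root r) = simple_root s" using r(2,3) c(1) by blast
  then have "N (v \<otimes> r) = N x" using r(4) c by auto
  then have "x = v \<otimes> r" using inv_roots_inj x v r(1) gen_closed m_closed by metis
  then show ?thesis using descent_commute[OF v r(1) s e] by simp
qed

lemma cover_shift:
  assumes x: "x \<in> carrier W" "simple_root s \<in> N x" and v: "v \<in> carrier W" and s: "s \<in> S"
    and c: "N v = insert f (N x)" "f \<notin> N x"
  shows "N (s \<otimes> v) = insert (reflect s f) (N (s \<otimes> x))" "reflect s f \<notin> N (s \<otimes> x)"
proof -
  have sv: "simple_root s \<in> N v" using x c by blast
  have "N v - {simple_root s} = insert f (N x - {simple_root s})" using c x by auto
  then show "N (s \<otimes> v) = insert (reflect s f) (N (s \<otimes> x))"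
    unfolding inv_roots_mult_gen_left'(1)[OF v s sv] inv_roots_mult_gen_left'(1)[OF x(1) s x(2)] by simp
  show "reflect s f \<notin> N (s \<otimes> x)"
  proof
    assume "reflect s f \<in> N (s \<otimes> x)"
    then obtain f' where "f' \<in> N x" "reflect s f = reflect s f'"
      unfolding inv_roots_mult_gen_left'(1)[OF x(1) s x(2)] by auto
    then show False using c(2) s by (metis reflect_reflect)
  qed
qed

text \<open>The recursion leads to a situation in which \<open>s\<close> is the first letter and \<open>f = \<alpha>\<^sub>s\<close>; there \<open>v\<close> skips \<open>s\<close>.\<close>

lemma upper_wall:
  assumes "distinct_gens as" "aligned as v" "aligned as w" "N w = insert f (N v)" "f \<notin> N v"
  shows "wall as v f"
  using assms
proof (induction "length as + card (N v)" arbitrary: as v w f rule: less_induct)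
  case less
  note g = less.prems(1) and v = less.prems(2) and w = less.prems(3) and c = less.prems(4,5)
  have vc: "v \<in> carrier W" and wc: "w \<in> carrier W" using v w aligned_closed by auto
  show ?case
  proof (cases as)
    case Nil
    then have "v = \<one>" "w = \<one>" using v w aligned_Nil by auto
    then show ?thesis using c(1) by simp
  next
    case (Cons s bs)
    have g': "distinct_gens (s # bs)" using g Cons by simp
    note s = distinct_gens_hd(1)[OF g']
    consider "simple_root s \<in> N v" | "simple_root s \<notin> N v" "simple_root s \<in> N w" | "simple_root s \<notin> N w"
      by blast
    then show ?thesis
    proof cases
      case 1
      have sw: "simple_root s \<in> N w" using 1 c by blast
      note cs = cover_shift[OF vc 1 wc s c]
      have m: "length (bs @ [s]) + card (N (s \<otimes> v)) < length as + card (N v)" using card_inv_roots_shift[OF vc s 1] Cons by simp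
      have "aligned (bs @ [s]) (s \<otimes> v)" "aligned (bs @ [s]) (s \<otimes> w)"
        using aligned_shift[OF distinct_gensD[OF g'] 1 vc] aligned_shift[OF distinct_gensD[OF g'] sw wc] v w Cons by simp_all
      then have "wall (bs @ [s]) (s \<otimes> v) (reflect s f)"
        by (rule less.hyps[OF m distinct_gens_rotate[OF g'] _ _ cs])
      from wall.used[OF 1 this] show ?thesis using Cons s by simp
    next
      case 2
      then have "f = simple_root s" using c(1) by (metis insertE)
      then show ?thesis using Cons 2 wall.skip by simp
    next
      case 3
      have n: "simple_root s \<notin> N v" using 3 c by blast
      have m: "length bs + card (N v) < length as + card (N v)" using Cons by simp
      have "aligned bs v" "aligned bs w"
        using aligned_drop_first[OF distinct_gensD[OF g'] n] aligned_drop_first[OF distinct_gensD[OF g'] 3] v w Cons by simp_all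
      then have "wall bs v f" by (rule less.hyps[OF m distinct_gens_tl[OF g'] _ _ c])
      then show ?thesis using Cons n wall.rest by simp
    qed
  qed
qed

text \<open>The recursion leads to \<open>f = \<alpha>\<^sub>s\<close> and \<open>x = s v\<close>, \<open>s\<close> being the first letter. Then \<open>v\<close> is also aligned for the rotated
word, and so is \<open>x\<close>; thus \<open>\<alpha>\<^sub>s\<close> is an upper wall of \<open>x\<close> for that word, which \<open>s\<close> reflects to the wall \<open>- \<alpha>\<^sub>s\<close> of \<open>v\<close>.\<close>

lemma lower_wall:
  assumes "distinct_gens as" "aligned as v" "x \<in> carrier W" "N v = insert f (N x)" "f \<notin> N x"
  shows "wall as v (- f)"
  using assms
proof (induction "length as + card (N v)" arbitrary: as v x f rule: less_induct)
  case less
  note g = less.prems(1) and v = less.prems(2) and x = less.prems(3) and c = less.prems(4,5)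
  have vc: "v \<in> carrier W" using v aligned_closed by auto
  show ?case
  proof (cases as)
    case Nil
    then have "v = \<one>" using v aligned_Nil by auto
    then show ?thesis using c(1) by simp
  next
    case (Cons s bs)
    have g': "distinct_gens (s # bs)" using g Cons by simp
    note s = distinct_gens_hd(1)[OF g']
    consider "simple_root s \<in> N x" | "simple_root s \<notin> N x" "simple_root s \<in> N v" | "simple_root s \<notin> N v"
      by blast
    then show ?thesis
    proof cases
      case 1
      have sv: "simple_root s \<in> N v" using 1 c by blast
      note cs = cover_shift[OF x 1 vc s c]
      have m: "length (bs @ [s]) + card (N (s \<otimes> v)) < length as + card (N v)" using card_inv_roots_shift[OF vc s sv] Cons by simp
      have "aligned (bs @ [s]) (s \<otimes> v)" using aligned_shift[OF distinct_gensD[OF g'] sv vc] v Cons by simp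
      moreover have "s \<otimes> x \<in> carrier W" using s x gen_closed by simp
      ultimately have "wall (bs @ [s]) (s \<otimes> v) (- reflect s f)"
        by (rule less.hyps[OF m distinct_gens_rotate[OF g'] _ _ cs])
      from wall.used[OF sv this] show ?thesis using Cons s by (simp add: reflect_uminus)
    next
      case 2
      then have f: "f = simple_root s" using c(1) by (metis insertE)
      have xs: "x = s \<otimes> v" by (rule cover_flip[OF x vc s]) (use c f in auto)
      have sv: "N (s \<otimes> v) = N v - {simple_root s}" using xs c f by auto
      have pv: "proj (s # bs) v = v" using proj_of_aligned[OF g'] v Cons by simp
      have "proj (bs @ [s]) v = v" using proj_at_cover(1)[OF g' vc 2(2) sv] pv by simp
      then have av: "aligned (bs @ [s]) v" using proj_aligned[OF distinct_gens_rotate[OF g'] vc] by simp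
      have "aligned (bs @ [s]) x" using aligned_shift[OF distinct_gensD[OF g'] 2(2) vc] v unfolding Cons xs by simp
      then have "wall (bs @ [s]) x (simple_root s)"
        using upper_wall[OF distinct_gens_rotate[OF g'] _ av c] unfolding f by simp
      then have "wall (s # bs) v (reflect s (simple_root s))" unfolding xs by (rule wall.used[OF 2(2)])
      then show ?thesis unfolding Cons f reflect_simple[OF s] .
    next
      case 3
      have m: "length bs + card (N v) < length as + card (N v)" using Cons by simp
      have "aligned bs v" using aligned_drop_first[OF distinct_gensD[OF g'] 3] v Cons by simp
      then have "wall bs v (- f)" by (rule less.hyps[OF m distinct_gens_tl[OF g'] _ x c])
      then show ?thesis using Cons 3 wall.rest by simp
    qed
  qed
qed

lemma euler_uminus: "euler as (- f) (- g) = euler as f g"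
proof -
  have "- f = comb (-1) f 0 f" "- g = comb (-1) g 0 g" by (auto simp: comb_def)
  then show ?thesis by (simp only: euler_comb_left euler_comb_right) simp
qed

text \<open>For \<open>\<alpha>\<^sub>s\<close> and \<open>\<beta> = - v \<alpha>\<^sub>r\<close> one of \<open>E(\<alpha>\<^sub>s, \<beta>)\<close> and \<open>E(\<beta>, \<alpha>\<^sub>s)\<close> is zero, and the latter is the coefficient in question.
Their sum is the inner product of \<open>\<alpha>\<^sub>s\<close> and \<open>\<beta>\<close>, which is not positive: applying \<open>v\<inverse>\<close> turns it into that of two simple roots.\<close>

lemma lower_walls_avoid_first:
  assumes g: "distinct_gens (s # bs)" and v: "aligned (s # bs) v"
    and sv: "simple_root s \<in> N v" "N (s \<otimes> v) = N v - {simple_root s}"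
    and r: "r \<in> S" "- act v (simple_root r) \<in> N v" "- act v (simple_root r) \<noteq> simple_root s"
  shows "(- act v (simple_root r)) s = 0"
proof -
  let ?f = "- act v (simple_root r)"
  note s = distinct_gens_hd(1)[OF g]
  have vc: "v \<in> carrier W" using v aligned_closed by auto
  have svc: "s \<otimes> v \<in> carrier W" using s vc gen_closed by simp
  have "nonneg ?f" using inv_rootsD(1)[OF r(2)] posrootD by blast
  then have Nr: "N (v \<otimes> r) = N v - {?f}" using inv_roots_mult_gen_right'(1)[OF vc r(1)] by simp
  \<comment> \<open>Both roots are lost in going down a cover from \<open>v\<close>.\<close>
  have w1: "wall (s # bs) v (- simple_root s)"
    by (rule lower_wall[OF g v svc]) (use sv in auto)
  have w2: "wall (s # bs) v (- ?f)"
    by (rule lower_wall[OF g v, of "v \<otimes> r"]) (use vc r Nr gen_closed in auto)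
  have fs: "supp_in (set (s # bs)) ?f" using aligned_supp[OF v r(2)] .
  have ne: "- simple_root s \<noteq> - ?f"
  proof
    assume "- simple_root s = - ?f"
    then have "- (- simple_root s) = - (- ?f)" by (rule arg_cong)
    then show False using r(3) by simp
  qed
  have "euler (s # bs) (simple_root s) ?f = 0 \<or> euler (s # bs) ?f (simple_root s) = 0"
    using wall_orthogonal[OF w1 w2 g] ne unfolding euler_uminus by simp
  moreover have "euler (s # bs) ?f (simple_root s) = ?f s" by (rule euler_first_right[OF distinct_gens_hd(2)[OF g]])
  moreover have "euler (s # bs) (simple_root s) ?f + euler (s # bs) ?f (simple_root s) = form (simple_root s) ?f"
    by (rule euler_add_transpose[OF distinct_gensD[OF g] _ fs]) simp
  moreover have "form (simple_root s) ?f \<le> 0"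
  proof -
    have sub: "N (s \<otimes> v) \<subseteq> N v" unfolding sv(2) by (rule Diff_subset)
    have ne': "s \<otimes> v \<noteq> v"
    proof
      assume "s \<otimes> v = v"
      then have "simple_root s \<in> N (s \<otimes> v)" using sv(1) by simp
      then show False unfolding sv(2) by simp
    qed
    \<comment> \<open>The root \<open>\<alpha>\<^sub>s\<close>, too, is the negative of the image under \<open>v\<close> of a simple root.\<close>
    obtain q where q: "q \<in> S" "- act v (simple_root q) \<in> N v" "- act v (simple_root q) \<notin> N (s \<otimes> v)"
      by (rule cover_below[OF svc vc sub ne'])
    have e: "simple_root s = - act v (simple_root q)" using q(2,3) unfolding sv(2) by simp
    have qr: "q \<noteq> r" using e r(3) by metis
    have "form (simple_root s) ?f = cartan q r"
      unfolding e form_uminus_left form_uminus_right form_act[OF vc] form_simple_left[OF q(1)] pairing_simple[OF r(1)] by simp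
    then show ?thesis using cartan_nonpos[OF q(1) r(1) qr] by simp
  qed
  moreover have "0 \<le> ?f s" by (rule posroot_coeff_nonneg[OF inv_rootsD(1)[OF r(2)]])
  ultimately show ?thesis by linarith
qed

section \<open>The projection preserves joins\<close>

text \<open>The complement is \<open>w w\<^sub>0\<close> with the longest element \<open>w\<^sub>0\<close>.\<close>

lemma ex_complement:
  assumes w: "w \<in> carrier W"
  shows "\<exists>w' \<in> carrier W. N w' = posroots - N w"
proof -
  obtain w0 where w0: "w0 \<in> carrier W" "N w0 = posroots" using ex_longest by blast
  have i: "act (inv (w \<otimes> w0)) f = act (inv w0) (act (inv w) f)" for f
    using w w0 by (simp add: inv_mult_group act_mult)
  have ww: "w \<otimes> w0 \<in> carrier W" using w w0(1) by simp
  have iff: "f \<in> N (w \<otimes> w0) \<longleftrightarrow> f \<notin> N w" if f: "f \<in> posroots" for f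
  proof -
    have r: "act (inv w) f \<in> roots" using act_root[OF inv_closed[OF w]] posrootD[OF f] by simp
    show ?thesis
    proof
      assume n: "f \<notin> N w"
      then have "nonneg (act (inv w) f)" using notin_inv_roots[OF w f] by simp
      then have "act (inv w) f \<in> N w0" unfolding w0(2) by (rule posrootI[OF r])
      then have "nonneg (- act (inv w0) (act (inv w) f))" by (rule inv_rootsD)
      then show "f \<in> N (w \<otimes> w0)" using f by (simp add: inv_roots_def i)
    next
      assume a: "f \<in> N (w \<otimes> w0)"
      show "f \<notin> N w"
      proof
        assume "f \<in> N w"
        then have "nonneg (- act (inv w) f)" by (rule inv_rootsD)
        then have "- act (inv w) f \<in> N w0" unfolding w0(2) by (rule posrootI[OF uminus_root[OF r]])
        then have "nonneg (- act (inv w0) (- act (inv w) f))" by (rule inv_rootsD)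
        then have "nonneg (act (inv (w \<otimes> w0)) f)" unfolding act_uminus i by simp
        then show False using notin_inv_roots[OF ww f] a by simp
      qed
    qed
  qed
  have "N (w \<otimes> w0) = posroots - N w"
    using iff inv_roots_subset[of "w \<otimes> w0"] by (intro subset_antisym subsetI) auto
  then show ?thesis using ww by (intro bexI)
qed

text \<open>The elements that are not above \<open>s\<close> are those below the complement of \<open>s\<close>.\<close>

lemma wjoin_avoids_gen:
  assumes s: "s \<in> S" and x: "x \<in> carrier W" "simple_root s \<notin> N x" and y: "y \<in> carrier W" "simple_root s \<notin> N y"
  shows "simple_root s \<notin> N (wjoin x y)"
proof -
  obtain q where q: "q \<in> carrier W" "N q = posroots - N s" using ex_complement[OF gen_closed[OF s]] by metis
  have "N x \<subseteq> N q" "N y \<subseteq> N q" using q(2) x(2) y(2) inv_roots_gen[OF s] inv_roots_subset by auto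
  then have "N (wjoin x y) \<subseteq> N q" by (rule wjoin_least[OF x(1) y(1) q(1)])
  then show ?thesis using q(2) inv_roots_gen[OF s] by auto
qed

text \<open>The complement \<open>q\<close> of the part without \<open>s\<close> of the complement of \<open>y\<close> inverts all roots that involve \<open>s\<close>, and of the others
only those which \<open>y\<close> inverts. So \<open>q\<close> is an upper bound of \<open>s\<close> and \<open>y\<close>.\<close>

lemma wjoin_gen_parabolic:
  assumes s: "s \<in> S" and y: "y \<in> carrier W" and f: "f \<in> N (wjoin s y)" "f s = 0"
  shows "f \<in> N y"
proof -
  obtain y' where y': "y' \<in> carrier W" "N y' = posroots - N y" using ex_complement[OF y] by metis
  obtain p where p: "p \<in> carrier W" "N p = {f \<in> N y'. supp_in (S - {s}) f}" by (rule ex_parabolic_part[OF y'(1) Diff_subset[of S "{s}"]])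
  obtain q where q: "q \<in> carrier W" "N q = posroots - N p" using ex_complement[OF p(1)] by metis
  have "simple_root s \<in> N q" using q(2) p(2) s by auto
  then have "N s \<subseteq> N q" using inv_roots_gen[OF s] by simp
  moreover have "N y \<subseteq> N q" using q(2) p(2) y'(2) inv_roots_subset by blast
  ultimately have "N (wjoin s y) \<subseteq> N q" using wjoin_least s y q(1) gen_closed by simp
  then have fq: "f \<in> N q" using f(1) by blast
  have fp: "f \<in> posroots" using f(1) inv_rootsD(1) by blast
  have "supp_in (S - {s}) f" using root_supp posrootD[OF fp] f(2) by (auto simp: supp_in_def)
  then show ?thesis using fq q(2) p(2) y'(2) fp by blast
qed

text \<open>Let \<open>v\<close> be the projection on the left, \<open>u\<close> its part without \<open>s\<close> and \<open>z = s \<or> u\<close>. If \<open>z < v\<close>, then some cover going down from \<open>v\<close>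
stays above \<open>z\<close> and loses a root other than \<open>\<alpha>\<^sub>s\<close>; this root lacks \<open>s\<close> and so is inverted by \<open>u\<close>, a contradiction. Hence \<open>v = s \<or> u\<close>,
and \<open>u\<close> is an aligned element below \<open>y\<close>.\<close>

lemma proj_wjoin_gen:
  assumes g: "distinct_gens (s # bs)" and y: "y \<in> carrier W" and n: "simple_root s \<notin> N y"
  shows "N (proj (s # bs) (wjoin s y)) \<subseteq> N (wjoin s (proj (s # bs) y))"
proof -
  note s = distinct_gens_hd(1)[OF g]
  have sc: "s \<in> carrier W" using s gen_closed by simp
  define Y where "Y = wjoin s y"
  have Yc: "Y \<in> carrier W" using sc y by (simp add: Y_def)
  note jY = join_gen_descent[OF s y n, folded Y_def]
  define v where "v = proj (s # bs) Y"
  have v: "aligned (s # bs) v" "v \<in> carrier W" "N v \<subseteq> N Y"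
    using proj_aligned[OF g Yc] proj_le[OF g Yc] proj_closed[OF g Yc] by (simp_all add: v_def)
  have sv: "simple_root s \<in> N v" unfolding v_def by (rule gen_le_proj[OF g Yc _ jY(2)]) simp
  have sv': "N (s \<otimes> v) = N v - {simple_root s}" unfolding v_def by (rule proj_at_cover(2)[OF g Yc jY(2,1)])
  obtain u where u: "u \<in> carrier W" "N u = {f \<in> N v. supp_in (set bs) f}"
    using ex_parabolic_part[OF v(2)] distinct_gensD(2)[OF distinct_gens_tl[OF g]] by blast
  have ua: "aligned bs u" by (rule aligned_parabolic_part[OF distinct_gensD(1)[OF g] v(1) u])
  define z where "z = wjoin s u"
  have zc: "z \<in> carrier W" using sc u by (simp add: z_def)
  have sz: "simple_root s \<in> N z" and uz: "N u \<subseteq> N z"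
    using wjoin_upper1[OF sc u(1)] wjoin_upper2[OF sc u(1)] inv_roots_gen[OF s] by (auto simp: z_def)
  have zv: "N z \<subseteq> N v" unfolding z_def
    by (rule wjoin_least[OF sc u(1) v(2)]) (use inv_roots_gen[OF s] sv u(2) in auto)
  have "z = v"
  proof (rule ccontr)
    assume "z \<noteq> v"
    then obtain r where r: "r \<in> S" "- act v (simple_root r) \<in> N v" "- act v (simple_root r) \<notin> N z"
      using cover_below[OF zc v(2) zv] by metis
    let ?f = "- act v (simple_root r)"
    have "?f \<noteq> simple_root s" using r(3) sz by metis
    then have "?f s = 0" by (rule lower_walls_avoid_first[OF g v(1) sv sv' r(1,2)])
    then have "supp_in (set bs) ?f" using aligned_supp[OF v(1) r(2)] by (auto simp: supp_in_def)
    then have "?f \<in> N u" using u(2) r(2) by blast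
    then show False using r(3) uz by blast
  qed
  have "N u \<subseteq> N y"
  proof
    fix f assume "f \<in> N u"
    then have "f \<in> N Y" "supp_in (set bs) f" using u(2) v(3) by auto
    moreover have "f s = 0" using supp_inD[OF \<open>supp_in (set bs) f\<close> distinct_gens_hd(2)[OF g]] .
    ultimately show "f \<in> N y" using wjoin_gen_parabolic[OF s y] by (simp add: Y_def)
  qed
  then have "N u \<subseteq> N (proj bs y)" by (rule proj_max[OF distinct_gens_tl[OF g] y ua])
  then have uy: "N u \<subseteq> N (proj (s # bs) y)" using proj_drop[OF g y n] by simp
  let ?j = "wjoin s (proj (s # bs) y)"
  have pc: "proj (s # bs) y \<in> carrier W" using g y by simp
  have "N z \<subseteq> N ?j" unfolding z_def
    by (rule wjoin_least[OF sc u(1)]) (use wjoin_upper1[OF sc pc] wjoin_upper2[OF sc pc] uy sc pc in auto)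
  then show ?thesis using \<open>z = v\<close> by (simp add: v_def Y_def)
qed

lemma wjoin_commute: "x \<in> carrier W \<Longrightarrow> y \<in> carrier W \<Longrightarrow> wjoin x y = wjoin y x"
  by (intro inv_roots_inj subset_antisym wjoin_least wjoin_upper1 wjoin_upper2 wjoin_closed)

lemma wjoin_shift:
  assumes s: "s \<in> S" and x: "x \<in> carrier W" "simple_root s \<in> N x" and y: "y \<in> carrier W" "simple_root s \<in> N y"
  shows "wjoin (s \<otimes> x) (s \<otimes> y) = s \<otimes> wjoin x y"
proof -
  let ?x = "s \<otimes> x" and ?y = "s \<otimes> y" and ?j = "wjoin x y"
  have sc: "s \<in> carrier W" using s gen_closed by simp
  have c: "?x \<in> carrier W" "?y \<in> carrier W" "?j \<in> carrier W" using sc x y by simp_all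
  have jc: "wjoin ?x ?y \<in> carrier W" "s \<otimes> ?j \<in> carrier W" "s \<otimes> wjoin ?x ?y \<in> carrier W" using c sc by simp_all
  have n: "simple_root s \<notin> N ?x" "simple_root s \<notin> N ?y"
    using inv_roots_mult_gen_left'(2)[OF x(1) s x(2)] inv_roots_mult_gen_left'(2)[OF y(1) s y(2)] by auto
  have nj: "simple_root s \<notin> N (wjoin ?x ?y)" by (rule wjoin_avoids_gen[OF s c(1) n(1) c(2) n(2)])
  have sj: "simple_root s \<in> N ?j" using wjoin_upper1[OF x(1) y(1)] x(2) by blast
  have sj': "simple_root s \<in> N (s \<otimes> wjoin ?x ?y)" using inv_roots_mult_gen_left[OF jc(1) s nj] by simp
  have cancel: "s \<otimes> (s \<otimes> wjoin ?x ?y) = wjoin ?x ?y" using s jc by simp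
  have "N ?j \<subseteq> N (s \<otimes> wjoin ?x ?y)"
  proof (rule wjoin_least[OF x(1) y(1) jc(3)])
    show "N x \<subseteq> N (s \<otimes> wjoin ?x ?y)"
      using shift_subset[OF x jc(3) sj' s] wjoin_upper1[OF c(1,2)] cancel by simp
    show "N y \<subseteq> N (s \<otimes> wjoin ?x ?y)"
      using shift_subset[OF y jc(3) sj' s] wjoin_upper2[OF c(1,2)] cancel by simp
  qed
  then have 1: "N (s \<otimes> ?j) \<subseteq> N (wjoin ?x ?y)" using shift_subset[OF c(3) sj jc(3) sj' s] cancel by simp
  have 2: "N (wjoin ?x ?y) \<subseteq> N (s \<otimes> ?j)"
    by (rule wjoin_least[OF c(1,2) jc(2)])
      (use shift_subset[OF x c(3) sj s] shift_subset[OF y c(3) sj s] wjoin_upper1[OF x(1) y(1)] wjoin_upper2[OF x(1) y(1)] in simp_all)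
  show ?thesis by (rule inv_roots_inj[OF jc(1,2)]) (use 1 2 in blast)
qed

text \<open>If both elements are above the first letter \<open>s\<close>, or none is, the recursion applies to all three projections. If only \<open>a\<close> is
above \<open>s\<close>, then replacing \<open>b\<close> by \<open>s \<or> b\<close> does not change the join, and \<open>proj_wjoin_gen\<close> controls the effect on the
projection.\<close>

lemma proj_wjoin:
  assumes "distinct_gens as" "x \<in> carrier W" "y \<in> carrier W"
  shows "N (proj as (wjoin x y)) \<subseteq> N (wjoin (proj as x) (proj as y))"
  using assms
proof (induction "length as + card (N (wjoin x y))" arbitrary: as x y rule: less_induct)
  case less
  note g = less.prems(1) and x = less.prems(2) and y = less.prems(3)
  show ?case
  proof (cases as)
    case Nil
    have "proj [] (wjoin x y) = \<one>" using aligned_Nil proj_aligned[of "[]" "wjoin x y"] g Nil x y by simp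
    then show ?thesis using Nil by simp
  next
    case (Cons s bs)
    have g': "distinct_gens (s # bs)" using g Cons by simp
    note s = distinct_gens_hd(1)[OF g']
    have sc: "s \<in> carrier W" using s gen_closed by simp
    have both: "N (proj as (wjoin a b)) \<subseteq> N (wjoin (proj as a) (proj as b))"
      if a: "a \<in> carrier W" "simple_root s \<in> N a" and b: "b \<in> carrier W" "simple_root s \<in> N b"
        and le: "card (N (wjoin a b)) \<le> card (N (wjoin x y))" for a b
    proof -
      let ?a = "s \<otimes> a" and ?b = "s \<otimes> b" and ?j = "wjoin a b"
      have c: "?a \<in> carrier W" "?b \<in> carrier W" "?j \<in> carrier W" using sc a b by simp_all
      have sj: "simple_root s \<in> N ?j" using wjoin_upper1[OF a(1) b(1)] a(2) by blast
      note js = wjoin_shift[OF s a b]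
      have "card (N (wjoin ?a ?b)) < card (N (wjoin x y))" using card_inv_roots_shift[OF c(3) s sj] le js by simp
      then have ih: "N (proj (bs @ [s]) (wjoin ?a ?b)) \<subseteq> N (wjoin (proj (bs @ [s]) ?a) (proj (bs @ [s]) ?b))"
        using less.hyps[of "bs @ [s]" ?a ?b] distinct_gens_rotate[OF g'] c Cons by simp
      have pa: "proj (s # bs) a \<in> carrier W" "simple_root s \<in> N (proj (s # bs) a)"
        using g' a gen_le_proj[OF g' a(1) _ a(2)] by simp_all
      have pb: "proj (s # bs) b \<in> carrier W" "simple_root s \<in> N (proj (s # bs) b)"
        using g' b gen_le_proj[OF g' b(1) _ b(2)] by simp_all
      have pj: "proj (s # bs) ?j \<in> carrier W" "simple_root s \<in> N (proj (s # bs) ?j)"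
        using g' c gen_le_proj[OF g' c(3) _ sj] by simp_all
      have jc: "wjoin (proj (s # bs) a) (proj (s # bs) b) \<in> carrier W" using pa pb by simp
      have js': "simple_root s \<in> N (wjoin (proj (s # bs) a) (proj (s # bs) b))" using wjoin_upper1[OF pa(1) pb(1)] pa(2) by blast
      have "N (s \<otimes> proj (s # bs) ?j) \<subseteq> N (s \<otimes> wjoin (proj (s # bs) a) (proj (s # bs) b))"
        using ih unfolding js proj_shift[OF g' c(3) sj] proj_shift[OF g' a, symmetric] proj_shift[OF g' b, symmetric]
          wjoin_shift[OF s pa pb] .
      then show ?thesis using shift_subset[OF pj jc js' s] Cons by simp
    qed
    have mixed: "N (proj as (wjoin a b)) \<subseteq> N (wjoin (proj as a) (proj as b))"
      if a: "a \<in> carrier W" "simple_root s \<in> N a" and b: "b \<in> carrier W" "simple_root s \<notin> N b" and e: "wjoin a b = wjoin x y" for a b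
    proof -
      let ?B = "wjoin s b"
      have Bc: "?B \<in> carrier W" using sc b by simp
      have sB: "simple_root s \<in> N ?B" using wjoin_upper1[OF sc b(1)] inv_roots_gen[OF s] by simp
      have ab: "wjoin a b \<in> carrier W" "wjoin a ?B \<in> carrier W" using a b Bc by simp_all
      have sa: "N s \<subseteq> N a" using inv_roots_gen[OF s] a(2) by simp
      have jab: "N s \<subseteq> N (wjoin a b)" using sa wjoin_upper1[OF a(1) b(1)] by blast
      have "N ?B \<subseteq> N (wjoin a b)" by (rule wjoin_least[OF sc b(1) ab(1) jab wjoin_upper2[OF a(1) b(1)]])
      then have "N (wjoin a ?B) \<subseteq> N (wjoin a b)" by (rule wjoin_least[OF a(1) Bc ab(1) wjoin_upper1[OF a(1) b(1)]])
      moreover have "N (wjoin a b) \<subseteq> N (wjoin a ?B)"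
        by (rule wjoin_least[OF a(1) b(1) ab(2) wjoin_upper1[OF a(1) Bc]]) (use wjoin_upper2[OF a(1) Bc] wjoin_upper2[OF sc b(1)] in blast)
      ultimately have jj: "wjoin a ?B = wjoin a b" using inv_roots_inj[OF ab(2,1)] by blast
      have 1: "N (proj as (wjoin a b)) \<subseteq> N (wjoin (proj as a) (proj as ?B))"
        using both[OF a Bc sB] jj e by simp
      have pa: "proj as a \<in> carrier W" and pb: "proj as b \<in> carrier W" and pB: "proj as ?B \<in> carrier W"
        using g a b Bc by simp_all
      have jp: "wjoin (proj as a) (proj as b) \<in> carrier W" using pa pb by simp
      have "simple_root s \<in> N (proj as a)" using gen_le_proj[OF g' a(1) _ a(2)] Cons by simp
      then have "N s \<subseteq> N (wjoin (proj as a) (proj as b))" using inv_roots_gen[OF s] wjoin_upper1[OF pa pb] by auto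
      then have "N (wjoin s (proj as b)) \<subseteq> N (wjoin (proj as a) (proj as b))"
        by (rule wjoin_least[OF sc pb jp _ wjoin_upper2[OF pa pb]])
      then have "N (proj as ?B) \<subseteq> N (wjoin (proj as a) (proj as b))"
        using proj_wjoin_gen[OF g' b] Cons by auto
      then have "N (wjoin (proj as a) (proj as ?B)) \<subseteq> N (wjoin (proj as a) (proj as b))"
        by (rule wjoin_least[OF pa pB jp wjoin_upper1[OF pa pb]])
      then show ?thesis using 1 by blast
    qed
    consider "simple_root s \<in> N x" "simple_root s \<in> N y" | "simple_root s \<in> N x" "simple_root s \<notin> N y"
      | "simple_root s \<notin> N x" "simple_root s \<in> N y" | "simple_root s \<notin> N x" "simple_root s \<notin> N y" by blast
    then show ?thesis
    proof cases
      case 1 then show ?thesis using both[OF x _ y] by simp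
    next
      case 2 then show ?thesis using mixed[OF x _ y] by simp
    next
      case 3 then show ?thesis
        using mixed[OF y _ x] wjoin_commute[OF x y] wjoin_commute[of "proj as x" "proj as y"] g x y by simp
    next
      case 4
      have nj: "simple_root s \<notin> N (wjoin x y)" by (rule wjoin_avoids_gen[OF s x 4(1) y 4(2)])
      have "N (proj bs (wjoin x y)) \<subseteq> N (wjoin (proj bs x) (proj bs y))"
        using less.hyps[of bs x y] distinct_gens_tl[OF g'] x y Cons by simp
      then show ?thesis
        using proj_drop[OF g' x 4(1)] proj_drop[OF g' y 4(2)] proj_drop[OF g' wjoin_closed[OF x y] nj] Cons by simp
    qed
  qed
qed

end

section \<open>Sorting words\<close>

text \<open>The blocks decrease iff a letter that is skipped once is never used again. In terms of positions the condition
does not mention blocks, and therefore survives rotation of the word, which moves the dividers.\<close>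

definition shift_closed :: "nat \<Rightarrow> nat list \<Rightarrow> bool" where
  "shift_closed n ps \<longleftrightarrow> (\<forall>i\<in>set ps. n \<le> i \<longrightarrow> i - n \<in> set ps)"

lemma c_inf_add_period: "c_inf as (i + length as) = c_inf as i"
  by (simp add: c_inf_def)

lemma antimono_blocks_iff:
  assumes d: "distinct as"
  shows "antimono (sorting_block as ps) \<longleftrightarrow> shift_closed (length as) ps"
proof (cases "as = []")
  case True
  then show ?thesis by (auto simp: shift_closed_def sorting_block_def monotone_def le_Suc_eq)
next
  case False
  let ?n = "length as"
  have n: "0 < ?n" using False by simp
  show ?thesis
  proof
    assume a: "antimono (sorting_block as ps)"
    show "shift_closed ?n ps" unfolding shift_closed_def
    proof (intro ballI impI)
      fix i assume i: "i \<in> set ps" "?n \<le> i"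
      define k where "k = i div ?n - 1"
      have k: "i div ?n = Suc k" using i(2) n by (simp add: k_def div_greater_zero_iff)
      have "c_inf as i \<in> sorting_block as ps (Suc k)" using i(1) k by (auto simp: sorting_block_def)
      moreover have "sorting_block as ps (Suc k) \<subseteq> sorting_block as ps k" using antimonoD[OF a, of k "Suc k"] by simp
      ultimately obtain j where j: "j \<in> set ps" "j div ?n = k" "c_inf as i = c_inf as j"
        by (auto simp: sorting_block_def)
      have "i mod ?n = j mod ?n" using j(3) d n by (simp add: c_inf_def nth_eq_iff_index_eq)
      then have "i = j + ?n" using k j(2) div_mult_mod_eq[of i ?n] div_mult_mod_eq[of j ?n] by simp
      then show "i - ?n \<in> set ps" using j(1) by simp
    qed
  next
    assume c: "shift_closed ?n ps"
    have "sorting_block as ps (Suc k) \<subseteq> sorting_block as ps k" for k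
    proof
      fix a assume "a \<in> sorting_block as ps (Suc k)"
      then obtain i where i: "i \<in> set ps" "i div ?n = Suc k" "a = c_inf as i" by (auto simp: sorting_block_def)
      have le: "?n \<le> i" using i(2) n by (metis div_less not_less zero_neq_one Suc_not_Zero)
      then have "i - ?n \<in> set ps" using c i(1) by (simp add: shift_closed_def)
      moreover have "(i - ?n) div ?n = k" using i(2) le_div_geq[OF n le] by simp
      moreover have "c_inf as (i - ?n) = a" using c_inf_add_period[of as "i - ?n"] le i(3) by simp
      ultimately show "a \<in> sorting_block as ps k" by (auto simp: sorting_block_def)
    qed
    then show "antimono (sorting_block as ps)" by (simp add: antimono_iff_le_Suc)
  qed
qed

lemma lexord_map_strict_mono:
  assumes "strict_mono (\<psi> :: nat \<Rightarrow> nat)"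
  shows "(map \<psi> xs, map \<psi> ys) \<in> lexord {(i, j). i < j} \<longleftrightarrow> (xs, ys) \<in> lexord {(i, j). i < j}"
proof (induction xs arbitrary: ys)
  case Nil then show ?case by (cases ys) auto
next
  case (Cons x xs)
  then show ?case using assms by (cases ys) (auto simp: strict_mono_less strict_mono_eq)
qed

lemma sorted_map_strict_mono:
  "strict_mono (\<psi> :: nat \<Rightarrow> nat) \<Longrightarrow> sorted_wrt (<) (map \<psi> xs) \<longleftrightarrow> sorted_wrt (<) xs"
  by (simp add: sorted_wrt_map strict_mono_less)

lemma ex_map_of_range: "set qs \<subseteq> range \<psi> \<Longrightarrow> \<exists>rs. qs = map \<psi> rs"
proof (induction qs)
  case (Cons q qs)
  then obtain rs r where "qs = map \<psi> rs" "q = \<psi> r" by auto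
  then show ?case by (intro exI[of _ "r # rs"]) simp
qed simp

lemma ex_positions:
  assumes "us \<in> lists (set as)"
  shows "\<exists>ps. sorted_wrt (<) ps \<and> map (c_inf as) ps = us \<and> (\<forall>p\<in>set ps. N \<le> p)"
  using assms
proof (induction us arbitrary: N)
  case (Cons a us)
  then obtain k where k: "k < length as" "as ! k = a" by (auto simp: in_set_conv_nth)
  define p where "p = N * length as + k"
  have "N * 1 \<le> N * length as" using k by (intro mult_le_mono2) simp
  then have "N \<le> p" unfolding p_def by linarith
  moreover have "c_inf as p = a" using k by (auto simp: c_inf_def p_def)
  ultimately have p: "c_inf as p = a" "N \<le> p" by simp_all
  obtain ps where "sorted_wrt (<) ps" "map (c_inf as) ps = us" "\<forall>q\<in>set ps. Suc p \<le> q" using Cons by blast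
  then show ?case using p by (intro exI[of _ "p # ps"]) fastforce
qed simp

context coxeter_system
begin

text \<open>Sorting positions for an arbitrary sequence \<open>x\<close> of letters: removing the first letter of the word, or all occurrences of a letter,
then amounts to composing \<open>x\<close> with an increasing map.\<close>

definition first_subword :: "(nat \<Rightarrow> 'a) \<Rightarrow> 'a \<Rightarrow> nat list \<Rightarrow> bool" where
  "first_subword x w ps \<longleftrightarrow> sorted_wrt (<) ps \<and> reduced_word W S (map x ps) w \<and>
     (\<forall>qs. sorted_wrt (<) qs \<longrightarrow> reduced_word W S (map x qs) w \<longrightarrow> qs \<noteq> ps \<longrightarrow> (ps, qs) \<in> lexord {(i, j). i < j})"

lemma is_sorting_positions_iff: "is_sorting_positions W S as w ps \<longleftrightarrow> first_subword (c_inf as) w ps"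
  by (auto simp: is_sorting_positions_def reduced_positions_def first_subword_def)

lemma first_subword_reindex:
  assumes mono: "strict_mono \<psi>"
    and range: "\<And>qs. sorted_wrt (<) qs \<Longrightarrow> reduced_word W S (map x qs) w \<Longrightarrow> set qs \<subseteq> range \<psi>"
  shows "first_subword x w ps \<longleftrightarrow> (\<exists>rs. ps = map \<psi> rs \<and> first_subword (x \<circ> \<psi>) w rs)"
proof
  assume a: "first_subword x w ps"
  then have "set ps \<subseteq> range \<psi>" using range by (simp add: first_subword_def)
  then obtain rs where rs: "ps = map \<psi> rs" using ex_map_of_range by blast
  have "first_subword (x \<circ> \<psi>) w rs"
    unfolding first_subword_def
  proof (intro conjI allI impI)
    show "sorted_wrt (<) rs" "reduced_word W S (map (x \<circ> \<psi>) rs) w"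
      using a sorted_map_strict_mono[OF mono] unfolding first_subword_def rs by auto
    fix qs assume q: "sorted_wrt (<) qs" "reduced_word W S (map (x \<circ> \<psi>) qs) w" "qs \<noteq> rs"
    have "map \<psi> qs \<noteq> ps" using q(3) strict_mono_imp_inj_on[OF mono] by (simp add: rs inj_map_eq_map)
    then have "(ps, map \<psi> qs) \<in> lexord {(i, j). i < j}"
      using a q(1,2) sorted_map_strict_mono[OF mono] by (simp add: first_subword_def)
    then show "(rs, qs) \<in> lexord {(i, j). i < j}" unfolding rs using lexord_map_strict_mono[OF mono] by blast
  qed
  then show "\<exists>rs. ps = map \<psi> rs \<and> first_subword (x \<circ> \<psi>) w rs" using rs by blast
next
  assume "\<exists>rs. ps = map \<psi> rs \<and> first_subword (x \<circ> \<psi>) w rs"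
  then obtain rs where rs: "ps = map \<psi> rs" and a: "first_subword (x \<circ> \<psi>) w rs" by blast
  show "first_subword x w ps"
    unfolding first_subword_def
  proof (intro conjI allI impI)
    show "sorted_wrt (<) ps" "reduced_word W S (map x ps) w"
      using a sorted_map_strict_mono[OF mono] unfolding first_subword_def rs by auto
    fix qs assume q: "sorted_wrt (<) qs" "reduced_word W S (map x qs) w" "qs \<noteq> ps"
    obtain qs' where qs': "qs = map \<psi> qs'" using range[OF q(1,2)] ex_map_of_range by blast
    have "(rs, qs') \<in> lexord {(i, j). i < j}"
      using a q sorted_map_strict_mono[OF mono] unfolding first_subword_def qs' rs by auto
    then show "(ps, qs) \<in> lexord {(i, j). i < j}" unfolding rs qs' using lexord_map_strict_mono[OF mono] by blast
  qed
qed

lemma reduced_word_Cons_iff: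
  assumes w: "w \<in> carrier W" and s: "s \<in> S" and sw: "simple_root s \<in> N w"
  shows "reduced_word W S (s # us) w \<longleftrightarrow> reduced_word W S us (s \<otimes> w)"
proof -
  have sc: "s \<in> carrier W" using s gen_closed by simp
  have "len (s \<otimes> w) < len w" using simple_in_inv_roots[OF w s] sw by simp
  moreover have "len w \<le> Suc (len (s \<otimes> w))"
  proof -
    obtain ws where ws: "ws \<in> lists S" "wp ws = s \<otimes> w" "length ws = len (s \<otimes> w)"
      using ex_reduced[of "s \<otimes> w"] sc w by auto
    have "wp (s # ws) = w" using ws s w by simp
    then show ?thesis using len_wp_le[of "s # ws"] ws s by simp
  qed
  ultimately have l: "len w = Suc (len (s \<otimes> w))" by simp
  have "s \<otimes> wp us = w \<longleftrightarrow> wp us = s \<otimes> w" if "us \<in> lists S"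
    using gen_cancel_left[OF s w] gen_cancel_left[OF s wp_closed[OF that]] by metis
  then show ?thesis using s l by (auto simp: reduced_word_def)
qed

lemma reduced_word_head:
  assumes w: "w \<in> carrier W" and r: "reduced_word W S (s # us) w"
  shows "simple_root s \<in> N w"
proof -
  have us: "us \<in> lists S" "s \<in> S" "s \<otimes> wp us = w" "Suc (length us) = len w" using r by (auto simp: reduced_word_def)
  have "s \<otimes> w = wp us" using us(3) gen_cancel_left[OF us(2) wp_closed[OF us(1)]] by simp
  then have "len (s \<otimes> w) < len w" using len_wp_le[OF us(1)] us(4) by simp
  then show ?thesis using simple_in_inv_roots[OF w us(2)] by simp
qed

text \<open>Sequences that begin with position \<open>0\<close> come before all others, and by \<open>ex\<close> there is one.\<close>

lemma first_subword_use_first: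
  assumes w: "w \<in> carrier W" and s: "s \<in> S" and sw: "simple_root s \<in> N w" and x0: "x 0 = s"
    and ex: "\<exists>qs. sorted_wrt (<) qs \<and> reduced_word W S (map (x \<circ> Suc) qs) (s \<otimes> w)"
  shows "first_subword x w ps \<longleftrightarrow> (\<exists>qs. ps = 0 # map Suc qs \<and> first_subword (x \<circ> Suc) (s \<otimes> w) qs)"
proof -
  have mono: "strict_mono Suc" by (simp add: strict_mono_def)
  have ne: "qs \<noteq> []" if "reduced_word W S (map x qs) w" for qs
  proof
    assume "qs = []"
    then have "w = \<one>" using that by (simp add: reduced_word_def)
    then show False using sw by simp
  qed
  have cons: "sorted_wrt (<) (0 # map Suc qs) \<and> reduced_word W S (map x (0 # map Suc qs)) w \<longleftrightarrow>
      sorted_wrt (<) qs \<and> reduced_word W S (map (x \<circ> Suc) qs) (s \<otimes> w)" for qs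
    using reduced_word_Cons_iff[OF w s sw, of "map (x \<circ> Suc) qs"] sorted_map_strict_mono[OF mono, of qs] x0 by auto
  have start: "\<exists>qs. ps = 0 # map Suc qs" if "sorted_wrt (<) (0 # ps')" "ps = 0 # ps'" for ps ps' :: "nat list"
  proof -
    have "set ps' \<subseteq> range Suc" using that(1) by (auto simp: image_iff gr0_conv_Suc)
    then show ?thesis using ex_map_of_range that(2) by blast
  qed
  show ?thesis
  proof
    assume a: "first_subword x w ps"
    obtain q0 where q0: "sorted_wrt (<) q0" "reduced_word W S (map (x \<circ> Suc) q0) (s \<otimes> w)" using ex by blast
    have "ps = 0 # map Suc q0 \<or> (ps, 0 # map Suc q0) \<in> lexord {(i, j). i < j}"
      using a cons[of q0] q0 unfolding first_subword_def by metis
    moreover have "ps \<noteq> []" using ne a unfolding first_subword_def by blast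
    then obtain p ps' where p: "ps = p # ps'" by (cases ps) auto
    ultimately have "p = 0" by auto
    then obtain qs where qs: "ps = 0 # map Suc qs" using start[of ps' ps] p a unfolding first_subword_def by blast
    have "first_subword (x \<circ> Suc) (s \<otimes> w) qs"
      unfolding first_subword_def
    proof (intro conjI allI impI)
      show "sorted_wrt (<) qs" "reduced_word W S (map (x \<circ> Suc) qs) (s \<otimes> w)"
        using a cons[of qs] unfolding first_subword_def qs by blast+
      fix q assume q: "sorted_wrt (<) q" "reduced_word W S (map (x \<circ> Suc) q) (s \<otimes> w)" "q \<noteq> qs"
      have "0 # map Suc q \<noteq> ps" using q(3) by (simp add: qs inj_map_eq_map)
      then have "(ps, 0 # map Suc q) \<in> lexord {(i, j). i < j}" using a cons[of q] q(1,2) unfolding first_subword_def by blast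
      then show "(qs, q) \<in> lexord {(i, j). i < j}" unfolding qs using lexord_map_strict_mono[OF mono] by auto
    qed
    then show "\<exists>qs. ps = 0 # map Suc qs \<and> first_subword (x \<circ> Suc) (s \<otimes> w) qs" using qs by blast
  next
    assume "\<exists>qs. ps = 0 # map Suc qs \<and> first_subword (x \<circ> Suc) (s \<otimes> w) qs"
    then obtain qs where qs: "ps = 0 # map Suc qs" and a: "first_subword (x \<circ> Suc) (s \<otimes> w) qs" by blast
    show "first_subword x w ps"
      unfolding first_subword_def
    proof (intro conjI allI impI)
      show "sorted_wrt (<) ps" "reduced_word W S (map x ps) w"
        using a cons[of qs] unfolding first_subword_def qs by blast+
      fix q assume q: "sorted_wrt (<) q" "reduced_word W S (map x q) w" "q \<noteq> ps"
      have "q \<noteq> []" using ne q(2) by blast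
      then obtain p q' where p: "q = p # q'" by (cases q) auto
      show "(ps, q) \<in> lexord {(i, j). i < j}"
      proof (cases "p = 0")
        case False then show ?thesis using p qs by simp
      next
        case True
        then obtain q'' where q'': "q = 0 # map Suc q''" using start[of q' q] p q(1) by blast
        have "q'' \<noteq> qs" using q(3) q'' qs by auto
        then have "(qs, q'') \<in> lexord {(i, j). i < j}" using a cons[of q''] q(1,2) unfolding first_subword_def q'' by blast
        then show ?thesis unfolding qs q'' using lexord_map_strict_mono[OF mono] by auto
      qed
    qed
  qed
qed

lemma c_inf_Cons_0: "c_inf (s # bs) 0 = s"
  by (simp add: c_inf_def)

lemma c_inf_Cons_Suc: "c_inf (s # bs) \<circ> Suc = c_inf (bs @ [s])"
proof
  fix i
  let ?j = "i mod Suc (length bs)"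
  have "?j < Suc (length bs)" by simp
  then have "?j < length bs \<or> ?j = length bs" by linarith
  then show "(c_inf (s # bs) \<circ> Suc) i = c_inf (bs @ [s]) i"
    by (auto simp: c_inf_def mod_Suc nth_append)
qed

definition word_sortable :: "'a list \<Rightarrow> 'a \<Rightarrow> bool" where
  "word_sortable as w \<longleftrightarrow> (\<exists>ps. first_subword (c_inf as) w ps \<and> shift_closed (length as) ps)"

definition generated_by :: "'a list \<Rightarrow> 'a \<Rightarrow> bool" where
  "generated_by as w \<longleftrightarrow> (\<exists>ws \<in> lists (set as). wp ws = w)"

lemma generated_by_closed:
  assumes "generated_by as w" "set as \<subseteq> S"
  shows "w \<in> carrier W"
proof -
  obtain ws where ws: "ws \<in> lists (set as)" "wp ws = w" using assms(1) unfolding generated_by_def ..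
  have "ws \<in> lists S" by (rule subsetD[OF lists_mono[OF assms(2)] ws(1)])
  then show ?thesis using wp_closed[of ws] ws(2) by simp
qed

lemma word_sortable_one: "word_sortable as \<one>"
proof -
  have "first_subword (c_inf as) \<one> []"
    by (simp add: first_subword_def reduced_word_def)
  then show ?thesis unfolding word_sortable_def shift_closed_def by (intro exI[of _ "[]"]) simp
qed

lemma reduced_generated_by:
  assumes sub: "set as \<subseteq> S" and sp: "generated_by as w" and r: "reduced_word W S us w"
  shows "us \<in> lists (set as)"
proof (rule reduced_letters)
  obtain ws where ws: "ws \<in> lists (set as)" "wp ws = w" using sp unfolding generated_by_def ..
  show "us \<in> lists S" "len (wp us) = length us" using r by (simp_all add: reduced_word_def)
  fix f assume "f \<in> N (wp us)"
  then have "f \<in> N (wp ws)" using r ws(2) by (simp add: reduced_word_def)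
  then show "supp_in (set as) f" by (rule inv_roots_word_supp[OF ws(1) sub])
qed

lemma aligned_generated_by:
  assumes "aligned as w"
  shows "generated_by as w"
proof -
  have w: "w \<in> carrier W" using aligned_closed[OF assms] .
  obtain ws where ws: "ws \<in> lists S" "wp ws = w" "length ws = len w" using ex_reduced[OF w] .
  have "ws \<in> lists (set as)" by (rule reduced_letters[OF _ ws(1)]) (use ws aligned_supp[OF assms] in simp_all)
  then show ?thesis unfolding generated_by_def using ws(2) by (intro bexI[of _ ws])
qed

lemma generated_by_shift:
  assumes "generated_by as w" "s \<in> set as"
  shows "generated_by as (s \<otimes> w)"
proof -
  obtain ws where "ws \<in> lists (set as)" "wp ws = w" using assms by (auto simp: generated_by_def)
  then show ?thesis using assms(2) unfolding generated_by_def by (intro bexI[of _ "s # ws"]) auto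
qed

lemma ex_subword:
  assumes sub: "set as \<subseteq> S" and sp: "generated_by as w"
  shows "\<exists>qs. sorted_wrt (<) qs \<and> reduced_word W S (map (c_inf as) qs) w"
proof -
  have w: "w \<in> carrier W" using generated_by_closed[OF sp sub] .
  obtain ws where ws: "ws \<in> lists S" "wp ws = w" "length ws = len w" using ex_reduced[OF w] .
  then have r: "reduced_word W S ws w" by (simp add: reduced_word_def)
  from ex_positions[OF reduced_generated_by[OF sub sp r], of 0]
  obtain ps where "sorted_wrt (<) ps" "map (c_inf as) ps = ws" by blast
  then show ?thesis using r by (intro exI[of _ ps]) simp
qed

lemma word_sortable_use_first:
  assumes g: "distinct_gens (s # bs)" and sp: "generated_by (s # bs) w" and sw: "simple_root s \<in> N w"
  shows "word_sortable (s # bs) w \<longleftrightarrow> word_sortable (bs @ [s]) (s \<otimes> w)"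
proof -
  note s = distinct_gens_hd(1)[OF g]
  have w: "w \<in> carrier W" using generated_by_closed[OF sp] distinct_gensD(2)[OF g] by blast
  have "generated_by (bs @ [s]) (s \<otimes> w)" using generated_by_shift[OF sp] by (simp add: generated_by_def)
  from ex_subword[OF distinct_gensD(2)[OF distinct_gens_rotate[OF g]] this]
  have ex: "\<exists>qs. sorted_wrt (<) qs \<and> reduced_word W S (map (c_inf (s # bs) \<circ> Suc) qs) (s \<otimes> w)"
    unfolding c_inf_Cons_Suc .
  \<comment> \<open>The shift of position \<open>n + 1\<close> is position \<open>0\<close>, which is always present, so it imposes no condition.\<close>
  have cl: "shift_closed (Suc n) (0 # map Suc qs) \<longleftrightarrow> shift_closed (Suc n) qs" for n qs
  proof
    assume a: "shift_closed (Suc n) (0 # map Suc qs)"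
    show "shift_closed (Suc n) qs" unfolding shift_closed_def
    proof (intro ballI impI)
      fix i assume i: "i \<in> set qs" "Suc n \<le> i"
      then have "Suc i - Suc n \<in> set (0 # map Suc qs)" using a unfolding shift_closed_def by force
      moreover have "Suc i - Suc n = Suc (i - Suc n)" using i(2) by simp
      ultimately show "i - Suc n \<in> set qs" by auto
    qed
  next
    assume a: "shift_closed (Suc n) qs"
    show "shift_closed (Suc n) (0 # map Suc qs)" unfolding shift_closed_def
    proof (intro ballI impI)
      fix i assume i: "i \<in> set (0 # map Suc qs)" "Suc n \<le> i"
      then obtain j where j: "i = Suc j" "j \<in> set qs" by auto
      show "i - Suc n \<in> set (0 # map Suc qs)"
      proof (cases "j = n")
        case False
        then have "j - Suc n \<in> set qs" using a i j by (auto simp: shift_closed_def)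
        moreover have "i - Suc n = Suc (j - Suc n)" using i j False by simp
        ultimately show ?thesis by simp
      qed (use j in simp)
    qed
  qed
  show ?thesis
    unfolding word_sortable_def
    using first_subword_use_first[OF w s sw c_inf_Cons_0 ex] cl[of "length bs"] unfolding c_inf_Cons_Suc by auto
qed

text \<open>The positions of the letters of \<open>bs\<close> in the periodic word of \<open>s # bs\<close>, where \<open>b\<close> is the length of \<open>bs\<close>.\<close>

definition reindex :: "nat \<Rightarrow> nat \<Rightarrow> nat" where
  "reindex b i = (i div b) * Suc b + Suc (i mod b)"

lemma reindex_add: "0 < b \<Longrightarrow> reindex b (i + b) = reindex b i + Suc b"
  by (simp add: reindex_def)

lemma reindex_div_mod:
  assumes "0 < b"
  shows "reindex b i div Suc b = i div b" "reindex b i mod Suc b = Suc (i mod b)"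
proof -
  have l: "Suc (i mod b) < Suc b" using assms by simp
  show "reindex b i div Suc b = i div b"
    unfolding reindex_def using l by (subst div_mult_self3) auto
  show "reindex b i mod Suc b = Suc (i mod b)"
    unfolding reindex_def using l by (subst mod_mult_self3) auto
qed

lemma strict_mono_reindex:
  assumes b: "0 < b"
  shows "strict_mono (reindex b)"
  unfolding strict_mono_Suc_iff
proof
  fix i
  show "reindex b i < reindex b (Suc i)"
  proof (cases "Suc (i mod b) = b")
    case True
    then have "Suc i mod b = 0" "Suc i div b = Suc (i div b)" by (simp_all add: mod_Suc div_Suc)
    then show ?thesis using True by (simp add: reindex_def)
  next
    case False
    then have "Suc i mod b = Suc (i mod b)" "Suc i div b = i div b" by (simp_all add: mod_Suc div_Suc)
    then show ?thesis by (simp add: reindex_def)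
  qed
qed

lemma range_reindex:
  assumes b: "0 < b"
  shows "p \<in> range (reindex b) \<longleftrightarrow> p mod Suc b \<noteq> 0"
proof
  assume "p \<in> range (reindex b)" then show "p mod Suc b \<noteq> 0" using reindex_div_mod[OF b] by auto
next
  assume p: "p mod Suc b \<noteq> 0"
  define r where "r = p mod Suc b - 1"
  have r: "p mod Suc b = Suc r" using p by (simp add: r_def)
  then have rb: "r < b" using mod_less_divisor[of "Suc b" p] by simp
  define i where "i = p div Suc b * b + r"
  have "i div b = p div Suc b" "i mod b = r" using rb b by (simp_all add: i_def)
  then have "reindex b i = p" unfolding reindex_def using r div_mult_mod_eq[of p "Suc b"] by simp
  then show "p \<in> range (reindex b)" by blast
qed

lemma c_inf_reindex: "bs \<noteq> [] \<Longrightarrow> c_inf (s # bs) \<circ> reindex (length bs) = c_inf bs"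
  using reindex_div_mod(2)[of "length bs"] by (auto simp: c_inf_def fun_eq_iff)

lemma c_inf_in_tail:
  assumes "distinct_gens (s # bs)"
  shows "c_inf (s # bs) p \<in> set bs \<longleftrightarrow> p mod Suc (length bs) \<noteq> 0"
proof (cases "p mod Suc (length bs)")
  case 0 then show ?thesis using distinct_gens_hd(2)[OF assms] by (simp add: c_inf_def)
next
  case (Suc r)
  then have "r < length bs" using mod_less_divisor[of "Suc (length bs)" p] by simp
  then show ?thesis using Suc by (simp add: c_inf_def)
qed

text \<open>As \<open>s\<close> is no initial letter of \<open>w\<close>, position \<open>0\<close> is not used, and closure under shifts excludes all other
positions of \<open>s\<close>. The exception \<open>w = \<one>\<close> avoids an empty \<open>bs\<close>, whose periodic word is meaningless.\<close>

lemma word_sortable_skip_first: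
  assumes g: "distinct_gens (s # bs)" and w: "w \<in> carrier W" "w \<noteq> \<one>" and n: "simple_root s \<notin> N w"
  shows "word_sortable (s # bs) w \<longleftrightarrow> generated_by bs w \<and> word_sortable bs w"
proof -
  let ?b = "length bs"
  have tl: "set bs \<subseteq> S" using distinct_gensD(2)[OF distinct_gens_tl[OF g]] .
  have key: "word_sortable (s # bs) w \<longleftrightarrow> word_sortable bs w" if sp: "generated_by bs w"
  proof -
    have bs: "bs \<noteq> []" using sp w(2) by (auto simp: generated_by_def)
    then have b: "0 < ?b" by simp
    have rng: "set qs \<subseteq> range (reindex ?b)"
      if "reduced_word W S (map (c_inf (s # bs)) qs) w" for qs
    proof
      fix p assume p: "p \<in> set qs"
      have "map (c_inf (s # bs)) qs \<in> lists (set bs)" by (rule reduced_generated_by[OF tl sp that])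
      then have "c_inf (s # bs) p \<in> set bs" using p by auto
      then show "p \<in> range (reindex ?b)" unfolding range_reindex[OF b] c_inf_in_tail[OF g] .
    qed
    have cl: "shift_closed (Suc ?b) (map (reindex ?b) rs) \<longleftrightarrow> shift_closed ?b rs" for rs
    proof -
      have 1: "Suc ?b \<le> reindex ?b i \<longleftrightarrow> ?b \<le> i" for i
      proof (cases "?b \<le> i")
        case True then show ?thesis using reindex_add[OF b, of "i - ?b"] by simp
      next
        case False then show ?thesis by (simp add: reindex_def)
      qed
      have 2: "reindex ?b i - Suc ?b = reindex ?b (i - ?b)" if "?b \<le> i" for i
        using reindex_add[OF b, of "i - ?b"] that by simp
      have inj: "inj (reindex ?b)" by (rule strict_mono_imp_inj_on[OF strict_mono_reindex[OF b]])
      show ?thesis using 1 2 by (auto simp: shift_closed_def inj_image_mem_iff[OF inj])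
    qed
    show ?thesis
      unfolding word_sortable_def
      using first_subword_reindex[OF strict_mono_reindex[OF b], of "c_inf (s # bs)" w] rng cl
      unfolding c_inf_reindex[OF bs] by auto
  qed
  moreover have "generated_by bs w" if so: "word_sortable (s # bs) w"
  proof -
    obtain ps where ps: "first_subword (c_inf (s # bs)) w ps" "shift_closed (Suc ?b) ps"
      using so by (auto simp: word_sortable_def)
    have r: "reduced_word W S (map (c_inf (s # bs)) ps) w" and srt: "sorted_wrt (<) ps"
      using ps(1) by (auto simp: first_subword_def)
    have zero: "0 \<notin> set ps"
    proof
      assume z: "0 \<in> set ps"
      then obtain p ps' where p: "ps = p # ps'" by (cases ps) auto
      have "p = 0" using z srt p by auto
      then have "reduced_word W S (s # map (c_inf (s # bs)) ps') w" using r p by (simp add: c_inf_Cons_0)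
      then show False using reduced_word_head[OF w(1)] n by blast
    qed
    have mult: "k * Suc ?b \<notin> set ps" for k
    proof (induction k)
      case (Suc k)
      then show ?case using ps(2) unfolding shift_closed_def by force
    qed (use zero in simp)
    have "c_inf (s # bs) p \<in> set bs" if "p \<in> set ps" for p
    proof -
      have "p mod Suc ?b \<noteq> 0"
      proof
        assume "p mod Suc ?b = 0"
        then have "p = p div Suc ?b * Suc ?b" using div_mult_mod_eq[of p "Suc ?b"] by simp
        then show False using mult that by metis
      qed
      then show ?thesis using c_inf_in_tail[OF g] by simp
    qed
    then have "map (c_inf (s # bs)) ps \<in> lists (set bs)" by auto
    then show ?thesis using r unfolding generated_by_def reduced_word_def by blast
  qed
  ultimately show ?thesis by blast
qed

end

context finite_coxeter_system
begin

text \<open>Both sides satisfy the same recursion on the first letter.\<close>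

lemma word_sortable_iff_aligned:
  assumes "distinct_gens as" "generated_by as w"
  shows "word_sortable as w \<longleftrightarrow> aligned as w"
  using assms
proof (induction "length as + card (N w)" arbitrary: as w rule: less_induct)
  case less
  note g = less.prems(1) and sp = less.prems(2)
  have w: "w \<in> carrier W" by (rule generated_by_closed[OF sp distinct_gensD(2)[OF g]])
  show ?case
  proof (cases "w = \<one>")
    case True then show ?thesis using word_sortable_one aligned_one by simp
  next
    case ne: False
    then obtain s bs where as: "as = s # bs" using sp by (cases as) (auto simp: generated_by_def)
    have g': "distinct_gens (s # bs)" using g as by simp
    note s = distinct_gens_hd(1)[OF g']
    show ?thesis
    proof (cases "simple_root s \<in> N w")
      case True
      have m: "length (bs @ [s]) + card (N (s \<otimes> w)) < length as + card (N w)"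
        using card_inv_roots_shift[OF w s True] as by simp
      have "generated_by (bs @ [s]) (s \<otimes> w)" using generated_by_shift[OF sp] as by (simp add: generated_by_def)
      from less.hyps[OF m distinct_gens_rotate[OF g'] this]
      show ?thesis using word_sortable_use_first[OF g' _ True] sp as aligned_shift[OF distinct_gensD[OF g'] True w] by simp
    next
      case False
      have m: "length bs + card (N w) < length as + card (N w)" using as by simp
      have "generated_by bs w \<Longrightarrow> word_sortable bs w \<longleftrightarrow> aligned bs w" by (rule less.hyps[OF m distinct_gens_tl[OF g']])
      then show ?thesis
        using word_sortable_skip_first[OF g' w ne False] aligned_drop_first[OF distinct_gensD[OF g'] False] aligned_generated_by[of bs w] as by blast
    qed
  qed
qed

end

context coxeter_system
begin

section \<open>Independence of the word for the Coxeter element\<close>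

text \<open>Each letter of the word acts on its coordinate once, while this coordinate is still zero, and adds at least the contribution of
\<open>\<alpha>\<^sub>s\<close>.\<close>

lemma distinct_word_act_coeffs:
  assumes "distinct us" "set us \<subseteq> S" "s \<in> S" "s \<notin> set us"
  shows "supp_in (insert s (set us)) (word_act us (simple_root s)) \<and> nonneg (word_act us (simple_root s)) \<and>
    word_act us (simple_root s) s = 1 \<and> (\<forall>i\<in>set us. - cartan i s \<le> word_act us (simple_root s) i)"
  using assms
proof (induction us)
  case Nil then show ?case by (auto simp: supp_in_def nonneg_def simple_root_apply)
next
  case (Cons p us)
  let ?x = "word_act us (simple_root s)"
  have ih: "supp_in (insert s (set us)) ?x" "nonneg ?x" "?x s = 1" "\<And>i. i \<in> set us \<Longrightarrow> - cartan i s \<le> ?x i"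
    using Cons by auto
  have p: "p \<in> S" "p \<noteq> s" "p \<notin> set us" using Cons.prems by auto
  have xp: "?x p = 0" using supp_inD[OF ih(1)] p by simp
  have "pairing p ?x = 2 * ?x p + cartan_row p (s # us) ?x"
    by (rule pairing_cartan_row) (use Cons.prems ih(1) in \<open>auto simp: supp_in_def\<close>)
  also have "\<dots> = cartan p s + cartan_row p us ?x" using xp ih(3) by (simp add: cartan_row_def)
  also have "\<dots> \<le> cartan p s" using cartan_row_nonpos[of us p ?x] Cons.prems ih(2) p by simp
  finally have pr: "pairing p ?x \<le> cartan p s" .
  have up: "word_act (p # us) (simple_root s) = ?x(p := - pairing p ?x)" using xp by (simp add: reflect_def)
  have "cartan p s \<le> 0" using cartan_nonpos p Cons.prems by simp
  then show ?case unfolding up using ih pr p by (auto simp: supp_in_def nonneg_def)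
qed

text \<open>Compare the coefficient of \<open>\<alpha>\<^sub>s\<close> in \<open>c\<inverse> \<alpha>\<^sub>s\<close>. It is \<open>-1\<close> for a word that begins with \<open>s\<close>; for the other word each letter before \<open>s\<close>
that does not commute with \<open>s\<close> raises it.\<close>

lemma first_letter_commutes:
  assumes g: "distinct_gens (s # bs)" and g': "distinct_gens (pre @ s # post)" and eq: "wp (s # bs) = wp (pre @ s # post)"
    and i: "i \<in> set pre"
  shows "cartan s i = 0"
proof -
  have s: "s \<in> S" "s \<notin> set bs" using distinct_gens_hd[OF g] by auto
  have sub: "set bs \<subseteq> S" "set pre \<subseteq> S" "set post \<subseteq> S" and d: "distinct pre" "s \<notin> set pre" "s \<notin> set post"
    using g g' by (auto simp: distinct_gens_def)
  have L: "s # bs \<in> lists S" "pre @ s # post \<in> lists S" "rev (s # bs) \<in> lists S" "rev (pre @ s # post) \<in> lists S"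
    using s sub by auto
  let ?x = "word_act (rev pre) (simple_root s)"
  have x: "supp_in (insert s (set pre)) ?x" "nonneg ?x" "?x s = 1" "\<And>i. i \<in> set pre \<Longrightarrow> - cartan i s \<le> ?x i"
    using distinct_word_act_coeffs[of "rev pre" s] sub d s by auto
  have "wp (rev (s # bs)) = wp (rev (pre @ s # post))" using eq wp_rev[OF L(1)] wp_rev[OF L(2)] by simp
  then have wa: "word_act (rev (s # bs)) = word_act (rev (pre @ s # post))" by (rule word_act_eq[OF L(3,4)])
  have "word_act (rev (s # bs)) (simple_root s) s = - 1"
  proof -
    have "word_act (rev (s # bs)) (simple_root s) s = word_act (rev bs) (- simple_root s) s"
      using s by (simp add: word_act_append reflect_simple)
    also have "\<dots> = (- simple_root s) s" by (rule word_act_outside[of _ "set bs"]) (use s in auto)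
    finally show ?thesis by (simp add: simple_root_apply)
  qed
  moreover have "word_act (rev (pre @ s # post)) (simple_root s) s = 1 - pairing s ?x"
  proof -
    have "word_act (rev (pre @ s # post)) (simple_root s) s = word_act (rev post) (reflect s ?x) s"
      by (simp add: word_act_append)
    also have "\<dots> = reflect s ?x s" by (rule word_act_outside[of _ "set post"]) (use d in auto)
    finally show ?thesis using x(3) by (simp add: reflect_def)
  qed
  moreover have "pairing s ?x = 2 * ?x s + cartan_row s pre ?x"
    by (rule pairing_cartan_row) (use d s sub x(1) in auto)
  ultimately have row0: "cartan_row s pre ?x = 0" using wa x(3) by simp
  have terms: "cartan s j * ?x j \<le> 0" if "j \<in> set pre" for j
    using cartan_nonpos[of s j] x(2) that s sub d by (intro mult_nonpos_nonneg) (auto simp: nonneg_def)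
  have "(\<Sum>j\<in>set pre. cartan s j * ?x j) = 0"
    using row0 d(1) by (simp add: cartan_row_def sum_list_distinct_conv_sum_set)
  then have "cartan s i * ?x i = 0"
    using sum_nonneg_eq_0_iff[of "set pre" "\<lambda>j. - (cartan s j * ?x j)"] terms i by (simp add: sum_negf)
  moreover have "- cartan s i \<le> ?x i" using x(4)[OF i] cartan_sym[of s i] s i sub by auto
  moreover have "cartan s i \<le> 0" using cartan_nonpos[of s i] s i sub d by auto
  ultimately show ?thesis by auto
qed

lemma gens_commute:
  assumes "s \<in> S" "i \<in> S" "cartan s i = 0"
  shows "s \<otimes> i = i \<otimes> s"
proof -
  have "act s (simple_root i) = act \<one> (simple_root i)" using assms by (simp add: reflect_def)
  then have "s \<otimes> i \<otimes> inv s = \<one> \<otimes> i \<otimes> inv \<one>"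
    using conj_eq_iff[of s i \<one> i] assms gen_closed by simp
  then have "s \<otimes> i \<otimes> s = i" using assms gen_closed by simp
  then have "s \<otimes> i \<otimes> s \<otimes> s = i \<otimes> s" by simp
  then show ?thesis using assms gen_closed by simp
qed

lemma wp_move_front:
  assumes "s \<in> S" "pre \<in> lists S" "post \<in> lists S" "\<And>i. i \<in> set pre \<Longrightarrow> cartan s i = 0"
  shows "wp (pre @ s # post) = s \<otimes> wp (pre @ post)"
  using assms
proof (induction pre)
  case (Cons p pre)
  have p: "p \<in> S" "s \<otimes> p = p \<otimes> s" using Cons.prems gens_commute by auto
  have c: "wp (pre @ post) \<in> carrier W" using Cons.prems by (intro wp_closed) auto
  have "wp ((p # pre) @ s # post) = p \<otimes> (s \<otimes> wp (pre @ post))" using Cons by simp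
  also have "\<dots> = s \<otimes> (p \<otimes> wp (pre @ post))" using p c Cons.prems gen_closed by (simp flip: m_assoc)
  finally show ?case by simp
qed simp

lemma euler_move_front:
  assumes "s \<in> S" "set pre \<subseteq> S" "\<And>i. i \<in> set pre \<Longrightarrow> cartan s i = 0"
  shows "euler (pre @ s # post) f g = euler (s # pre @ post) f g"
  using assms
proof (induction pre)
  case (Cons p pre)
  have "cartan s p = 0" "cartan p s = 0" using Cons.prems cartan_sym[of p s] by auto
  moreover have "cartan_row p (pre @ s # post) g = cartan_row p (pre @ post) g + cartan p s * g s"
    "cartan_row s (p # pre @ post) g = cartan s p * g p + cartan_row s (pre @ post) g"
    by (simp_all add: cartan_row_def)
  ultimately show ?case using Cons by simp
qed simp

text \<open>The first letter of one word can be moved to the front of the other by commutations, which affect neither the product nor the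
Euler form.\<close>

lemma euler_depends_on_product:
  assumes "distinct_gens as" "distinct_gens as'" "set as = set as'" "wp as = wp as'"
  shows "euler as = euler as'"
  using assms
proof (induction as arbitrary: as')
  case (Cons s bs)
  then obtain pre post where as': "as' = pre @ s # post" using split_list[of s as'] by auto
  have g': "distinct_gens (pre @ s # post)" using Cons.prems as' by simp
  have comm: "cartan s i = 0" if "i \<in> set pre" for i
    using first_letter_commutes[OF Cons.prems(1) g' _ that] Cons.prems(4) as' by simp
  have s: "s \<in> S" using distinct_gens_hd(1)[OF Cons.prems(1)] .
  have L: "pre \<in> lists S" "post \<in> lists S" "bs \<in> lists S" "pre @ post \<in> lists S"
    using distinct_gensD(2)[OF g'] distinct_gensD(2)[OF Cons.prems(1)] by auto
  have "s \<otimes> wp bs = s \<otimes> wp (pre @ post)"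
    using Cons.prems(4) wp_move_front[OF s L(1,2) comm] as' by simp
  then have "wp bs = wp (pre @ post)" using gen_cancel_left[OF s wp_closed[OF L(3)]] gen_cancel_left[OF s wp_closed[OF L(4)]] by metis
  moreover have gp: "distinct_gens (pre @ post)" using g' by (auto simp: distinct_gens_def)
  moreover have se: "set bs = set (pre @ post)"
    using Cons.prems(3) as' distinct_gens_hd(2)[OF Cons.prems(1)] g' by (auto simp: distinct_gens_def)
  ultimately have ih: "euler bs = euler (pre @ post)" using Cons.IH distinct_gens_tl[OF Cons.prems(1)] by blast
  have "cartan_row s bs g = cartan_row s (pre @ post) g" for g
    using distinct_gensD(1)[OF distinct_gens_tl[OF Cons.prems(1)]] distinct_gensD(1)[OF gp] se
    by (simp only: cartan_row_def sum_list_distinct_conv_sum_set)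
  then have "euler (s # bs) f g = euler (s # pre @ post) f g" for f g using ih by simp
  then show ?case unfolding as' using euler_move_front[OF s _ comm] distinct_gensD(2)[OF g'] by (auto simp: fun_eq_iff)
qed auto

end

context finite_coxeter_system
begin

lemma coxeter_word_distinct_gens: "coxeter_word W S c as \<Longrightarrow> distinct_gens as"
  using card_distinct[of as] by (simp add: coxeter_word_def distinct_gens_def)

text \<open>Sortability admits every word for \<open>c\<close>, whereas alignment depends on the word through its letters and its Euler form alone.\<close>

lemma c_sortable_iff_aligned:
  assumes c: "coxeter_word W S c as"
  shows "c_sortable W S c w \<longleftrightarrow> aligned as w"
proof -
  have main: "(\<exists>ps. is_sorting_positions W S bs w ps \<and> antimono (sorting_block bs ps)) \<longleftrightarrow> aligned as w"
    if bs: "coxeter_word W S c bs" and w: "w \<in> carrier W" for bs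
  proof -
    have g: "distinct_gens bs" "distinct_gens as" using coxeter_word_distinct_gens bs c by auto
    have se: "set bs = S" "set as = S" using bs c by (auto simp: coxeter_word_def)
    have "euler bs = euler as"
      by (rule euler_depends_on_product[OF g]) (use bs c in \<open>auto simp: coxeter_word_def\<close>)
    then have "aligned bs w \<longleftrightarrow> aligned as w" by (simp add: aligned_def skew_def se)
    moreover have "generated_by bs w" using ex_word[OF w] se by (simp add: generated_by_def)
    ultimately show ?thesis
      using word_sortable_iff_aligned[OF g(1), of w] antimono_blocks_iff[OF distinct_gensD(1)[OF g(1)]]
      by (simp add: word_sortable_def is_sorting_positions_iff)
  qed
  show ?thesis
  proof
    assume "c_sortable W S c w"
    then show "aligned as w" using main unfolding c_sortable_def by blast
  next
    assume a: "aligned as w"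
    then show "c_sortable W S c w" using main[OF c aligned_closed[OF a]] aligned_closed[OF a] c unfolding c_sortable_def by blast
  qed
qed

end

section \<open>Congruences from interior operators\<close>

text \<open>The converse of the last inequality holds by monotonicity, so \<open>p\<close> preserves joins. It need not preserve meets,
and the meet in \<open>K\<close> is \<open>p (x \<sqinter> y)\<close>.\<close>

locale interior_operator = lattice L for L (structure) +
  fixes K :: "'a set" and p :: "'a \<Rightarrow> 'a"
  assumes K_sub: "K \<subseteq> carrier L"
    and p_in: "x \<in> carrier L \<Longrightarrow> p x \<in> K"
    and p_le: "x \<in> carrier L \<Longrightarrow> p x \<sqsubseteq> x"
    and p_greatest: "\<lbrakk>x \<in> carrier L; k \<in> K; k \<sqsubseteq> x\<rbrakk> \<Longrightarrow> k \<sqsubseteq> p x"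
    and p_join_le: "\<lbrakk>x \<in> carrier L; y \<in> carrier L\<rbrakk> \<Longrightarrow> p (x \<squnion> y) \<sqsubseteq> p x \<squnion> p y"
begin

definition same_image :: "('a \<times> 'a) set" where
  "same_image = {(x, y). x \<in> carrier L \<and> y \<in> carrier L \<and> p x = p y}"

lemma p_closed [simp]: "x \<in> carrier L \<Longrightarrow> p x \<in> carrier L"
  using p_in K_sub by blast

lemma K_closed: "k \<in> K \<Longrightarrow> k \<in> carrier L"
  using K_sub by blast

lemma p_fixed: "k \<in> K \<Longrightarrow> p k = k"
  using p_le p_greatest[of k k] K_closed by (intro le_antisym) auto

lemma p_idem: "x \<in> carrier L \<Longrightarrow> p (p x) = p x"
  using p_fixed p_in by blast

lemma p_mono:
  assumes "x \<in> carrier L" "y \<in> carrier L" "x \<sqsubseteq> y"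
  shows "p x \<sqsubseteq> p y"
  by (rule p_greatest[OF assms(2) p_in[OF assms(1)]]) (rule le_trans[OF p_le[OF assms(1)] assms(3)], use assms in simp_all)

lemma p_join:
  assumes x: "x \<in> carrier L" and y: "y \<in> carrier L"
  shows "p (x \<squnion> y) = p x \<squnion> p y"
proof (rule le_antisym)
  show "p x \<squnion> p y \<sqsubseteq> p (x \<squnion> y)"
    by (rule join_le) (use x y p_mono join_left join_right in auto)
qed (use x y p_join_le in auto)

text \<open>This makes the kernel of \<open>p\<close> compatible with meets for every interior operator.\<close>

lemma p_meet:
  assumes x: "x \<in> carrier L" and y: "y \<in> carrier L"
  shows "p (x \<sqinter> y) = p (p x \<sqinter> p y)"
proof (rule le_antisym)
  have c: "x \<sqinter> y \<in> carrier L" "p x \<sqinter> p y \<in> carrier L" using x y by auto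
  have "p (x \<sqinter> y) \<sqsubseteq> p x \<sqinter> p y"
    by (rule meet_le) (use x y c p_mono meet_left meet_right in auto)
  then show "p (x \<sqinter> y) \<sqsubseteq> p (p x \<sqinter> p y)" using p_greatest[OF c(2) p_in[OF c(1)]] by simp
  have "p x \<sqinter> p y \<sqsubseteq> x \<sqinter> y"
  proof (rule meet_le)
    show "p x \<sqinter> p y \<sqsubseteq> x" by (rule le_trans[OF meet_left p_le]) (use x y c in auto)
    show "p x \<sqinter> p y \<sqsubseteq> y" by (rule le_trans[OF meet_right p_le]) (use x y c in auto)
  qed (use x y c in auto)
  then show "p (p x \<sqinter> p y) \<sqsubseteq> p (x \<sqinter> y)" using p_mono c by simp
qed (use x y in auto)

lemma same_image_congruence: "lattice_congruence L same_image"
proof (unfold_locales)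
  show "equiv (carrier L) same_image"
    by (rule equivI) (auto simp: same_image_def refl_on_def sym_def trans_def)
next
  fix a1 b1 a2 b2 assume "(a1, b1) \<in> same_image" "(a2, b2) \<in> same_image"
  then have a: "a1 \<in> carrier L" "b1 \<in> carrier L" "a2 \<in> carrier L" "b2 \<in> carrier L" "p a1 = p b1" "p a2 = p b2"
    by (auto simp: same_image_def)
  show "(a1 \<sqinter> a2, b1 \<sqinter> b2) \<in> same_image"
    using a p_meet[of a1 a2] p_meet[of b1 b2] by (simp add: same_image_def)
  show "(a1 \<squnion> a2, b1 \<squnion> b2) \<in> same_image"
    using a p_join[of a1 a2] p_join[of b1 b2] by (simp add: same_image_def)
qed

lemma minimal_in_class:
  assumes a: "a \<in> carrier L"
  shows "minimal_in L (same_image `` {a}) y \<longleftrightarrow> y = p a"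
proof
  assume m: "minimal_in L (same_image `` {a}) y"
  then have y: "y \<in> carrier L" "p a = p y" by (auto simp: minimal_in_def same_image_def)
  have "p y \<in> same_image `` {a}" using a y p_idem by (simp add: same_image_def)
  then have "p y = y" using m p_le[OF y(1)] by (auto simp: minimal_in_def)
  then show "y = p a" using y by simp
next
  assume y: "y = p a"
  show "minimal_in L (same_image `` {a}) y"
    unfolding minimal_in_def
  proof (intro conjI ballI impI)
    show "y \<in> same_image `` {a}" using a y p_idem by (simp add: same_image_def)
    fix z assume z: "z \<in> same_image `` {a}" "z \<sqsubseteq> y"
    then have zc: "z \<in> carrier L" "p a = p z" by (auto simp: same_image_def)
    then show "z = y" using z(2) p_le[of z] a y by (intro le_antisym) auto
  qed
qed

lemma bottom_elements_same_image: "bottom_elements L same_image = K"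
proof (intro subset_antisym subsetI)
  fix x assume "x \<in> bottom_elements L same_image"
  then obtain X where X: "X \<in> carrier L // same_image" "\<forall>y. minimal_in L X y \<longleftrightarrow> y = x"
    by (auto simp: bottom_elements_def)
  then obtain a where a: "a \<in> carrier L" "X = same_image `` {a}" by (auto elim: quotientE)
  then have "x = p a" using X(2) minimal_in_class[OF a(1)] by blast
  then show "x \<in> K" using p_in a by simp
next
  fix k assume k: "k \<in> K"
  then have "\<forall>y. minimal_in L (same_image `` {k}) y \<longleftrightarrow> y = k"
    using minimal_in_class[OF K_closed[OF k]] p_fixed by simp
  then show "k \<in> bottom_elements L same_image"
    unfolding bottom_elements_def using quotientI[OF K_closed[OF k], of same_image] by blast
qed

abbreviation restricted :: "('a, 'b) gorder_scheme" where
  "restricted \<equiv> L\<lparr>carrier := K\<rparr>"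

lemma restricted_partial_order: "partial_order restricted"
proof -
  have eq: "(.=\<^bsub>restricted\<^esub>) = (=)" by (simp add: eq_is_equal)
  show ?thesis
    by (unfold_locales, unfold eq) (auto intro: le_antisym le_trans K_closed)
qed

lemma restricted_least:
  assumes x: "x \<in> K" and y: "y \<in> K"
  shows "least restricted (x \<squnion> y) (Upper restricted {x, y})"
proof (rule least_UpperI)
  note c = K_closed[OF x] K_closed[OF y]
  have "p (x \<squnion> y) = x \<squnion> y" using p_join[OF c] p_fixed x y by simp
  then show j: "x \<squnion> y \<in> carrier restricted" using p_in[of "x \<squnion> y"] c by simp
  show "z \<sqsubseteq>\<^bsub>restricted\<^esub> x \<squnion> y" if "z \<in> {x, y}" for z using that c join_left join_right by auto
  show "x \<squnion> y \<sqsubseteq>\<^bsub>restricted\<^esub> z" if "z \<in> Upper restricted {x, y}" for z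
    using that x y c K_closed by (auto simp: Upper_def intro!: join_le)
qed (use x y in auto)

lemma restricted_greatest:
  assumes x: "x \<in> K" and y: "y \<in> K"
  shows "greatest restricted (p (x \<sqinter> y)) (Lower restricted {x, y})"
proof (rule greatest_LowerI)
  note c = K_closed[OF x] K_closed[OF y]
  show "p (x \<sqinter> y) \<in> carrier restricted" using p_in[of "x \<sqinter> y"] c by simp
  show "p (x \<sqinter> y) \<sqsubseteq>\<^bsub>restricted\<^esub> z" if "z \<in> {x, y}" for z
  proof -
    have "p (x \<sqinter> y) \<sqsubseteq> x" "p (x \<sqinter> y) \<sqsubseteq> y"
      using le_trans[OF p_le meet_left] le_trans[OF p_le meet_right] c by auto
    then show ?thesis using that by auto
  qed
  show "z \<sqsubseteq>\<^bsub>restricted\<^esub> p (x \<sqinter> y)" if z: "z \<in> Lower restricted {x, y}" for z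
  proof -
    have zz: "z \<in> K" "z \<sqsubseteq> x" "z \<sqsubseteq> y" using z x y by (auto simp: Lower_def)
    then have "z \<sqsubseteq> x \<sqinter> y" using c K_closed by (intro meet_le) auto
    then show ?thesis using p_greatest[of "x \<sqinter> y" z] zz c by simp
  qed
qed (use x y in auto)

lemma restricted_lattice: "lattice restricted"
proof -
  interpret R: partial_order restricted by (rule restricted_partial_order)
  show ?thesis
  proof (unfold_locales)
    fix x y assume "x \<in> carrier restricted" "y \<in> carrier restricted"
    then have k: "x \<in> K" "y \<in> K" by simp_all
    show "\<exists>s. least restricted s (Upper restricted {x, y})" by (rule exI, rule restricted_least[OF k])
    show "\<exists>s. greatest restricted s (Lower restricted {x, y})" by (rule exI, rule restricted_greatest[OF k])
  qed
qed

lemma restricted_isomorphic: "lattice_isomorphic restricted (quotient_lattice L same_image)"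
proof -
  let ?Q = "quotient_lattice L same_image" and ?f = "\<lambda>k. same_image `` {k}"
  interpret C: lattice_congruence L same_image by (rule same_image_congruence)
  interpret R: lattice restricted by (rule restricted_lattice)
  have cls: "?f x = ?f y \<longleftrightarrow> p x = p y" if "x \<in> carrier L" "y \<in> carrier L" for x y
    using C.class_eq_iff[OF that] that by (simp add: same_image_def)
  have inQ: "?f x \<in> carrier ?Q" if "x \<in> carrier L" for x
    using that by (simp add: quotient_lattice_def quotientI)
  have join: "x \<squnion>\<^bsub>restricted\<^esub> y = x \<squnion> y" if "x \<in> K" "y \<in> K" for x y
    using R.joinI[of x y "\<lambda>z. z = x \<squnion> y"] R.least_unique[OF _ restricted_least[OF that]] that by simp
  have meet: "x \<sqinter>\<^bsub>restricted\<^esub> y = p (x \<sqinter> y)" if "x \<in> K" "y \<in> K" for x y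
    using R.meetI[of x y "\<lambda>z. z = p (x \<sqinter> y)"] R.greatest_unique[OF _ restricted_greatest[OF that]] that by simp
  have bij: "bij_betw ?f (carrier restricted) (carrier ?Q)"
  proof (rule bij_betw_imageI)
    show "inj_on ?f (carrier restricted)"
      by (rule inj_onI) (use cls K_closed p_fixed in auto)
    show "?f ` carrier restricted = carrier ?Q"
    proof (intro subset_antisym subsetI)
      fix X assume "X \<in> ?f ` carrier restricted"
      then show "X \<in> carrier ?Q" using inQ K_closed by auto
    next
      fix X assume "X \<in> carrier ?Q"
      then obtain a where a: "a \<in> carrier L" "X = ?f a" by (auto simp: quotient_lattice_def elim: quotientE)
      then have "X = ?f (p a)" using cls[of a "p a"] p_idem by simp
      then show "X \<in> ?f ` carrier restricted" using p_in[OF a(1)] by auto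
    qed
  qed
  have "?f (x \<sqinter>\<^bsub>restricted\<^esub> y) = ?f x \<sqinter>\<^bsub>?Q\<^esub> ?f y" if xy: "x \<in> K" "y \<in> K" for x y
  proof -
    note c = K_closed[OF xy(1)] K_closed[OF xy(2)]
    have "?f (p (x \<sqinter> y)) = ?f (x \<sqinter> y)" using cls[of "p (x \<sqinter> y)" "x \<sqinter> y"] p_idem c by simp
    also have "\<dots> = ?f x \<sqinter>\<^bsub>?Q\<^esub> ?f y"
      using C.quotient_meet_join(1)[OF inQ inQ, OF c] C.quotient_meet_class[OF c] by simp
    finally show ?thesis using meet xy by simp
  qed
  moreover have "?f (x \<squnion>\<^bsub>restricted\<^esub> y) = ?f x \<squnion>\<^bsub>?Q\<^esub> ?f y" if xy: "x \<in> K" "y \<in> K" for x y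
  proof -
    note c = K_closed[OF xy(1)] K_closed[OF xy(2)]
    show ?thesis
      using C.quotient_meet_join(2)[OF inQ inQ, OF c] C.quotient_join_class[OF c] join[OF xy] by simp
  qed
  ultimately show ?thesis
    unfolding lattice_isomorphic_def meet_pres_def join_pres_def
    using bij restricted_lattice C.quotient_is_lattice by (intro exI[of _ ?f]) simp
qed

end

context finite_coxeter_system
begin

section \<open>The weak order\<close>

abbreviation weak :: "'a gorder" where "weak \<equiv> weak_order W S"

lemma weak_carrier: "carrier weak = carrier W"
  by (simp add: weak_order_def)

lemma weak_le: "x \<in> carrier W \<Longrightarrow> y \<in> carrier W \<Longrightarrow> x \<sqsubseteq>\<^bsub>weak\<^esub> y \<longleftrightarrow> N x \<subseteq> N y"
  using inversions_subset_iff[of x y] by (simp add: weak_order_def)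

lemma weak_partial_order: "partial_order weak"
proof -
  have eq: "(.=\<^bsub>weak\<^esub>) = (=)" by (simp add: weak_order_def)
  show ?thesis
  proof (unfold_locales, unfold eq weak_carrier)
    fix x y assume "x \<sqsubseteq>\<^bsub>weak\<^esub> y" "y \<sqsubseteq>\<^bsub>weak\<^esub> x" and c: "x \<in> carrier W" "y \<in> carrier W"
    then have "N x = N y" unfolding weak_le[OF c] weak_le[OF c(2,1)] by simp
    then show "x = y" by (rule inv_roots_inj[OF c])
  next
    fix x y z assume "x \<sqsubseteq>\<^bsub>weak\<^esub> y" "y \<sqsubseteq>\<^bsub>weak\<^esub> z"
      and c: "x \<in> carrier W" "y \<in> carrier W" "z \<in> carrier W"
    then show "x \<sqsubseteq>\<^bsub>weak\<^esub> z"
      unfolding weak_le[OF c(1,2)] weak_le[OF c(2,3)] weak_le[OF c(1,3)] by simp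
  qed (simp_all add: weak_le)
qed

lemma weak_least:
  assumes x: "x \<in> carrier W" and y: "y \<in> carrier W"
  shows "least weak (wjoin x y) (Upper weak {x, y})"
proof (rule least_UpperI)
  have j: "wjoin x y \<in> carrier W" using x y by simp
  then show "wjoin x y \<in> carrier weak" by (simp add: weak_carrier)
  show "z \<sqsubseteq>\<^bsub>weak\<^esub> wjoin x y" if "z \<in> {x, y}" for z
    using that wjoin_upper1[OF x y] wjoin_upper2[OF x y] weak_le[OF x j] weak_le[OF y j] by auto
  show "wjoin x y \<sqsubseteq>\<^bsub>weak\<^esub> z" if z: "z \<in> Upper weak {x, y}" for z
  proof -
    have zc: "z \<in> carrier W" "x \<sqsubseteq>\<^bsub>weak\<^esub> z" "y \<sqsubseteq>\<^bsub>weak\<^esub> z" using z x y by (auto simp: Upper_def weak_carrier)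
    then show ?thesis using wjoin_least[OF x y zc(1)] weak_le[OF x zc(1)] weak_le[OF y zc(1)] weak_le[OF j zc(1)] by simp
  qed
qed (use x y in \<open>auto simp: weak_carrier\<close>)

lemma weak_lattice: "lattice weak"
proof -
  interpret P: partial_order weak by (rule weak_partial_order)
  show ?thesis
  proof (unfold_locales)
    fix x y assume "x \<in> carrier weak" "y \<in> carrier weak"
    then have c: "x \<in> carrier W" "y \<in> carrier W" by (simp_all add: weak_carrier)
    show "\<exists>s. least weak s (Upper weak {x, y})" using weak_least[OF c] by blast
    obtain g where g: "g \<in> carrier W" "N g \<subseteq> N x" "N g \<subseteq> N y"
      "\<And>u. u \<in> carrier W \<Longrightarrow> N u \<subseteq> N x \<Longrightarrow> N u \<subseteq> N y \<Longrightarrow> N u \<subseteq> N g"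
      using ex_meet[OF c] by metis
    have "greatest weak g (Lower weak {x, y})"
    proof (rule greatest_LowerI)
      show "g \<in> carrier weak" using g(1) by (simp add: weak_carrier)
      show "g \<sqsubseteq>\<^bsub>weak\<^esub> z" if "z \<in> {x, y}" for z
        using that g(2,3) weak_le[OF g(1) c(1)] weak_le[OF g(1) c(2)] by auto
      show "z \<sqsubseteq>\<^bsub>weak\<^esub> g" if z: "z \<in> Lower weak {x, y}" for z
      proof -
        have zc: "z \<in> carrier W" "z \<sqsubseteq>\<^bsub>weak\<^esub> x" "z \<sqsubseteq>\<^bsub>weak\<^esub> y" using z c by (auto simp: Lower_def weak_carrier)
        then show ?thesis using g(4)[OF zc(1)] weak_le[OF zc(1) c(1)] weak_le[OF zc(1) c(2)] weak_le[OF zc(1) g(1)] by simp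
      qed
    qed (use c in \<open>auto simp: weak_carrier\<close>)
    then show "\<exists>s. greatest weak s (Lower weak {x, y})" by blast
  qed
qed

lemma weak_join:
  assumes "x \<in> carrier W" "y \<in> carrier W"
  shows "x \<squnion>\<^bsub>weak\<^esub> y = wjoin x y"
proof -
  interpret L: lattice weak by (rule weak_lattice)
  show ?thesis
    using L.joinI[of x y "\<lambda>z. z = wjoin x y"] L.least_unique[OF _ weak_least[OF assms]] assms
    by (simp add: weak_carrier)
qed

lemma aligned_interior_operator:
  assumes g: "distinct_gens as"
  shows "interior_operator weak {w. aligned as w} (proj as)"
proof -
  interpret L: lattice weak by (rule weak_lattice)
  show ?thesis
  proof (unfold_locales)
    show "{w. aligned as w} \<subseteq> carrier weak" using aligned_closed by (auto simp: weak_carrier)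
  next
    fix x assume "x \<in> carrier weak"
    then have x: "x \<in> carrier W" by (simp add: weak_carrier)
    show "proj as x \<in> {w. aligned as w}" using proj_aligned[OF g x] by simp
    show "proj as x \<sqsubseteq>\<^bsub>weak\<^esub> x" using proj_le[OF g x] weak_le[OF proj_closed[OF g x] x] by simp
  next
    fix x k assume "x \<in> carrier weak" "k \<in> {w. aligned as w}" "k \<sqsubseteq>\<^bsub>weak\<^esub> x"
    then have x: "x \<in> carrier W" and k: "aligned as k" "k \<sqsubseteq>\<^bsub>weak\<^esub> x" by (simp_all add: weak_carrier)
    have kc: "k \<in> carrier W" by (rule aligned_closed[OF k(1)])
    have "N k \<subseteq> N x" using k(2) weak_le[OF kc x] by simp
    then show "k \<sqsubseteq>\<^bsub>weak\<^esub> proj as x" using proj_max[OF g x k(1)] weak_le[OF kc proj_closed[OF g x]] by simp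
  next
    fix x y assume "x \<in> carrier weak" "y \<in> carrier weak"
    then have c: "x \<in> carrier W" "y \<in> carrier W" by (simp_all add: weak_carrier)
    have pc: "proj as x \<in> carrier W" "proj as y \<in> carrier W" using g c by simp_all
    show "proj as (x \<squnion>\<^bsub>weak\<^esub> y) \<sqsubseteq>\<^bsub>weak\<^esub> proj as x \<squnion>\<^bsub>weak\<^esub> proj as y"
      unfolding weak_join[OF c] weak_join[OF pc]
      using proj_wjoin[OF g c] weak_le[OF proj_closed[OF g wjoin_closed[OF c]] wjoin_closed[OF pc]] by simp
  qed
qed

end

theorem theorem1p1:
  fixes W :: "('a, 'b) monoid_scheme" and S :: "'a set" and m :: "'a \<Rightarrow> 'a \<Rightarrow> enat" and c :: 'a
  assumes "coxeter_system W S m"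
    and "finite (carrier W)"
    and "coxeter_element W S c"
  shows "\<exists>\<Theta>. lattice_congruence (weak_order W S) \<Theta> \<and>
              bottom_elements (weak_order W S) \<Theta> = {w. c_sortable W S c w} \<and>
              lattice_isomorphic
                ((weak_order W S)\<lparr>carrier := {w. c_sortable W S c w}\<rparr>)
                (quotient_lattice (weak_order W S) \<Theta>)"
proof -
  interpret finite_coxeter_system W S m
    using assms(1,2) by (intro finite_coxeter_system.intro finite_coxeter_system_axioms.intro)
  obtain as where as: "coxeter_word W S c as" using assms(3) by (auto simp: coxeter_element_def)
  have sortable: "{w. c_sortable W S c w} = {w. aligned as w}" using c_sortable_iff_aligned[OF as] by simp
  interpret I: interior_operator "weak_order W S" "{w. aligned as w}" "proj as"
    by (rule aligned_interior_operator[OF coxeter_word_distinct_gens[OF as]])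
  show ?thesis
    unfolding sortable
    using I.same_image_congruence I.bottom_elements_same_image I.restricted_isomorphic by blast
qed

end
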